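(* $M_\Omega$ is a free $\mathcal{D}$-module of rank $2$ generated by two functions from $M_\Omega(1)$.
   Context: Let $\Omega=\mathbb{C}P^1\times\mathbb{C}P^1/\{(1:0,t_1:t_2)\sim(t_1:t_2,0:1)\}$, the variety obtained from $\mathbb{C}P^1\times\mathbb{C}P^1$ (homogeneous coordinates $(z_1:z_2,w_1:w_2)$) by identifying $(1:0,t)$ with $(t,0:1)$ for all $t\in\mathbb{C}P^1$. Fix $B\in\mathbb{C}^*$ and $g(z_1,z_2,w_1,w_2)=\alpha z_1w_1+\beta z_1w_2+\gamma z_2w_1+\delta z_2w_2$ with $\alpha,\beta,\gamma,\delta\in\mathbb{C}$, such that $g(1,0,t_1,t_2)-B\,g(t_1,t_2,0,1)=0$ for all $(t_1,t_2)\in\mathbb{C}^2$ and $g(0,1,0,1)\neq0$. Let $g_i(z_1,z_2,w_1,w_2)=\alpha_iz_1w_1+\beta_iz_1w_2+\gamma_iz_2w_1+\delta_iz_2w_2$, $i=1,2$, be such that for some $c_i\in\mathbb{C}$ one has $g_i(1,0,t_1,t_2)-B\,g_i(t_1,t_2,0,1)-c_i\,g(1,0,t_1,t_2)=0$ for all $(t_1,t_2)\in\mathbb{C}^2$ (equivalently $\frac{g_i(1,0,t_1,t_2)}{g(1,0,t_1,t_2)}-\frac{g_i(t_1,t_2,0,1)}{g(t_1,t_2,0,1)}=c_i$). Assume that $g,g_1,g_2$ are linearly independent and that for $i=1,2$ $$(\gamma\delta_i-\gamma_i\delta)^2+2\gamma\delta c_i(\gamma\delta_i-\gamma_i\delta)+\delta^2(\gamma-2B\delta)^2c_i^2\neq0.$$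 Put $G_i(P)=g_i(P)/g(P)$. Let $(x_0,y_0)\in\mathbb{C}^2$ be a fixed point, let $\mathcal{O}$ be the ring of analytic functions of $(x,y)$ in a neighbourhood of $(x_0,y_0)$, and $\mathcal{D}=\mathcal{O}[\partial_x,\partial_y]$. Fix $\Lambda\in\mathbb{C}$. For $k\geq1$ let $M_\Omega(k)$ be the set of functions $$\varphi(x,y,P)=\frac{\tilde h(x,y,P)}{g^k(P)}\exp\big(xG_1(P)+yG_2(P)\big),$$ where $P=(z_1:z_2,w_1:w_2)$ and $\tilde h(x,y,P)$ is a bihomogeneous polynomial of bidegree $(k,k)$ in $(z_1,z_2)$ and $(w_1,w_2)$ with coefficients in $\mathcal{O}$, satisfying $\varphi(x,y,1:0,t_1:t_2)-\Lambda\varphi(x,y,t_1:t_2,0:1)=0$ for all $(t_1:t_2)\in\mathbb{C}P^1$. Put $M_\Omega=\bigcup_{k\ge1}M_\Omega(k)$, a module over $\mathcal{D}$ (operators act in $x,y$).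
   Formalization: The formal theorem adds the condition Λ ≠ exp(c_1 x_0 + c_2 y_0) on the fixed point (x_0,y_0); at points where equality holds, no two functions from M_Ω(1) form a basis of M_Ω, so the claim as printed fails there. *)

theory Defs
  imports "HOL-Analysis.Analysis" "HOL-Algebra.Module" "HOL-Algebra.Generated_Rings"
begin

section \<open>Left modules over a ring that need not be commutative\<close>

text \<open>The library locale \<^locale>\<open>module\<close> asks for a commutative ring of scalars; the axioms below are
  the same ones over an arbitrary ring.\<close>

locale left_module = R?: ring R + M?: abelian_group M
  for R :: "('r, 'x) ring_scheme" (structure)
    and M :: "('r, 'm, 'y) module_scheme" (structure) +
  assumes smult_closed:
      "\<lbrakk> a \<in> carrier R; x \<in> carrier M \<rbrakk> \<Longrightarrow> a \<odot>\<^bsub>M\<^esub> x \<in> carrier M"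
    and smult_l_distr:
      "\<lbrakk> a \<in> carrier R; b \<in> carrier R; x \<in> carrier M \<rbrakk> \<Longrightarrow>
      (a \<oplus>\<^bsub>R\<^esub> b) \<odot>\<^bsub>M\<^esub> x = (a \<odot>\<^bsub>M\<^esub> x) \<oplus>\<^bsub>M\<^esub> (b \<odot>\<^bsub>M\<^esub> x)"
    and smult_r_distr:
      "\<lbrakk> a \<in> carrier R; x \<in> carrier M; y \<in> carrier M \<rbrakk> \<Longrightarrow>
      a \<odot>\<^bsub>M\<^esub> (x \<oplus>\<^bsub>M\<^esub> y) = (a \<odot>\<^bsub>M\<^esub> x) \<oplus>\<^bsub>M\<^esub> (a \<odot>\<^bsub>M\<^esub> y)"
    and smult_assoc1:
      "\<lbrakk> a \<in> carrier R; b \<in> carrier R; x \<in> carrier M \<rbrakk> \<Longrightarrow>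
      (a \<otimes>\<^bsub>R\<^esub> b) \<odot>\<^bsub>M\<^esub> x = a \<odot>\<^bsub>M\<^esub> (b \<odot>\<^bsub>M\<^esub> x)"
    and smult_one:
      "x \<in> carrier M \<Longrightarrow> \<one>\<^bsub>R\<^esub> \<odot>\<^bsub>M\<^esub> x = x"

definition module_basis ::
    "('r, 'x) ring_scheme \<Rightarrow> ('r, 'm, 'y) module_scheme \<Rightarrow> nat \<Rightarrow> (nat \<Rightarrow> 'm) \<Rightarrow> bool" where
  "module_basis R M n b \<longleftrightarrow>
     (\<forall>i<n. b i \<in> carrier M) \<and>
     (\<forall>m\<in>carrier M. \<exists>!r. r \<in> {..<n} \<rightarrow>\<^sub>E carrier R \<and>
        m = finsum M (\<lambda>i. r i \<odot>\<^bsub>M\<^esub> b i) {..<n})"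

section \<open>The ring of germs of analytic functions of two complex variables\<close>

type_synonym fun2 = "complex \<times> complex \<Rightarrow> complex"

text \<open>As for \<^const>\<open>analytic_on\<close> in one variable: complex differentiability at every point of
  a neighbourhood. The derivative has to be complex linear.\<close>

definition analytic_near :: "complex \<times> complex \<Rightarrow> fun2 \<Rightarrow> bool" where
  "analytic_near p f \<longleftrightarrow>
     (\<exists>e>0. \<forall>q\<in>ball p e. \<exists>a b. (f has_derivative (\<lambda>(u, v). a * u + b * v)) (at q))"

definition germ :: "complex \<times> complex \<Rightarrow> fun2 \<Rightarrow> fun2 set" where
  "germ p f = {h. \<forall>\<^sub>F q in nhds p. h q = f q}"

definition analytic_germs :: "complex \<times> complex \<Rightarrow> fun2 set ring" where
  "analytic_germs p =
     \<lparr> carrier = germ p ` {f. analytic_near p f},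
       mult = (\<lambda>a b. {h. \<exists>f\<in>a. \<exists>g\<in>b. \<forall>\<^sub>F q in nhds p. h q = f q * g q}),
       one = germ p (\<lambda>_. 1),
       zero = germ p (\<lambda>_. 0),
       add = (\<lambda>a b. {h. \<exists>f\<in>a. \<exists>g\<in>b. \<forall>\<^sub>F q in nhds p. h q = f q + g q}) \<rparr>"

definition germ_dx :: "complex \<times> complex \<Rightarrow> fun2 set \<Rightarrow> fun2 set" where
  "germ_dx p a = {h. \<exists>f\<in>a. \<forall>\<^sub>F q in nhds p. h q = deriv (\<lambda>x. f (x, snd q)) (fst q)}"

definition germ_dy :: "complex \<times> complex \<Rightarrow> fun2 set \<Rightarrow> fun2 set" where
  "germ_dy p a = {h. \<exists>f\<in>a. \<forall>\<^sub>F q in nhds p. h q = deriv (\<lambda>y. f (fst q, y)) (snd q)}"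

section \<open>The ring of differential operators\<close>

definition additive_endomorphisms :: "('a, 'b) ring_scheme \<Rightarrow> ('a \<Rightarrow> 'a) ring" where
  "additive_endomorphisms R =
     \<lparr> carrier = {T \<in> carrier R \<rightarrow>\<^sub>E carrier R.
                   \<forall>a\<in>carrier R. \<forall>b\<in>carrier R. T (a \<oplus>\<^bsub>R\<^esub> b) = T a \<oplus>\<^bsub>R\<^esub> T b},
       mult = compose (carrier R),
       one = (\<lambda>a\<in>carrier R. a),
       zero = (\<lambda>a\<in>carrier R. \<zero>\<^bsub>R\<^esub>),
       add = (\<lambda>S T. \<lambda>a\<in>carrier R. S a \<oplus>\<^bsub>R\<^esub> T a) \<rparr>"

text \<open>The ring of differential operators with analytic coefficients is the ring of endomorphisms
  of the germs at \<open>p\<close> that is generated by the multiplications and the two partial derivatives.\<close>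

definition diff_ops :: "complex \<times> complex \<Rightarrow> (fun2 set \<Rightarrow> fun2 set) ring" where
  "diff_ops p =
     (let R = analytic_germs p; E = additive_endomorphisms R in
      E\<lparr> carrier := generate_ring E
           ({\<lambda>b\<in>carrier R. a \<otimes>\<^bsub>R\<^esub> b | a. a \<in> carrier R} \<union>
            {restrict (germ_dx p) (carrier R), restrict (germ_dy p) (carrier R)}) \<rparr>)"

section \<open>The projective line and forms of bidegree (k,k)\<close>

definition proj_rel :: "complex \<times> complex \<Rightarrow> complex \<times> complex \<Rightarrow> bool" where
  "proj_rel u v \<longleftrightarrow> u \<noteq> 0 \<and> v \<noteq> 0 \<and> (\<exists>c. c \<noteq> 0 \<and> v = (c * fst u, c * snd u))"

quotient_type cp1 = "complex \<times> complex" / partial: proj_rel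
proof (rule part_equivpI)
  show "\<exists>u. proj_rel u u"
    by (rule exI[of _ "(1, 1)"]) (auto simp: proj_rel_def zero_prod_def intro!: exI[of _ 1])
  show "symp proj_rel"
  proof (rule sympI)
    fix u v assume "proj_rel u v"
    then obtain c where "u \<noteq> 0" "v \<noteq> 0" "c \<noteq> 0" "v = (c * fst u, c * snd u)"
      by (auto simp: proj_rel_def)
    then show "proj_rel v u"
      unfolding proj_rel_def by (auto simp: prod_eq_iff intro!: exI[of _ "inverse c"])
  qed
  show "transp proj_rel"
  proof (rule transpI)
    fix u v w assume "proj_rel u v" "proj_rel v w"
    then obtain c d where "u \<noteq> 0" "w \<noteq> 0" "c \<noteq> 0" "v = (c * fst u, c * snd u)"
      "d \<noteq> 0" "w = (d * fst v, d * snd v)"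
      by (auto simp: proj_rel_def)
    then show "proj_rel u w"
      unfolding proj_rel_def by (auto intro!: exI[of _ "d * c"])
  qed
qed

text \<open>The point \<open>(z\<^sub>1 : z\<^sub>2)\<close>; meaningful only when the coordinates are not both zero.\<close>

definition pt :: "complex \<Rightarrow> complex \<Rightarrow> cp1" where
  "pt z1 z2 = abs_cp1 (z1, z2)"

type_synonym form = "complex \<Rightarrow> complex \<Rightarrow> complex \<Rightarrow> complex \<Rightarrow> complex"

definition bilinear_form :: "complex \<Rightarrow> complex \<Rightarrow> complex \<Rightarrow> complex \<Rightarrow> form" where
  "bilinear_form a b c d z1 z2 w1 w2 = a * z1 * w1 + b * z1 * w2 + c * z2 * w1 + d * z2 * w2"

definition bihom_form :: "nat \<Rightarrow> (nat \<Rightarrow> nat \<Rightarrow> complex) \<Rightarrow> form" where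
  "bihom_form k a z1 z2 w1 w2 =
     (\<Sum>i\<le>k. \<Sum>j\<le>k. a i j * z1 ^ i * z2 ^ (k - i) * w1 ^ j * w2 ^ (k - j))"

text \<open>The complement of the curve \<open>g = 0\<close>. A nonzero value of \<open>g\<close> forces both coordinate pairs to
  be nonzero when \<open>g\<close> is a bilinear form.\<close>

definition nonvanishing :: "form \<Rightarrow> (cp1 \<times> cp1) set" where
  "nonvanishing g = {(pt z1 z2, pt w1 w2) | z1 z2 w1 w2. g z1 z2 w1 w2 \<noteq> 0}"

section \<open>The Baker-Akhiezer module\<close>

text \<open>A function \<open>\<phi>(x, y, P)\<close> is regarded as the map sending a point \<open>P\<close> outside the curve
  \<open>g = 0\<close> to the germ of \<open>(x, y) \<mapsto> \<phi>(x, y, P)\<close> at \<open>p\<close>. The coefficients of the numerator, finitely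
  many, are independent of \<open>P\<close>, so all these germs live on a common neighbourhood of \<open>p\<close>.\<close>

definition BA_space ::
    "form \<Rightarrow> form \<Rightarrow> form \<Rightarrow> complex \<Rightarrow> complex \<times> complex \<Rightarrow> nat \<Rightarrow> (cp1 \<times> cp1 \<Rightarrow> fun2 set) set" where
  "BA_space g g1 g2 \<Lambda> p k =
     {\<phi> \<in> nonvanishing g \<rightarrow>\<^sub>E carrier (analytic_germs p).
        (\<exists>h :: nat \<Rightarrow> nat \<Rightarrow> fun2.
           (\<forall>i\<le>k. \<forall>j\<le>k. analytic_near p (h i j)) \<and>
           (\<forall>z1 z2 w1 w2. g z1 z2 w1 w2 \<noteq> 0 \<longrightarrow>
              \<phi> (pt z1 z2, pt w1 w2) =
                germ p (\<lambda>(x, y).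
                  bihom_form k (\<lambda>i j. h i j (x, y)) z1 z2 w1 w2 / g z1 z2 w1 w2 ^ k *
                  exp (x * (g1 z1 z2 w1 w2 / g z1 z2 w1 w2) +
                       y * (g2 z1 z2 w1 w2 / g z1 z2 w1 w2))))) \<and>
        (\<forall>t. (pt 1 0, t) \<in> nonvanishing g \<and> (t, pt 0 1) \<in> nonvanishing g \<longrightarrow>
           \<phi> (pt 1 0, t) = germ p (\<lambda>_. \<Lambda>) \<otimes>\<^bsub>analytic_germs p\<^esub> \<phi> (t, pt 0 1))}"

text \<open>Operators act pointwise in \<open>P\<close>. The fields \<^const>\<open>mult\<close> and \<^const>\<open>one\<close>, which the record
  type of modules inherits from rings, play no role.\<close>

definition BA_module ::
    "form \<Rightarrow> form \<Rightarrow> form \<Rightarrow> complex \<Rightarrow> complex \<times> complex \<Rightarrow>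
     (fun2 set \<Rightarrow> fun2 set, cp1 \<times> cp1 \<Rightarrow> fun2 set) module" where
  "BA_module g g1 g2 \<Lambda> p =
     \<lparr> carrier = (\<Union>k\<in>{1..}. BA_space g g1 g2 \<Lambda> p k),
       mult = undefined,
       one = undefined,
       zero = (\<lambda>P\<in>nonvanishing g. \<zero>\<^bsub>analytic_germs p\<^esub>),
       add = (\<lambda>\<phi> \<psi>. \<lambda>P\<in>nonvanishing g. \<phi> P \<oplus>\<^bsub>analytic_germs p\<^esub> \<psi> P),
       smult = (\<lambda>T \<phi>. \<lambda>P\<in>nonvanishing g. T (\<phi> P)) \<rparr>"

text \<open>Restricted to the identified curves, the exponentials differ by the factor
  \<open>exp (c\<^sub>1 x + c\<^sub>2 y)\<close>. At a base point \<open>(x\<^sub>0, y\<^sub>0)\<close> with \<open>\<Lambda> = exp (c\<^sub>1 x\<^sub>0 + c\<^sub>2 y\<^sub>0)\<close> the numerator \<open>g\<close>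
  satisfies the gluing condition to zeroth order, and a suitable element of the level \<open>k = 1\<close> has
  numerator equal to \<open>g\<close> at the base point. Its derivatives then do not raise the order of the
  pole there, and no two functions of level 1 form a basis of the module. Freeness on functions
  of level 1 is therefore a statement about base points off this locus.\<close>

end

theory Submission
  imports Defs "HOL-Complex_Analysis.Complex_Analysis"
begin

text \<open>The reason for the theorem is that the functions without the gluing condition form the free module of
rank two on \<open>exp\<close> and \<open>w exp\<close> over the differential operators, where \<open>exp\<close> is
\<open>exp (x G\<^sub>1 + y G\<^sub>2)\<close>; inside it the gluing condition cuts out a free submodule whose basis can be
written down.

The condition on \<open>g\<close> forces \<open>\<beta> = B \<delta>\<close> and \<open>\<alpha> = B\<^sup>2 \<delta>\<close>, and the conditions on the \<open>g\<^sub>i\<close> turn the exponents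
into \<open>G\<^sub>i = k\<^sub>i + c\<^sub>i \<delta> u + e\<^sub>i v\<close> with \<open>u = (2 B\<^sup>2 z\<^sub>1 w\<^sub>1 + B z\<^sub>1 w\<^sub>2) / g\<close> and \<open>v = z\<^sub>2 w\<^sub>1 / g\<close>. Linear independence
of \<open>g, g\<^sub>1, g\<^sub>2\<close> says that \<open>c\<^sub>1 e\<^sub>2 - c\<^sub>2 e\<^sub>1\<close> is not zero, so suitable operators \<open>X, Y\<close> of order one with
constant coefficients satisfy \<open>X exp = u exp\<close> and \<open>Y exp = v exp\<close>.

The complement of the curve \<open>g = 0\<close> is an affine quadric: its coordinate ring is generated by \<open>u\<close>, \<open>v\<close>
and \<open>w = z\<^sub>1 w\<^sub>1 / g\<close>, and the Segre relation is a quadratic equation for \<open>w\<close> over the polynomials in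
\<open>u, v\<close> with constant leading coefficient. Hence a form of bidegree \<open>(k,k)\<close> divided by \<open>g\<^sup>k\<close> is \<open>a + w b\<close>
with polynomials \<open>a, b\<close> in \<open>u, v\<close>, and a function \<open>h / g\<^sup>k exp\<close> is \<open>T exp + w S exp\<close> with differential
operators \<open>T, S\<close> (\<open>form_family_imp_op_family\<close>, \<open>op_family_imp_form_family\<close>). Every operator is a polynomial
in \<open>X, Y\<close> with analytic coefficients on the left (\<open>ore_normal_form\<close>), and over a generic point \<open>(u, v)\<close>
there are two points of the surface with different \<open>w\<close>. So \<open>T\<close> and \<open>S\<close> are unique
(\<open>representation_unique\<close>).

On the two curves that are identified, \<open>v\<close> vanishes, \<open>u\<close> differs by \<open>1/\<delta>\<close>, and the two exponentials differ
by the factor \<open>exp (c\<^sub>1 x + c\<^sub>2 y)\<close>. Put \<open>\<mu> = \<Lambda> exp (- c\<^sub>1 x - c\<^sub>2 y)\<close>. Solving the gluing condition for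
\<open>k = 1\<close> gives \<open>\<phi>\<^sub>1 = v exp = Y exp\<close> and
\<open>\<phi>\<^sub>0 = (z\<^sub>2 w\<^sub>2 + \<mu> B z\<^sub>1 w\<^sub>2 + \<mu>\<^sup>2 B\<^sup>2 z\<^sub>1 w\<^sub>1) / g exp\<close>. In the form \<open>T exp + w S exp\<close> the operator \<open>S\<close> of
\<open>\<phi>\<^sub>0\<close> is the multiplication by \<open>B\<^sup>2 (\<mu> - 1)\<^sup>2\<close>, and this function is invertible near the base point exactly
because \<open>\<Lambda> \<noteq> exp (c\<^sub>1 x\<^sub>0 + c\<^sub>2 y\<^sub>0)\<close>.

Given an element \<open>T exp + w S exp\<close> of the module, a multiple of \<open>\<phi>\<^sub>0\<close> removes \<open>S\<close>. What is left is
\<open>T' exp\<close> with \<open>T' = \<Sum> a\<^sub>i\<^sub>j X\<^sup>i Y\<^sup>j\<close>, and the gluing condition for it is an identity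
\<open>A (s + 1/\<delta>) = \<mu> A (s)\<close> for the polynomial \<open>A = \<Sum> a\<^sub>i\<^sub>0 s\<^sup>i\<close>. Comparison of leading coefficients gives
\<open>A = 0\<close> since \<open>\<mu> \<noteq> 1\<close>. So \<open>T'\<close> is divisible by \<open>Y\<close> on the right and \<open>T' exp\<close> is a multiple of \<open>\<phi>\<^sub>1\<close>
(\<open>glued_divisible_by_Y\<close>, \<open>basis_exists\<close>). Uniqueness of the coefficients follows from the uniqueness of
\<open>T, S\<close>, the invertibility of \<open>B\<^sup>2 (\<mu> - 1)\<^sup>2\<close> and the fact that \<open>Y\<close> can be cancelled on the right
(\<open>basis_unique\<close>).\<close>

section \<open>Partial derivatives of analytic functions of two variables\<close>

definition dx :: "fun2 \<Rightarrow> fun2" where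
  "dx f q = deriv (\<lambda>x. f (x, snd q)) (fst q)"

definition dy :: "fun2 \<Rightarrow> fun2" where
  "dy f q = deriv (\<lambda>y. f (fst q, y)) (snd q)"

text \<open>Osgood's description of analyticity: it splits into statements about one variable, to which Cauchy's
formula applies, and is equivalent to complex differentiability in both variables
(\<open>analytic_near_iff_separately_holomorphic\<close>).\<close>

definition separately_holomorphic :: "complex set \<Rightarrow> complex set \<Rightarrow> fun2 \<Rightarrow> bool" where
  "separately_holomorphic U V f \<longleftrightarrow>
     continuous_on (U \<times> V) f \<and>
     (\<forall>y\<in>V. (\<lambda>x. f (x, y)) holomorphic_on U) \<and>
     (\<forall>x\<in>U. (\<lambda>y. f (x, y)) holomorphic_on V)"

lemma separately_holomorphic_swap:
  "separately_holomorphic U V f \<Longrightarrow> separately_holomorphic V U (f \<circ> prod.swap)"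
  unfolding separately_holomorphic_def
  using continuous_on_compose[OF continuous_on_swap, of "V \<times> U" f] by (auto simp: product_swap o_def)

lemma dx_swap: "dx (f \<circ> prod.swap) (y, x) = dy f (x, y)"
  by (simp add: dx_def dy_def)

text \<open>The factor by which a boundary value at the parameter \<open>t\<close> of the circle is multiplied in Cauchy's integral
for the first derivative at \<open>x\<close>. Cauchy's formula becomes an integral over \<open>{0..1}\<close>, so that the rules for
integrals with parameters apply.\<close>

definition cauchy_kernel :: "complex \<Rightarrow> real \<Rightarrow> complex \<Rightarrow> real \<Rightarrow> complex" where
  "cauchy_kernel z r x t =
     vector_derivative (circlepath z r) (at t) / (2 * of_real pi * \<i> * (circlepath z r t - x)\<^sup>2)"

lemma circlepath_in_sphere:
  "circlepath z r t \<in> sphere z \<bar>r\<bar>"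
  by (simp add: circlepath dist_norm norm_mult)

lemma continuous_cauchy_kernel:
  assumes "0 < r"
  shows "continuous_on (ball z r \<times> UNIV) (\<lambda>(x, t). cauchy_kernel z r x t)"
proof -
  have "circlepath z r t \<noteq> x" if "x \<in> ball z r" for x t
    using that circlepath_in_sphere[of z r t] assms by auto
  then show ?thesis
    unfolding cauchy_kernel_def vector_derivative_circlepath case_prod_unfold
    by (auto simp: circlepath mem_Times_iff intro!: continuous_intros)
qed

lemma dx_eq_integral:
  assumes "separately_holomorphic U V f" "cball z r \<subseteq> U" "0 < r" "x \<in> ball z r" "y \<in> V"
  shows "dx f (x, y) = integral (cbox 0 1) (\<lambda>t. f (circlepath z r t, y) * cauchy_kernel z r x t)"
proof -
  have h: "(\<lambda>x. f (x, y)) holomorphic_on U"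
    using assms(1,5) by (simp add: separately_holomorphic_def)
  have "(\<lambda>x. f (x, y)) holomorphic_on cball z r"
    using h assms(2) by (rule holomorphic_on_subset)
  then have h': "continuous_on (cball z r) (\<lambda>x. f (x, y))" "(\<lambda>x. f (x, y)) holomorphic_on ball z r"
    using ball_subset_cball by (auto intro: holomorphic_on_subset holomorphic_on_imp_continuous_on)
  have "((\<lambda>u. f (u, y) / (u - x) ^ Suc 1) has_contour_integral
          ((2 * pi * \<i>) / (fact 1) * (deriv ^^ 1) (\<lambda>x. f (x, y)) x)) (circlepath z r)"
    by (rule Cauchy_has_contour_integral_higher_derivative_circlepath[OF h' assms(4)])
  from has_contour_integral_div[OF this, of "2 * pi * \<i>"]
  have "((\<lambda>u. f (u, y) / (u - x) ^ 2 / (2 * pi * \<i>)) has_contour_integral dx f (x, y)) (circlepath z r)"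
    by (simp add: dx_def numeral_2_eq_2)
  then have "((\<lambda>t. f (circlepath z r t, y) / (circlepath z r t - x) ^ 2 / (2 * pi * \<i>) *
       vector_derivative (circlepath z r) (at t within {0..1})) has_integral dx f (x, y)) {0..1}"
    by (simp add: has_contour_integral_def)
  then have "((\<lambda>t. f (circlepath z r t, y) * cauchy_kernel z r x t) has_integral dx f (x, y)) {0..1}"
    by (rule has_integral_eq[rotated])
       (simp add: cauchy_kernel_def vector_derivative_circlepath01 vector_derivative_circlepath field_simps)
  then show ?thesis
    by (simp add: integral_unique)
qed

lemma continuous_cauchy_integrand:
  assumes f: "continuous_on (U \<times> V) f" and sub: "cball z r \<subseteq> U" and r: "0 < r"
  shows "continuous_on ((ball z r \<times> V) \<times> cbox 0 1)
           (\<lambda>(q, t). f (circlepath z r t, snd q) * cauchy_kernel z r (fst q) t)"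
proof -
  have 1: "circlepath z r t \<in> U" for t
    using circlepath_in_sphere[of z r t] r sub by auto
  have "continuous_on ((ball z r \<times> V) \<times> cbox 0 1)
          (\<lambda>p. f (circlepath z r (snd p), snd (fst p)))"
    by (rule continuous_on_compose2[OF f]) (use 1 in \<open>auto simp: circlepath intro!: continuous_intros\<close>)
  moreover have "continuous_on ((ball z r \<times> V) \<times> cbox 0 1)
          (\<lambda>p. (\<lambda>(x, t). cauchy_kernel z r x t) (fst (fst p), snd p))"
    by (rule continuous_on_compose2[OF continuous_cauchy_kernel[OF r]]) (auto intro!: continuous_intros)
  ultimately show ?thesis
    by (auto simp: case_prod_unfold intro!: continuous_on_mult)
qed

text \<open>Locally Cauchy's formula writes the derivative as an integral over a fixed circle, and the integrand depends
continuously on both variables.\<close>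

lemma continuous_dx:
  assumes f: "separately_holomorphic U V f" and "open U"
  shows "continuous_on (U \<times> V) (dx f)"
proof (clarsimp simp: continuous_on_eq_continuous_within)
  fix x y assume xy: "x \<in> U" "y \<in> V"
  obtain r where r: "0 < r" "cball x r \<subseteq> U"
    using \<open>open U\<close> xy open_contains_cball by blast
  \<comment> \<open>Near a point of the line over \<open>x\<close> the circle around \<open>x\<close> can be kept fixed.\<close>
  have "continuous_on (ball x r \<times> V)
     (\<lambda>q. integral (cbox 0 1) (\<lambda>t. f (circlepath x r t, snd q) * cauchy_kernel x r (fst q) t))"
    by (rule integral_continuous_on_param, rule continuous_cauchy_integrand)
       (use f r in \<open>auto simp: separately_holomorphic_def\<close>)
  then have "continuous_on (ball x r \<times> V) (dx f)"
    by (rule continuous_on_eq) (use dx_eq_integral[OF f r(2,1)] in auto)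
  then have "continuous (at (x, y) within (ball x r \<times> V)) (dx f)"
    using xy r by (auto simp: continuous_on_eq_continuous_within)
  moreover have "at (x, y) within (ball x r \<times> V) = at (x, y) within (U \<times> V)"
  proof (rule at_within_nhd[where S = "ball x r \<times> UNIV"])
    show "ball x r \<times> V \<inter> (ball x r \<times> UNIV) - {(x, y)} = U \<times> V \<inter> (ball x r \<times> UNIV) - {(x, y)}"
      using r ball_subset_cball by blast
  qed (use r in \<open>auto intro: open_Times\<close>)
  ultimately show "continuous (at (x, y) within U \<times> V) (dx f)"
    by simp
qed

lemma continuous_dy:
  assumes f: "separately_holomorphic U V f" and "open V"
  shows "continuous_on (U \<times> V) (dy f)"
proof -
  have "continuous_on (V \<times> U) (dx (f \<circ> prod.swap))"
    by (rule continuous_dx[OF separately_holomorphic_swap[OF f] \<open>open V\<close>])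
  then have "continuous_on (U \<times> V) (dx (f \<circ> prod.swap) \<circ> prod.swap)"
    by (intro continuous_on_compose continuous_on_swap) (simp add: product_swap)
  then show ?thesis
    by (rule continuous_on_eq) (auto simp: dx_swap)
qed

text \<open>Differentiation of Cauchy's integral for \<open>dx f\<close> under the integral sign with respect to the other variable.
The derivative obtained is Cauchy's integral for \<open>dx (dy f)\<close>, but this reading of it needs that \<open>dy f\<close> is
holomorphic in \<open>x\<close>, which follows from the present lemma with the variables exchanged.\<close>

lemma dx_has_y_derivative:
  assumes f: "separately_holomorphic U V f" and U: "cball z r \<subseteq> U" "0 < r" and V: "open V"
    and x: "x \<in> ball z r" and y: "y \<in> V"
  shows "((\<lambda>y. dx f (x, y)) has_field_derivative
            integral (cbox 0 1) (\<lambda>t. dy f (circlepath z r t, y) * cauchy_kernel z r x t)) (at y)"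
proof -
  obtain s where s: "0 < s" "ball y s \<subseteq> V"
    using V y open_contains_ball by blast
  have ball_sub: "{x} \<times> ball y s \<subseteq> ball z r \<times> V"
    using x s by auto
  have slice: "continuous_on (ball y s \<times> cbox 0 1) (\<lambda>(y, t). h (circlepath z r t, y) * cauchy_kernel z r x t)"
    if "continuous_on (U \<times> V) h" for h
  proof -
    have "continuous_on (ball y s \<times> cbox 0 1)
        (\<lambda>p. (\<lambda>(q, t). h (circlepath z r t, snd q) * cauchy_kernel z r (fst q) t) ((x, fst p), snd p))"
      by (rule continuous_on_compose2[OF continuous_cauchy_integrand[OF that U]])
         (use x s in \<open>auto intro!: continuous_intros\<close>)
    then show ?thesis by (simp add: case_prod_unfold)
  qed
  have cf: "continuous_on (U \<times> V) f" and hol: "\<And>x. x \<in> U \<Longrightarrow> (\<lambda>y. f (x, y)) holomorphic_on V"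
    using f by (auto simp: separately_holomorphic_def)
  have circ: "circlepath z r t \<in> U" for t
    using circlepath_in_sphere[of z r t] U by auto
  have "((\<lambda>y. integral (cbox 0 1) (\<lambda>t. f (circlepath z r t, y) * cauchy_kernel z r x t)) has_field_derivative
          integral (cbox 0 1) (\<lambda>t. dy f (circlepath z r t, y) * cauchy_kernel z r x t)) (at y within ball y s)"
  proof (rule leibniz_rule_field_derivative)
    fix y' t assume y': "y' \<in> ball y s" "t \<in> cbox 0 (1::real)"
    then have "((\<lambda>y. f (circlepath z r t, y)) has_field_derivative dy f (circlepath z r t, y')) (at y')"
      using holomorphic_derivI[OF hol[OF circ] V, of y'] s by (auto simp: dy_def)
    then show "((\<lambda>y. f (circlepath z r t, y) * cauchy_kernel z r x t) has_field_derivative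
       dy f (circlepath z r t, y') * cauchy_kernel z r x t) (at y' within ball y s)"
      by (intro DERIV_cmult_right) (rule has_field_derivative_at_within)
  next
    fix y' assume y': "y' \<in> ball y s"
    have "continuous_on (cbox 0 1) (\<lambda>t. (\<lambda>(y, t). f (circlepath z r t, y) * cauchy_kernel z r x t) (y', t))"
      by (rule continuous_on_compose2[OF slice[OF cf]]) (use y' in \<open>auto intro!: continuous_intros\<close>)
    then show "(\<lambda>t. f (circlepath z r t, y') * cauchy_kernel z r x t) integrable_on cbox 0 1"
      by (intro integrable_continuous) simp
  qed (use slice[OF continuous_dy[OF f V]] s in auto)
  then have "((\<lambda>y. integral (cbox 0 1) (\<lambda>t. f (circlepath z r t, y) * cauchy_kernel z r x t)) has_field_derivative
          integral (cbox 0 1) (\<lambda>t. dy f (circlepath z r t, y) * cauchy_kernel z r x t)) (at y)"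
    using s at_within_open[of y "ball y s"] by simp
  then show ?thesis
    by (rule has_field_derivative_transform_within_open[where S = "ball y s"])
       (use s dx_eq_integral[OF f U x] in auto)
qed

lemma separately_holomorphic_dx:
  assumes f: "separately_holomorphic U V f" and U: "open U" and V: "open V"
  shows "separately_holomorphic U V (dx f)"
  unfolding separately_holomorphic_def
proof (intro conjI ballI)
  show "continuous_on (U \<times> V) (dx f)"
    by (rule continuous_dx[OF f U])
next
  fix y assume "y \<in> V"
  then show "(\<lambda>x. dx f (x, y)) holomorphic_on U"
    using f U unfolding dx_def separately_holomorphic_def by (auto intro!: holomorphic_deriv)
next
  fix x assume "x \<in> U"
  then obtain r where "0 < r" "cball x r \<subseteq> U"
    using U open_contains_cball by blast
  then show "(\<lambda>y. dx f (x, y)) holomorphic_on V"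
    using dx_has_y_derivative[OF f _ _ V, of x r x] V by (auto simp: holomorphic_on_open)
qed

lemma separately_holomorphic_dy:
  assumes f: "separately_holomorphic U V f" and U: "open U" and V: "open V"
  shows "separately_holomorphic U V (dy f)"
proof -
  have "separately_holomorphic U V (dx (f \<circ> prod.swap) \<circ> prod.swap)"
    by (intro separately_holomorphic_swap separately_holomorphic_dx assms)
  moreover have "dx (f \<circ> prod.swap) \<circ> prod.swap = dy f"
    by (auto simp: dx_swap)
  ultimately show ?thesis by simp
qed

lemma mixed_partials_commute:
  assumes f: "separately_holomorphic U V f" and U: "open U" and V: "open V" and "x \<in> U" "y \<in> V"
  shows "dy (dx f) (x, y) = dx (dy f) (x, y)"
proof -
  obtain r where r: "0 < r" "cball x r \<subseteq> U"
    using U \<open>x \<in> U\<close> open_contains_cball by blast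
  have "dy (dx f) (x, y) = integral (cbox 0 1) (\<lambda>t. dy f (circlepath x r t, y) * cauchy_kernel x r x t)"
    unfolding dy_def using dx_has_y_derivative[OF f r(2,1) V _ \<open>y \<in> V\<close>, of x] r
    by (auto intro!: DERIV_imp_deriv simp: dy_def)
  also have "\<dots> = dx (dy f) (x, y)"
    using dx_eq_integral[OF separately_holomorphic_dy[OF f U V] r(2,1) _ \<open>y \<in> V\<close>, of x] r by auto
  finally show ?thesis .
qed

text \<open>A continuous function that is holomorphic in each variable has continuous partial derivatives, hence is
differentiable, and its derivative is complex linear.\<close>

lemma separately_holomorphic_has_derivative:
  assumes f: "separately_holomorphic U V f" and U: "open U" and V: "open V" "convex V"
    and "x \<in> U" "y \<in> V"
  shows "(f has_derivative (\<lambda>(u, v). dx f (x, y) * u + dy f (x, y) * v)) (at (x, y))"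
proof -
  have "((\<lambda>(x, y). f (x, y)) has_derivative
      (\<lambda>(u, v). dx f (x, y) * u + blinfun_apply (blinfun_mult_right (dy f (x, y))) v)) (at (x, y) within U \<times> V)"
  proof (rule has_derivative_partialsI)
    show "((\<lambda>x. f (x, y)) has_derivative (*) (dx f (x, y))) (at x within U)"
      using f U \<open>x \<in> U\<close> \<open>y \<in> V\<close> holomorphic_derivI[of "\<lambda>x. f (x, y)" U x U]
      by (auto simp: separately_holomorphic_def has_field_derivative_def dx_def)
  next
    fix x y assume "x \<in> U" "y \<in> V"
    then show "((\<lambda>y. f (x, y)) has_derivative blinfun_apply (blinfun_mult_right (dy f (x, y)))) (at y within V)"
      using f V holomorphic_derivI[of "\<lambda>y. f (x, y)" V y V]
      by (auto simp: separately_holomorphic_def has_field_derivative_def dy_def)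
  next
    have "continuous (at (x, y) within U \<times> V) (dy f)"
      using continuous_dy[OF f V(1)] \<open>x \<in> U\<close> \<open>y \<in> V\<close> by (auto simp: continuous_on_eq_continuous_within)
    then have "continuous (at (x, y) within U \<times> V) (\<lambda>q. blinfun_mult_right (dy f q))"
      by (rule bounded_linear.continuous[OF bounded_linear_blinfun_mult_right])
    then show "continuous (at (x, y) within U \<times> V) (\<lambda>(x, y). blinfun_mult_right (dy f (x, y)))"
      by (simp add: case_prod_unfold)
  qed (use assms in auto)
  then show ?thesis
    using at_within_open[of "(x, y)" "U \<times> V"] U V assms(5,6) by (simp add: open_Times)
qed

lemma partial_derivatives_unique:
  assumes "(f has_derivative (\<lambda>(u, v). a * u + b * v)) (at q)"
  shows "dx f q = a" "dy f q = b"
    "((\<lambda>x. f (x, snd q)) has_field_derivative a) (at (fst q))"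
    "((\<lambda>y. f (fst q, y)) has_field_derivative b) (at (snd q))"
proof -
  have "((\<lambda>x. (x, snd q)) has_derivative (\<lambda>u. (u, 0))) (at (fst q))"
    by (auto intro!: derivative_eq_intros)
  from has_derivative_compose[OF this, of f "\<lambda>(u, v). a * u + b * v"] assms
  show 1: "((\<lambda>x. f (x, snd q)) has_field_derivative a) (at (fst q))"
    by (simp add: has_field_derivative_def o_def mult_commute_abs)
  have "((\<lambda>y. (fst q, y)) has_derivative (\<lambda>u. (0, u))) (at (snd q))"
    by (auto intro!: derivative_eq_intros)
  from has_derivative_compose[OF this, of f "\<lambda>(u, v). a * u + b * v"] assms
  show 2: "((\<lambda>y. f (fst q, y)) has_field_derivative b) (at (snd q))"
    by (simp add: has_field_derivative_def o_def mult_commute_abs)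
  show "dx f q = a" "dy f q = b"
    unfolding dx_def dy_def using 1 2 by (auto intro!: DERIV_imp_deriv)
qed

lemma analytic_near_iff_separately_holomorphic:
  "analytic_near p f \<longleftrightarrow> (\<exists>r>0. separately_holomorphic (ball (fst p) r) (ball (snd p) r) f)"
proof
  assume "analytic_near p f"
  then obtain e where "e > 0" and e: "\<And>q. q \<in> ball p e \<Longrightarrow> \<exists>a b. (f has_derivative (\<lambda>(u, v). a * u + b * v)) (at q)"
    unfolding analytic_near_def by blast
  define r where "r = e / 2"
  have sub: "(x, y) \<in> ball p e" if "x \<in> ball (fst p) r" "y \<in> ball (snd p) r" for x y
  proof -
    have "dist p (x, y) \<le> dist (fst p) x + dist (snd p) y"
      by (cases p) (simp add: dist_Pair_Pair sqrt_sum_squares_le_sum)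
    then show ?thesis using that by (simp add: r_def)
  qed
  have "separately_holomorphic (ball (fst p) r) (ball (snd p) r) f"
    unfolding separately_holomorphic_def
  proof (intro conjI ballI)
    have "continuous_on (ball p e) f"
      using e has_derivative_continuous by (blast intro: continuous_at_imp_continuous_on)
    then show "continuous_on (ball (fst p) r \<times> ball (snd p) r) f"
      by (rule continuous_on_subset) (use sub in auto)
  next
    fix y assume y: "y \<in> ball (snd p) r"
    show "(\<lambda>x. f (x, y)) holomorphic_on ball (fst p) r"
      using partial_derivatives_unique(3)[of f _ _ "(_, y)"] e[OF sub[OF _ y]]
      by (fastforce simp: holomorphic_on_open)
  next
    fix x assume x: "x \<in> ball (fst p) r"
    show "(\<lambda>y. f (x, y)) holomorphic_on ball (snd p) r"
      using partial_derivatives_unique(4)[of f _ _ "(x, _)"] e[OF sub[OF x]]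
      by (fastforce simp: holomorphic_on_open)
  qed
  then show "\<exists>r>0. separately_holomorphic (ball (fst p) r) (ball (snd p) r) f"
    using \<open>e > 0\<close> by (intro exI[of _ r]) (simp add: r_def)
next
  assume "\<exists>r>0. separately_holomorphic (ball (fst p) r) (ball (snd p) r) f"
  then obtain r where r: "r > 0" "separately_holomorphic (ball (fst p) r) (ball (snd p) r) f"
    by blast
  have "\<exists>a b. (f has_derivative (\<lambda>(u, v). a * u + b * v)) (at q)" if "q \<in> ball p r" for q
  proof -
    have "fst q \<in> ball (fst p) r" "snd q \<in> ball (snd p) r"
      using that dist_fst_le[of p q] dist_snd_le[of p q] by auto
    with separately_holomorphic_has_derivative[OF r(2), of "fst q" "snd q"] show ?thesis
      by auto
  qed
  with r(1) show "analytic_near p f"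
    unfolding analytic_near_def by blast
qed

lemma analytic_near_dx: "analytic_near p f \<Longrightarrow> analytic_near p (dx f)"
  using separately_holomorphic_dx by (auto simp: analytic_near_iff_separately_holomorphic)

lemma analytic_near_dy: "analytic_near p f \<Longrightarrow> analytic_near p (dy f)"
  using separately_holomorphic_dy by (auto simp: analytic_near_iff_separately_holomorphic)

lemma eventually_nhds_polydisc:
  assumes "r > 0"
  shows "\<forall>\<^sub>F q in nhds p. fst q \<in> ball (fst p) r \<and> snd q \<in> ball (snd p) r"
proof -
  have "open (ball (fst p) r \<times> ball (snd p) r)" by (simp add: open_Times)
  moreover have "p \<in> ball (fst p) r \<times> ball (snd p) r" using assms by (cases p) auto
  ultimately show ?thesis
    by (rule eventually_nhds_in_open[THEN eventually_mono]) (auto simp: mem_Times_iff)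
qed

lemma analytic_near_mixed_partials:
  assumes "analytic_near p f"
  shows "\<forall>\<^sub>F q in nhds p. dy (dx f) q = dx (dy f) q"
proof -
  obtain r where r: "r > 0" "separately_holomorphic (ball (fst p) r) (ball (snd p) r) f"
    using assms by (auto simp: analytic_near_iff_separately_holomorphic)
  from eventually_nhds_polydisc[OF r(1), of p] show ?thesis
    by eventually_elim (use mixed_partials_commute[OF r(2)] in force)
qed

lemma analytic_near_iff_eventually:
  "analytic_near p f \<longleftrightarrow>
     (\<forall>\<^sub>F q in nhds p. (f has_derivative (\<lambda>(u, v). dx f q * u + dy f q * v)) (at q))"
  (is "_ \<longleftrightarrow> eventually ?P _")
proof -
  have "analytic_near p f \<longleftrightarrow> (\<exists>e>0. \<forall>q\<in>ball p e. ?P q)"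
    unfolding analytic_near_def by (metis partial_derivatives_unique(1,2))
  also have "\<dots> \<longleftrightarrow> eventually ?P (nhds p)"
    by (auto simp: eventually_nhds_metric dist_commute)
  finally show ?thesis .
qed

lemma analytic_nearI:
  assumes "\<forall>\<^sub>F q in nhds p. (f has_derivative (\<lambda>(u, v). a q * u + b q * v)) (at q)"
  shows "analytic_near p f"
  unfolding analytic_near_iff_eventually
  using assms by eventually_elim (metis partial_derivatives_unique(1,2))

section \<open>Operations on analytic functions\<close>

lemma analytic_near_const [simp]: "analytic_near p (\<lambda>_. c)"
  by (rule analytic_nearI[where a = "\<lambda>_. 0" and b = "\<lambda>_. 0"]) (simp add: case_prod_unfold)

lemma analytic_near_add:
  assumes "analytic_near p f" "analytic_near p g"
  shows "analytic_near p (\<lambda>q. f q + g q)"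
proof (rule analytic_nearI)
  show "\<forall>\<^sub>F q in nhds p. ((\<lambda>q. f q + g q) has_derivative
      (\<lambda>(u, v). (dx f q + dx g q) * u + (dy f q + dy g q) * v)) (at q)"
    using assms[unfolded analytic_near_iff_eventually]
    by eventually_elim (auto intro!: derivative_eq_intros simp: algebra_simps)
qed

lemma analytic_near_mult:
  assumes "analytic_near p f" "analytic_near p g"
  shows "analytic_near p (\<lambda>q. f q * g q)"
proof (rule analytic_nearI)
  show "\<forall>\<^sub>F q in nhds p. ((\<lambda>q. f q * g q) has_derivative
      (\<lambda>(u, v). (f q * dx g q + dx f q * g q) * u + (f q * dy g q + dy f q * g q) * v)) (at q)"
    using assms[unfolded analytic_near_iff_eventually]
    by eventually_elim (auto intro!: derivative_eq_intros simp: algebra_simps)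
qed

lemma analytic_near_eventually_nonzero:
  assumes "analytic_near p f" "f p \<noteq> 0"
  shows "\<forall>\<^sub>F q in nhds p. f q \<noteq> 0"
proof -
  have "isCont f p"
    using assms(1) eventually_nhds_x_imp_x has_derivative_continuous
    unfolding analytic_near_iff_eventually by blast
  then show ?thesis
    using assms(2) by (simp add: isCont_def tendsto_imp_eventually_ne eventually_nhds_conv_at)
qed

lemma analytic_near_inverse:
  assumes "analytic_near p f" "f p \<noteq> 0"
  shows "analytic_near p (\<lambda>q. inverse (f q))"
proof -
  have "\<forall>\<^sub>F q in nhds p. f q \<noteq> 0"
    using assms by (rule analytic_near_eventually_nonzero)
  with assms(1)[unfolded analytic_near_iff_eventually]
  have "\<forall>\<^sub>F q in nhds p. ((\<lambda>q. inverse (f q)) has_derivative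
      (\<lambda>(u, v). - (dx f q / (f q)\<^sup>2) * u + - (dy f q / (f q)\<^sup>2) * v)) (at q)"
    by eventually_elim
       (auto intro!: derivative_eq_intros simp: fun_eq_iff field_simps power2_eq_square)
  then show ?thesis by (rule analytic_nearI)
qed

lemma exp_linear_has_derivative:
  fixes a b :: complex
  shows "((\<lambda>(x, y). exp (x * a + y * b)) has_derivative
     (\<lambda>(u, v). a * exp (fst q * a + snd q * b) * u + b * exp (fst q * a + snd q * b) * v)) (at q)"
proof -
  have "((\<lambda>q. fst q * a + snd q * b) has_derivative (\<lambda>q. fst q * a + snd q * b)) (at q)"
    by (auto intro!: derivative_eq_intros)
  from has_derivative_compose[OF this DERIV_exp[unfolded has_field_derivative_def]] show ?thesis
    by (simp add: case_prod_unfold algebra_simps)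
qed

lemma analytic_near_exp_linear [simp]: "analytic_near p (\<lambda>(x, y). exp (x * a + y * b))"
  by (rule analytic_nearI, rule always_eventually, rule allI, rule exp_linear_has_derivative)



section \<open>Normal forms over Ore relations\<close>

context ring
begin

text \<open>Polynomials in \<open>X\<close> with coefficients from \<open>N\<close> on the left, in Horner form. In a ring that need not be
commutative this form is convenient since multiplication by \<open>X\<close> on the right only shifts the
coefficients.\<close>

definition left_polynomials :: "'a set \<Rightarrow> 'a \<Rightarrow> 'a set" where
  "left_polynomials N X = {foldr (\<lambda>k T. k \<oplus> T \<otimes> X) ks \<zero> | ks. set ks \<subseteq> N}"

lemma left_polynomials_zero: "\<zero> \<in> left_polynomials N X"
  unfolding left_polynomials_def by (auto intro!: exI[of _ "[]"])

lemma left_polynomials_step: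
  "\<lbrakk>k \<in> N; T \<in> left_polynomials N X\<rbrakk> \<Longrightarrow> k \<oplus> T \<otimes> X \<in> left_polynomials N X"
  unfolding left_polynomials_def
proof (clarify, goal_cases)
  case (1 ks)
  then show ?case by (auto intro!: exI[of _ "k # ks"])
qed

lemma left_polynomials_induct [consumes 1, case_names zero step]:
  assumes "T \<in> left_polynomials N X" "P \<zero>"
    "\<And>k T. \<lbrakk>k \<in> N; T \<in> left_polynomials N X; P T\<rbrakk> \<Longrightarrow> P (k \<oplus> T \<otimes> X)"
  shows "P T"
proof -
  obtain ks where ks: "set ks \<subseteq> N" "T = foldr (\<lambda>k T. k \<oplus> T \<otimes> X) ks \<zero>"
    using assms(1) by (auto simp: left_polynomials_def)
  have "foldr (\<lambda>k T. k \<oplus> T \<otimes> X) ks \<zero> \<in> left_polynomials N X \<and> P (foldr (\<lambda>k T. k \<oplus> T \<otimes> X) ks \<zero>)"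
    using ks(1) by (induction ks) (auto simp: left_polynomials_zero assms left_polynomials_step)
  then show ?thesis by (simp add: ks(2))
qed

context
  fixes N :: "'a set" and X :: 'a
  assumes N_carrier: "N \<subseteq> carrier R" and X_carrier: "X \<in> carrier R" and N_zero: "\<zero> \<in> N"
begin

lemma left_polynomials_carrier: "T \<in> left_polynomials N X \<Longrightarrow> T \<in> carrier R"
  by (induction rule: left_polynomials_induct) (use N_carrier X_carrier in auto)

lemma left_polynomials_coefficient: "k \<in> N \<Longrightarrow> k \<in> left_polynomials N X"
  using left_polynomials_step[OF _ left_polynomials_zero, of k N X] N_carrier X_carrier by auto

lemma left_polynomials_mult_right: "T \<in> left_polynomials N X \<Longrightarrow> T \<otimes> X \<in> left_polynomials N X"
  using left_polynomials_step[OF N_zero, of T X] X_carrier by (simp add: left_polynomials_carrier)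

lemma left_polynomials_add:
  assumes N_add: "\<And>k l. \<lbrakk>k \<in> N; l \<in> N\<rbrakk> \<Longrightarrow> k \<oplus> l \<in> N"
    and "S \<in> left_polynomials N X" "T \<in> left_polynomials N X"
  shows "S \<oplus> T \<in> left_polynomials N X"
  using assms(2,3)
proof (induction arbitrary: T rule: left_polynomials_induct)
  case zero
  then show ?case by (simp add: left_polynomials_carrier)
next
  case (step k S)
  have "\<forall>k\<in>N. \<forall>S\<in>left_polynomials N X. (\<forall>T\<in>left_polynomials N X. S \<oplus> T \<in> left_polynomials N X)
      \<longrightarrow> (k \<oplus> S \<otimes> X) \<oplus> T \<in> left_polynomials N X"
    using step(4)
  proof (induction rule: left_polynomials_induct)
    case zero
    then show ?case
      using N_carrier X_carrier left_polynomials_step by (simp add: subset_iff left_polynomials_carrier)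
  next
    case (step l T')
    show ?case
    proof (intro ballI impI)
      fix k S assume kS: "k \<in> N" "S \<in> left_polynomials N X"
        and IH: "\<forall>T\<in>left_polynomials N X. S \<oplus> T \<in> left_polynomials N X"
      have "(k \<oplus> S \<otimes> X) \<oplus> (l \<oplus> T' \<otimes> X) = (k \<oplus> l) \<oplus> (S \<oplus> T') \<otimes> X"
        using step kS N_carrier X_carrier
        by (simp add: subset_iff left_polynomials_carrier l_distr a_ac)
      also have "\<dots> \<in> left_polynomials N X"
        using step kS IH N_add by (intro left_polynomials_step) auto
      finally show "(k \<oplus> S \<otimes> X) \<oplus> (l \<oplus> T' \<otimes> X) \<in> left_polynomials N X" .
    qed
  qed
  with step show ?case by blast
qed

text \<open>Multiplication on the left passes through the Horner form, so its effect has to be known only on the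
coefficients.\<close>

lemma left_polynomials_mult_left:
  assumes N_add: "\<And>k l. \<lbrakk>k \<in> N; l \<in> N\<rbrakk> \<Longrightarrow> k \<oplus> l \<in> N"
    and A: "A \<in> carrier R" "\<And>k. k \<in> N \<Longrightarrow> A \<otimes> k \<in> left_polynomials N X"
    and "T \<in> left_polynomials N X"
  shows "A \<otimes> T \<in> left_polynomials N X"
  using assms(4)
proof (induction rule: left_polynomials_induct)
  case zero
  then show ?case using A by (simp add: left_polynomials_zero)
next
  case (step k T)
  have "A \<otimes> (k \<oplus> T \<otimes> X) = A \<otimes> k \<oplus> (A \<otimes> T) \<otimes> X"
    using A step N_carrier X_carrier
    by (simp add: subset_iff left_polynomials_carrier r_distr m_assoc)
  also have "\<dots> \<in> left_polynomials N X"
    using step A by (intro left_polynomials_add N_add left_polynomials_mult_right) auto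
  finally show ?case .
qed

end

text \<open>If \<open>X\<close> and \<open>Y\<close> commute with each other and commute with \<open>K\<close> up to elements of \<open>K\<close>, then they can be moved
to the right in every product. It is enough that left multiplication by each generator preserves the
polynomials in \<open>X, Y\<close>: as these contain the unit, they then contain the generated ring.\<close>

lemma ore_normal_form:
  assumes K: "K \<subseteq> carrier R" "\<one> \<in> K" "\<zero> \<in> K"
      "\<And>k l. \<lbrakk>k \<in> K; l \<in> K\<rbrakk> \<Longrightarrow> k \<oplus> l \<in> K" "\<And>k l. \<lbrakk>k \<in> K; l \<in> K\<rbrakk> \<Longrightarrow> k \<otimes> l \<in> K"
      "\<And>k. k \<in> K \<Longrightarrow> \<ominus> k \<in> K"
    and XY: "X \<in> carrier R" "Y \<in> carrier R" "Y \<otimes> X = X \<otimes> Y"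
    and X: "\<And>k. k \<in> K \<Longrightarrow> \<exists>l\<in>K. X \<otimes> k = l \<oplus> k \<otimes> X"
    and Y: "\<And>k. k \<in> K \<Longrightarrow> \<exists>l\<in>K. Y \<otimes> k = l \<oplus> k \<otimes> Y"
    and S: "S \<subseteq> carrier R"
      "\<And>s. s \<in> S \<Longrightarrow> \<exists>a\<in>K. \<exists>b\<in>K. \<exists>c\<in>K. s = a \<oplus> b \<otimes> X \<oplus> c \<otimes> Y"
  shows "generate_ring R S \<subseteq> left_polynomials (left_polynomials K X) Y"
proof
  define N where "N = left_polynomials K X"
  define M where "M = left_polynomials N Y"
  have N: "N \<subseteq> carrier R" "\<zero> \<in> N" "K \<subseteq> N" "\<And>k l. \<lbrakk>k \<in> N; l \<in> N\<rbrakk> \<Longrightarrow> k \<oplus> l \<in> N"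
    "\<And>T. T \<in> N \<Longrightarrow> T \<otimes> X \<in> N"
    unfolding N_def using K XY left_polynomials_zero[of K X] left_polynomials_carrier[of K X]
      left_polynomials_coefficient[of K X] left_polynomials_add[of K X] left_polynomials_mult_right[of K X]
    by auto
  have M: "M \<subseteq> carrier R" "N \<subseteq> M" "\<And>k l. \<lbrakk>k \<in> M; l \<in> M\<rbrakk> \<Longrightarrow> k \<oplus> l \<in> M" "\<And>T. T \<in> M \<Longrightarrow> T \<otimes> Y \<in> M"
    unfolding M_def using N XY left_polynomials_carrier[of N Y]
      left_polynomials_coefficient[of N Y] left_polynomials_add[of N Y] left_polynomials_mult_right[of N Y]
    by auto
  have kN: "k \<otimes> T \<in> N" if "k \<in> K" "T \<in> N" for k T
    using that left_polynomials_mult_left[of K X k T] left_polynomials_coefficient[of K X] K XY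
    unfolding N_def by auto
  have kM: "k \<otimes> T \<in> M" if "k \<in> K" "T \<in> M" for k T
    using that left_polynomials_mult_left[of N Y k T] kN M(2) N K(1) XY
    unfolding M_def by (simp add: subset_iff)
  \<comment> \<open>\<open>N\<close> are the polynomials in \<open>X\<close>, \<open>M\<close> those in \<open>X\<close> and \<open>Y\<close>.\<close>
  have XN: "X \<otimes> T \<in> N" if "T \<in> N" for T
  proof -
    have "X \<otimes> k \<in> N" if k: "k \<in> K" for k
    proof -
      obtain l where "l \<in> K" "X \<otimes> k = l \<oplus> k \<otimes> X"
        using X k by blast
      then show ?thesis using k N(3) by (simp add: subset_iff N(4,5))
    qed
    then show ?thesis
      using that left_polynomials_mult_left[of K X X T] K XY unfolding N_def by auto
  qed
  have XM: "X \<otimes> T \<in> M" if "T \<in> M" for T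
    using that left_polynomials_mult_left[of N Y X T] XN M(2) N XY unfolding M_def by auto
  have MX: "T \<otimes> X \<in> M" if "T \<in> M" for T
    using that unfolding M_def
  proof (induction rule: left_polynomials_induct)
    case zero
    then show ?case using XY by (simp add: left_polynomials_zero)
  next
    case (step k T)
    then have "T \<in> carrier R" "k \<in> carrier R"
      using M(1) N(1) by (auto simp: M_def)
    then have "(k \<oplus> T \<otimes> Y) \<otimes> X = k \<otimes> X \<oplus> (T \<otimes> X) \<otimes> Y"
      using XY by (simp add: l_distr m_assoc)
    with step N(5) show ?case by (auto intro: left_polynomials_step)
  qed
  have YN: "Y \<otimes> T \<in> M" if "T \<in> N" for T
    using that unfolding N_def
  proof (induction rule: left_polynomials_induct)
    case zero
    then show ?case using XY N(2) M(2) by auto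
  next
    case (step k T)
    obtain l where l: "l \<in> K" "Y \<otimes> k = l \<oplus> k \<otimes> Y"
      using Y step by blast
    have "T \<in> carrier R" "k \<in> carrier R"
      using step N(1) K(1) by (auto simp: N_def)
    then have "Y \<otimes> (k \<oplus> T \<otimes> X) = (l \<oplus> k \<otimes> Y) \<oplus> (Y \<otimes> T) \<otimes> X"
      using XY l by (simp add: r_distr m_assoc)
    moreover have "l \<oplus> k \<otimes> Y \<in> M"
      using l step M N by (intro M(3,4)) auto
    ultimately show ?case using step M MX by auto
  qed
  have YM: "Y \<otimes> T \<in> M" if "T \<in> M" for T
    using that left_polynomials_mult_left[of N Y Y T] YN N XY unfolding M_def by auto
  have sM: "s \<otimes> T \<in> M" if s: "s \<in> S" and T: "T \<in> M" for s T
  proof -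
    obtain a b c where abc: "a \<in> K" "b \<in> K" "c \<in> K" "s = a \<oplus> b \<otimes> X \<oplus> c \<otimes> Y"
      using S(2)[OF s] by blast
    then have "s \<otimes> T = a \<otimes> T \<oplus> b \<otimes> (X \<otimes> T) \<oplus> c \<otimes> (Y \<otimes> T)"
      using K(1) XY T M(1) by (simp add: subset_iff l_distr m_assoc)
    then show ?thesis
      using abc T by (simp add: M kM XM YM)
  qed
  fix s assume s: "s \<in> generate_ring R S"
  have minus: "\<ominus> T \<in> M" if "T \<in> M" for T
    using kM[of "\<ominus> \<one>" T] that K M(1) by (auto simp: l_minus subset_iff)
  have "\<forall>T\<in>M. s \<otimes> T \<in> M"
    using s
  proof (induction rule: generate_ring.induct)
    case one
    then show ?case using M(1) by auto
  next
    case (incl h)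
    then show ?case using sM by blast
  next
    case (a_inv h)
    then have "h \<in> carrier R" using generate_ring_in_carrier[OF S(1)] by blast
    then show ?case using a_inv minus M(1) by (auto simp: l_minus subset_iff)
  next
    case (eng_add h1 h2)
    then have "h1 \<in> carrier R" "h2 \<in> carrier R" using generate_ring_in_carrier[OF S(1)] by blast+
    then show ?case using eng_add M by (auto simp: l_distr subset_iff)
  next
    case (eng_mult h1 h2)
    then have "h1 \<in> carrier R" "h2 \<in> carrier R" using generate_ring_in_carrier[OF S(1)] by blast+
    then show ?case using eng_mult M by (auto simp: m_assoc subset_iff)
  qed
  then have "s \<otimes> \<one> \<in> M" using K(2) N(3) M(2) by blast
  then show "s \<in> left_polynomials (left_polynomials K X) Y"
    using generate_ring_in_carrier[OF S(1) s] by (simp add: M_def N_def)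
qed

end

section \<open>The ring of additive endomorphisms\<close>

context abelian_group
begin

lemma additive_endomorphismsI:
  assumes "T \<in> extensional (carrier G)" "\<And>a. a \<in> carrier G \<Longrightarrow> T a \<in> carrier G"
    "\<And>a b. \<lbrakk>a \<in> carrier G; b \<in> carrier G\<rbrakk> \<Longrightarrow> T (a \<oplus> b) = T a \<oplus> T b"
  shows "T \<in> carrier (additive_endomorphisms G)"
  using assms by (simp add: additive_endomorphisms_def PiE_def)

lemma additive_endomorphismsD:
  assumes "T \<in> carrier (additive_endomorphisms G)"
  shows "T \<in> extensional (carrier G)" "a \<in> carrier G \<Longrightarrow> T a \<in> carrier G"
    "\<lbrakk>a \<in> carrier G; b \<in> carrier G\<rbrakk> \<Longrightarrow> T (a \<oplus> b) = T a \<oplus> T b"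
  using assms by (auto simp: additive_endomorphisms_def PiE_def)

lemma additive_endomorphisms_apply:
  assumes "a \<in> carrier G"
  shows "(S \<oplus>\<^bsub>additive_endomorphisms G\<^esub> T) a = S a \<oplus> T a"
    "(S \<otimes>\<^bsub>additive_endomorphisms G\<^esub> T) a = S (T a)"
    "\<zero>\<^bsub>additive_endomorphisms G\<^esub> a = \<zero>" "\<one>\<^bsub>additive_endomorphisms G\<^esub> a = a"
  using assms by (simp_all add: additive_endomorphisms_def compose_def)

lemma additive_endomorphisms_extensional [simp]:
  "(S \<oplus>\<^bsub>additive_endomorphisms G\<^esub> T) \<in> extensional (carrier G)"
  "(S \<otimes>\<^bsub>additive_endomorphisms G\<^esub> T) \<in> extensional (carrier G)"
  "\<zero>\<^bsub>additive_endomorphisms G\<^esub> \<in> extensional (carrier G)"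
  "\<one>\<^bsub>additive_endomorphisms G\<^esub> \<in> extensional (carrier G)"
  by (auto simp: additive_endomorphisms_def compose_def)

lemma additive_endomorphisms_eqI:
  assumes "S \<in> extensional (carrier G)" "T \<in> extensional (carrier G)"
    "\<And>a. a \<in> carrier G \<Longrightarrow> S a = T a"
  shows "S = T"
  using assms by (rule extensionalityI)

lemma additive_endomorphisms_ring: "ring (additive_endomorphisms G)"
proof -
  let ?E = "additive_endomorphisms G"
  note D = additive_endomorphismsD and app = additive_endomorphisms_apply
  have closed:
    "S \<oplus>\<^bsub>?E\<^esub> T \<in> carrier ?E" "S \<otimes>\<^bsub>?E\<^esub> T \<in> carrier ?E"
    if "S \<in> carrier ?E" "T \<in> carrier ?E" for S T
    by (rule additive_endomorphismsI; simp add: app D[OF that(1)] D[OF that(2)] a_ac)+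
  have zero: "\<zero>\<^bsub>?E\<^esub> \<in> carrier ?E"
    by (rule additive_endomorphismsI) (simp_all add: app)
  have one: "\<one>\<^bsub>?E\<^esub> \<in> carrier ?E"
    by (rule additive_endomorphismsI) (simp_all add: app)
  note [simp] = closed zero one
  have neg: "\<exists>S\<in>carrier ?E. S \<oplus>\<^bsub>?E\<^esub> T = \<zero>\<^bsub>?E\<^esub>" if T: "T \<in> carrier ?E" for T
  proof (intro bexI)
    show "(\<lambda>a\<in>carrier G. \<ominus> T a) \<oplus>\<^bsub>?E\<^esub> T = \<zero>\<^bsub>?E\<^esub>"
      by (rule additive_endomorphisms_eqI) (simp_all add: app D[OF T] l_neg)
    show "(\<lambda>a\<in>carrier G. \<ominus> T a) \<in> carrier ?E"
      by (rule additive_endomorphismsI) (simp_all add: D[OF T] minus_add)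
  qed
  show ?thesis
  proof (rule ringI)
    show "abelian_group ?E"
      by (rule abelian_groupI)
        (auto intro: neg intro!: additive_endomorphisms_eqI simp: app additive_endomorphismsD(1,2) a_ac)
    show "monoid ?E"
      by (rule monoidI) (auto intro!: additive_endomorphisms_eqI simp: app additive_endomorphismsD(1,2))
  qed (auto intro!: additive_endomorphisms_eqI simp: app additive_endomorphismsD)
qed

end



section \<open>The ring of germs\<close>

lemma germ_eq_iff: "germ p f = germ p g \<longleftrightarrow> (\<forall>\<^sub>F q in nhds p. f q = g q)"
proof
  assume "germ p f = germ p g"
  moreover have "f \<in> germ p f" by (simp add: germ_def)
  ultimately have "f \<in> germ p g" by blast
  then show "\<forall>\<^sub>F q in nhds p. f q = g q" by (simp add: germ_def)
next
  assume fg: "\<forall>\<^sub>F q in nhds p. f q = g q"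
  have "(\<forall>\<^sub>F q in nhds p. h q = f q) \<longleftrightarrow> (\<forall>\<^sub>F q in nhds p. h q = g q)" for h
    using fg by (auto elim: eventually_elim2)
  then show "germ p f = germ p g" by (simp add: germ_def)
qed

lemma germ_carrier: "analytic_near p f \<Longrightarrow> germ p f \<in> carrier (analytic_germs p)"
  by (simp add: analytic_germs_def)

lemma germ_carrierE:
  assumes "a \<in> carrier (analytic_germs p)"
  obtains f where "analytic_near p f" "a = germ p f"
  using assms by (auto simp: analytic_germs_def)

text \<open>Computations with germs may be carried out on any representatives.\<close>

lemma germ_lift2:
  "{h. \<exists>f'\<in>germ p f. \<exists>g'\<in>germ p g. \<forall>\<^sub>F q in nhds p. h q = op (f' q) (g' q)} =
     germ p (\<lambda>q. op (f q) (g q))" (is "?L = ?R")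
proof
  show "?L \<subseteq> ?R"
  proof
    fix h assume "h \<in> ?L"
    then obtain f' g' where "\<forall>\<^sub>F q in nhds p. f' q = f q" "\<forall>\<^sub>F q in nhds p. g' q = g q"
      "\<forall>\<^sub>F q in nhds p. h q = op (f' q) (g' q)"
      by (auto simp: germ_def)
    then have "\<forall>\<^sub>F q in nhds p. h q = op (f q) (g q)"
      by eventually_elim simp
    then show "h \<in> ?R" by (simp add: germ_def)
  qed
  show "?R \<subseteq> ?L"
  proof
    fix h assume "h \<in> ?R"
    then have "\<forall>\<^sub>F q in nhds p. h q = op (f q) (g q)" "f \<in> germ p f" "g \<in> germ p g"
      by (simp_all add: germ_def)
    then show "h \<in> ?L" by blast
  qed
qed

lemma germ_mult: "germ p f \<otimes>\<^bsub>analytic_germs p\<^esub> germ p g = germ p (\<lambda>q. f q * g q)"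
  using germ_lift2[of p f g "(*)"] by (simp add: analytic_germs_def)

lemma germ_add: "germ p f \<oplus>\<^bsub>analytic_germs p\<^esub> germ p g = germ p (\<lambda>q. f q + g q)"
  using germ_lift2[of p f g "(+)"] by (simp add: analytic_germs_def)

lemma germ_zero: "\<zero>\<^bsub>analytic_germs p\<^esub> = germ p (\<lambda>_. 0)"
  by (simp add: analytic_germs_def)

lemma germ_one: "\<one>\<^bsub>analytic_germs p\<^esub> = germ p (\<lambda>_. 1)"
  by (simp add: analytic_germs_def)

lemma analytic_germs_cring: "cring (analytic_germs p)"
proof (rule cringI)
  let ?R = "analytic_germs p"
  show "abelian_group ?R"
  proof (rule abelian_groupI)
    fix a assume "a \<in> carrier ?R"
    then obtain f where f: "analytic_near p f" "a = germ p f" by (rule germ_carrierE)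
    have "germ p (\<lambda>q. - 1 * f q) \<in> carrier ?R"
      by (intro germ_carrier analytic_near_mult f) simp
    moreover have "germ p (\<lambda>q. - 1 * f q) \<oplus>\<^bsub>?R\<^esub> a = \<zero>\<^bsub>?R\<^esub>"
      by (simp add: f germ_add germ_zero)
    ultimately show "\<exists>b\<in>carrier ?R. b \<oplus>\<^bsub>?R\<^esub> a = \<zero>\<^bsub>?R\<^esub>" by blast
  qed (auto elim!: germ_carrierE simp: germ_add germ_zero add_ac intro!: germ_carrier analytic_near_add)
  show "Group.comm_monoid ?R"
    by (rule comm_monoidI)
      (auto elim!: germ_carrierE simp: germ_mult germ_one mult_ac intro!: germ_carrier analytic_near_mult)
qed (auto elim!: germ_carrierE simp: germ_mult germ_add algebra_simps)

text \<open>Partial derivatives look only at a line through the point, so local equalities have to be restricted to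
lines.\<close>

lemma nhds_slice1:
  assumes "\<forall>\<^sub>F q in nhds r. P q"
  shows "\<forall>\<^sub>F x in nhds (fst r). P (x, snd r)"
proof -
  have "filterlim (\<lambda>x. (x, snd r)) (nhds r) (nhds (fst r))"
    using tendsto_Pair[OF filterlim_ident tendsto_const[of "snd r"], of "fst r"] by simp
  from eventually_compose_filterlim[OF assms this] show ?thesis .
qed

lemma nhds_slice2:
  assumes "\<forall>\<^sub>F q in nhds r. P q"
  shows "\<forall>\<^sub>F y in nhds (snd r). P (fst r, y)"
proof -
  have "filterlim (\<lambda>y. (fst r, y)) (nhds r) (nhds (snd r))"
    using tendsto_Pair[OF tendsto_const[of "fst r"] filterlim_ident, of "snd r"] by simp
  from eventually_compose_filterlim[OF assms this] show ?thesis .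
qed

lemma eventually_dx_cong:
  assumes "\<forall>\<^sub>F q in nhds p. f q = g q"
  shows "\<forall>\<^sub>F q in nhds p. dx f q = dx g q"
proof -
  have "\<forall>\<^sub>F r in nhds p. \<forall>\<^sub>F q in nhds r. f q = g q"
    using assms by (simp add: eventually_eventually)
  then show ?thesis
    by eventually_elim (auto simp: dx_def dest!: nhds_slice1 intro!: deriv_cong_ev)
qed

lemma eventually_dy_cong:
  assumes "\<forall>\<^sub>F q in nhds p. f q = g q"
  shows "\<forall>\<^sub>F q in nhds p. dy f q = dy g q"
proof -
  have "\<forall>\<^sub>F r in nhds p. \<forall>\<^sub>F q in nhds r. f q = g q"
    using assms by (simp add: eventually_eventually)
  then show ?thesis
    by eventually_elim (auto simp: dy_def dest!: nhds_slice2 intro!: deriv_cong_ev)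
qed

lemma germ_dx_germ: "germ_dx p (germ p f) = germ p (dx f)"
proof (rule Set.set_eqI, rule iffI)
  fix h assume "h \<in> germ_dx p (germ p f)"
  then obtain f' where "\<forall>\<^sub>F q in nhds p. f' q = f q" and h: "\<forall>\<^sub>F q in nhds p. h q = dx f' q"
    by (auto simp: germ_dx_def germ_def dx_def)
  from h eventually_dx_cong[OF this(1)] have "\<forall>\<^sub>F q in nhds p. h q = dx f q"
    by eventually_elim simp
  then show "h \<in> germ p (dx f)" by (simp add: germ_def)
next
  fix h assume "h \<in> germ p (dx f)"
  then show "h \<in> germ_dx p (germ p f)"
    by (auto simp: germ_dx_def germ_def dx_def intro!: exI[of _ f])
qed

lemma germ_dy_germ: "germ_dy p (germ p f) = germ p (dy f)"
proof (rule Set.set_eqI, rule iffI)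
  fix h assume "h \<in> germ_dy p (germ p f)"
  then obtain f' where "\<forall>\<^sub>F q in nhds p. f' q = f q" and h: "\<forall>\<^sub>F q in nhds p. h q = dy f' q"
    by (auto simp: germ_dy_def germ_def dy_def)
  from h eventually_dy_cong[OF this(1)] have "\<forall>\<^sub>F q in nhds p. h q = dy f q"
    by eventually_elim simp
  then show "h \<in> germ p (dy f)" by (simp add: germ_def)
next
  fix h assume "h \<in> germ p (dy f)"
  then show "h \<in> germ_dy p (germ p f)"
    by (auto simp: germ_dy_def germ_def dy_def intro!: exI[of _ f])
qed

lemma partials_add:
  assumes "analytic_near p f" "analytic_near p g"
  shows "\<forall>\<^sub>F q in nhds p. dx (\<lambda>q. f q + g q) q = dx f q + dx g q \<and> dy (\<lambda>q. f q + g q) q = dy f q + dy g q"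
  using assms[unfolded analytic_near_iff_eventually]
proof eventually_elim
  case (elim q)
  have "((\<lambda>q. f q + g q) has_derivative
      (\<lambda>(u, v). (dx f q + dx g q) * u + (dy f q + dy g q) * v)) (at q)"
    using elim by (auto intro!: derivative_eq_intros simp: algebra_simps)
  then show ?case by (simp add: partial_derivatives_unique)
qed

lemma partials_mult:
  assumes "analytic_near p f" "analytic_near p g"
  shows "\<forall>\<^sub>F q in nhds p. dx (\<lambda>q. f q * g q) q = dx f q * g q + f q * dx g q \<and>
     dy (\<lambda>q. f q * g q) q = dy f q * g q + f q * dy g q"
  using assms[unfolded analytic_near_iff_eventually]
proof eventually_elim
  case (elim q)
  have "((\<lambda>q. f q * g q) has_derivative
      (\<lambda>(u, v). (dx f q * g q + f q * dx g q) * u + (dy f q * g q + f q * dy g q) * v)) (at q)"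
    using elim by (auto intro!: derivative_eq_intros simp: algebra_simps)
  then show ?case by (simp add: partial_derivatives_unique)
qed

lemma partials_const [simp]: "dx (\<lambda>_. c) q = 0" "dy (\<lambda>_. c) q = 0"
  by (simp_all add: dx_def dy_def)

section \<open>First order operators with constant coefficients\<close>

text \<open>Operators of this kind commute, because mixed partial derivatives agree. The two operators that multiply
the exponential by \<open>u\<close> and by \<open>v\<close> will be of this kind.\<close>

definition const_op :: "complex \<Rightarrow> complex \<Rightarrow> complex \<Rightarrow> fun2 \<Rightarrow> fun2" where
  "const_op k0 k1 k2 f q = k0 * f q + k1 * dx f q + k2 * dy f q"

lemma analytic_near_const_op [simp]: "analytic_near p f \<Longrightarrow> analytic_near p (const_op k0 k1 k2 f)"
  unfolding const_op_def
  by (intro analytic_near_add analytic_near_mult analytic_near_const analytic_near_dx analytic_near_dy)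

lemma const_op_cong:
  assumes "\<forall>\<^sub>F q in nhds p. f q = g q"
  shows "\<forall>\<^sub>F q in nhds p. const_op k0 k1 k2 f q = const_op k0 k1 k2 g q"
  using assms eventually_dx_cong[OF assms] eventually_dy_cong[OF assms]
  by eventually_elim (simp add: const_op_def)

lemma const_op_add:
  assumes "analytic_near p f" "analytic_near p g"
  shows "\<forall>\<^sub>F q in nhds p. const_op k0 k1 k2 (\<lambda>q. f q + g q) q = const_op k0 k1 k2 f q + const_op k0 k1 k2 g q"
  using partials_add[OF assms] by eventually_elim (simp add: const_op_def algebra_simps)

text \<open>The Leibniz rule: only the derivation part of the operator falls on the first factor.\<close>

lemma const_op_mult:
  assumes "analytic_near p f" "analytic_near p g"
  shows "\<forall>\<^sub>F q in nhds p. const_op k0 k1 k2 (\<lambda>q. f q * g q) q = const_op 0 k1 k2 f q * g q + f q * const_op k0 k1 k2 g q"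
  using partials_mult[OF assms] by eventually_elim (simp add: const_op_def algebra_simps)

lemma const_op_commute:
  assumes f: "analytic_near p f"
  shows "\<forall>\<^sub>F q in nhds p. const_op k0 k1 k2 (const_op l0 l1 l2 f) q = const_op l0 l1 l2 (const_op k0 k1 k2 f) q"
proof -
  note an = analytic_near_dx analytic_near_dy analytic_near_const f analytic_near_mult analytic_near_add
  have expand: "\<forall>\<^sub>F q in nhds p.
      dx (const_op l0 l1 l2 f) q = l0 * dx f q + l1 * dx (dx f) q + l2 * dx (dy f) q \<and>
      dy (const_op l0 l1 l2 f) q = l0 * dy f q + l1 * dy (dx f) q + l2 * dy (dy f) q" for l0 l1 l2
  proof -
    have e: "const_op l0 l1 l2 f = (\<lambda>q. (l0 * f q + l1 * dx f q) + l2 * dy f q)"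
      by (simp add: const_op_def fun_eq_iff)
    have "\<forall>\<^sub>F q in nhds p. dx (\<lambda>q. (l0 * f q + l1 * dx f q) + l2 * dy f q) q =
            dx (\<lambda>q. l0 * f q + l1 * dx f q) q + dx (\<lambda>q. l2 * dy f q) q \<and>
          dy (\<lambda>q. (l0 * f q + l1 * dx f q) + l2 * dy f q) q =
            dy (\<lambda>q. l0 * f q + l1 * dx f q) q + dy (\<lambda>q. l2 * dy f q) q"
      by (rule partials_add) (intro an)+
    moreover have "\<forall>\<^sub>F q in nhds p. dx (\<lambda>q. l0 * f q + l1 * dx f q) q = dx (\<lambda>q. l0 * f q) q + dx (\<lambda>q. l1 * dx f q) q \<and>
          dy (\<lambda>q. l0 * f q + l1 * dx f q) q = dy (\<lambda>q. l0 * f q) q + dy (\<lambda>q. l1 * dx f q) q"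
      by (rule partials_add) (intro an)+
    moreover note partials_mult[OF analytic_near_const[of p l0] f]
      partials_mult[OF analytic_near_const[of p l1] analytic_near_dx[OF f]]
      partials_mult[OF analytic_near_const[of p l2] analytic_near_dy[OF f]]
    ultimately show ?thesis
      unfolding e by eventually_elim simp
  qed
  from expand[of l0 l1 l2] expand[of k0 k1 k2] analytic_near_mixed_partials[OF f]
  show ?thesis
    by eventually_elim (simp add: const_op_def algebra_simps)
qed

lemma const_op_exp:
  "const_op k0 k1 k2 (\<lambda>(x, y). exp (x * a + y * b)) q =
     (k0 + k1 * a + k2 * b) * (\<lambda>(x, y). exp (x * a + y * b)) q"
  using partial_derivatives_unique(1,2)[OF exp_linear_has_derivative[of a b q]]
  by (simp add: const_op_def case_prod_unfold algebra_simps)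

section \<open>The ring of differential operators\<close>

locale germs =
  fixes p :: "complex \<times> complex"
begin

abbreviation \<O> where "\<O> \<equiv> analytic_germs p"
abbreviation \<E> where "\<E> \<equiv> additive_endomorphisms \<O>"

sublocale R: cring \<O> by (rule analytic_germs_cring)
sublocale E: ring \<E> by (rule R.additive_endomorphisms_ring)

definition mulop :: "fun2 \<Rightarrow> fun2 set \<Rightarrow> fun2 set" where
  "mulop f = (\<lambda>b\<in>carrier \<O>. germ p f \<otimes>\<^bsub>\<O>\<^esub> b)"

text \<open>The action of \<open>const_op\<close> on germs. The chosen representative does not matter, by \<open>dop_germ\<close>.\<close>

definition dop :: "complex \<Rightarrow> complex \<Rightarrow> complex \<Rightarrow> fun2 set \<Rightarrow> fun2 set" where
  "dop k0 k1 k2 = (\<lambda>b\<in>carrier \<O>. germ p (const_op k0 k1 k2 (SOME f. analytic_near p f \<and> b = germ p f)))"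

definition op_gens :: "(fun2 set \<Rightarrow> fun2 set) set" where
  "op_gens = mulop ` {f. analytic_near p f} \<union> {dop 0 1 0, dop 0 0 1}"

definition \<D> :: "(fun2 set \<Rightarrow> fun2 set) set" where
  "\<D> = generate_ring \<E> op_gens"

text \<open>Multiplication of a germ by a constant. All differential operators commute with it, and the values of \<open>u\<close>,
\<open>v\<close>, \<open>w\<close> at a point of the surface will enter as such constants.\<close>

definition scale :: "complex \<Rightarrow> fun2 set \<Rightarrow> fun2 set" where
  "scale c a = germ p (\<lambda>_. c) \<otimes>\<^bsub>\<O>\<^esub> a"

lemma mulop_germ: "analytic_near p f \<Longrightarrow> mulop a (germ p f) = germ p (\<lambda>q. a q * f q)"
  by (simp add: mulop_def germ_carrier germ_mult)

lemma dop_germ: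
  assumes f: "analytic_near p f"
  shows "dop k0 k1 k2 (germ p f) = germ p (const_op k0 k1 k2 f)"
proof -
  let ?f = "SOME f'. analytic_near p f' \<and> germ p f = germ p f'"
  have "\<exists>f'. analytic_near p f' \<and> germ p f = germ p f'"
    using f by blast
  then have "analytic_near p ?f \<and> germ p f = germ p ?f"
    by (rule someI_ex)
  then have "germ p (const_op k0 k1 k2 f) = germ p (const_op k0 k1 k2 ?f)"
    by (simp add: germ_eq_iff const_op_cong)
  then show ?thesis
    using f by (simp add: dop_def germ_carrier)
qed

lemma scale_germ: "scale c (germ p f) = germ p (\<lambda>q. c * f q)"
  by (simp add: scale_def germ_mult)

lemma endo_eqI:
  assumes "S \<in> carrier \<E>" "T \<in> carrier \<E>" "\<And>f. analytic_near p f \<Longrightarrow> S (germ p f) = T (germ p f)"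
  shows "S = T"
  by (rule R.additive_endomorphisms_eqI)
     (use assms R.additive_endomorphismsD(1) in \<open>auto elim!: germ_carrierE\<close>)

lemma mulop_carrier: "analytic_near p f \<Longrightarrow> mulop f \<in> carrier \<E>"
  by (rule R.additive_endomorphismsI) (simp_all add: mulop_def germ_carrier R.r_distr)

lemma dop_carrier: "dop k0 k1 k2 \<in> carrier \<E>"
proof (rule R.additive_endomorphismsI)
  fix a b assume "a \<in> carrier \<O>" "b \<in> carrier \<O>"
  then obtain f g where "analytic_near p f" "a = germ p f" "analytic_near p g" "b = germ p g"
    by (metis germ_carrierE)
  then show "dop k0 k1 k2 (a \<oplus>\<^bsub>\<O>\<^esub> b) = dop k0 k1 k2 a \<oplus>\<^bsub>\<O>\<^esub> dop k0 k1 k2 b"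
    by (simp add: germ_add dop_germ analytic_near_add germ_eq_iff const_op_add)
next
  fix a assume "a \<in> carrier \<O>"
  then show "dop k0 k1 k2 a \<in> carrier \<O>"
    by (elim germ_carrierE) (simp add: dop_germ germ_carrier)
qed (simp add: dop_def)

lemma op_gens_carrier: "op_gens \<subseteq> carrier \<E>"
  by (auto simp: op_gens_def mulop_carrier dop_carrier)

lemma \<D>_carrier: "T \<in> \<D> \<Longrightarrow> T \<in> carrier \<E>"
  unfolding \<D>_def by (rule E.generate_ring_in_carrier[OF op_gens_carrier])

lemma diff_ops_eq: "diff_ops p = \<E>\<lparr>carrier := \<D>\<rparr>"
proof -
  have 1: "{\<lambda>b\<in>carrier \<O>. a \<otimes>\<^bsub>\<O>\<^esub> b | a. a \<in> carrier \<O>} = mulop ` {f. analytic_near p f}"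
    by (auto simp: mulop_def germ_carrier elim!: germ_carrierE)
  have 2: "restrict (germ_dx p) (carrier \<O>) = dop 0 1 0"
    by (rule R.additive_endomorphisms_eqI)
       (auto elim!: germ_carrierE simp: germ_carrier dop_germ germ_dx_germ const_op_def[abs_def]
          R.additive_endomorphismsD(1)[OF dop_carrier])
  have 3: "restrict (germ_dy p) (carrier \<O>) = dop 0 0 1"
    by (rule R.additive_endomorphisms_eqI)
       (auto elim!: germ_carrierE simp: germ_carrier dop_germ germ_dy_germ const_op_def[abs_def]
          R.additive_endomorphismsD(1)[OF dop_carrier])
  show ?thesis
    unfolding diff_ops_def Let_def 1 2 3 \<D>_def op_gens_def by simp
qed

lemma diff_ops_ring: "ring (diff_ops p)"
  unfolding diff_ops_eq \<D>_def by (rule E.generate_ring_is_ring[OF op_gens_carrier])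

lemma \<D>_closed [simp]:
  "S \<in> \<D> \<Longrightarrow> T \<in> \<D> \<Longrightarrow> S \<oplus>\<^bsub>\<E>\<^esub> T \<in> \<D>"
  "S \<in> \<D> \<Longrightarrow> T \<in> \<D> \<Longrightarrow> S \<otimes>\<^bsub>\<E>\<^esub> T \<in> \<D>"
  "S \<in> \<D> \<Longrightarrow> \<ominus>\<^bsub>\<E>\<^esub> S \<in> \<D>"
  "\<zero>\<^bsub>\<E>\<^esub> \<in> \<D>" "\<one>\<^bsub>\<E>\<^esub> \<in> \<D>"
  "analytic_near p f \<Longrightarrow> mulop f \<in> \<D>"
  unfolding \<D>_def
  by (auto intro: generate_ring.intros E.zero_in_generate simp: op_gens_def)

lemma endo_simps:
  assumes "S \<in> carrier \<E>" "T \<in> carrier \<E>" "a \<in> carrier \<O>"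
  shows "T a \<in> carrier \<O>" "(S \<oplus>\<^bsub>\<E>\<^esub> T) a = S a \<oplus>\<^bsub>\<O>\<^esub> T a" "(S \<otimes>\<^bsub>\<E>\<^esub> T) a = S (T a)"
    "(\<ominus>\<^bsub>\<E>\<^esub> T) a = \<ominus>\<^bsub>\<O>\<^esub> T a" "\<one>\<^bsub>\<E>\<^esub> a = a" "\<zero>\<^bsub>\<E>\<^esub> a = \<zero>\<^bsub>\<O>\<^esub>"
proof -
  note app = R.additive_endomorphisms_apply[OF assms(3)] and D = R.additive_endomorphismsD
  show "T a \<in> carrier \<O>" "(S \<oplus>\<^bsub>\<E>\<^esub> T) a = S a \<oplus>\<^bsub>\<O>\<^esub> T a" "(S \<otimes>\<^bsub>\<E>\<^esub> T) a = S (T a)"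
    "\<one>\<^bsub>\<E>\<^esub> a = a" "\<zero>\<^bsub>\<E>\<^esub> a = \<zero>\<^bsub>\<O>\<^esub>"
    using D(2)[OF assms(2,3)] by (simp_all add: app)
  have "(\<ominus>\<^bsub>\<E>\<^esub> T \<oplus>\<^bsub>\<E>\<^esub> T) a = \<zero>\<^bsub>\<O>\<^esub>"
    using assms(2) by (simp add: E.l_neg app)
  then have "(\<ominus>\<^bsub>\<E>\<^esub> T) a \<oplus>\<^bsub>\<O>\<^esub> T a = \<zero>\<^bsub>\<O>\<^esub>"
    by (simp add: app)
  then show "(\<ominus>\<^bsub>\<E>\<^esub> T) a = \<ominus>\<^bsub>\<O>\<^esub> T a"
    using assms by (intro R.minus_equality[symmetric]) (auto simp: D(2))
qed

lemma \<D>_apply: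
  assumes "T \<in> \<D>" "a \<in> carrier \<O>"
  shows "T a \<in> carrier \<O>" "b \<in> carrier \<O> \<Longrightarrow> T (a \<oplus>\<^bsub>\<O>\<^esub> b) = T a \<oplus>\<^bsub>\<O>\<^esub> T b"
    "(\<ominus>\<^bsub>\<E>\<^esub> T) a = \<ominus>\<^bsub>\<O>\<^esub> T a"
    "S \<in> \<D> \<Longrightarrow> (S \<oplus>\<^bsub>\<E>\<^esub> T) a = S a \<oplus>\<^bsub>\<O>\<^esub> T a"
    "S \<in> \<D> \<Longrightarrow> (S \<otimes>\<^bsub>\<E>\<^esub> T) a = S (T a)"
  using assms endo_simps[OF \<D>_carrier \<D>_carrier] R.additive_endomorphismsD[OF \<D>_carrier]
  by auto

lemma scale_carrier [simp]: "a \<in> carrier \<O> \<Longrightarrow> scale c a \<in> carrier \<O>"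
  by (simp add: scale_def germ_carrier)

lemma scale_simps:
  assumes "a \<in> carrier \<O>"
  shows "b \<in> carrier \<O> \<Longrightarrow> scale c (a \<oplus>\<^bsub>\<O>\<^esub> b) = scale c a \<oplus>\<^bsub>\<O>\<^esub> scale c b"
    "scale c (scale d a) = scale (c * d) a"
    "scale c (\<ominus>\<^bsub>\<O>\<^esub> a) = \<ominus>\<^bsub>\<O>\<^esub> scale c a"
    "scale c a \<oplus>\<^bsub>\<O>\<^esub> scale d a = scale (c + d) a"
    "scale 1 a = a" "scale 0 a = \<zero>\<^bsub>\<O>\<^esub>"
proof -
  obtain f where f: "analytic_near p f" "a = germ p f" using assms by (rule germ_carrierE)
  show "b \<in> carrier \<O> \<Longrightarrow> scale c (a \<oplus>\<^bsub>\<O>\<^esub> b) = scale c a \<oplus>\<^bsub>\<O>\<^esub> scale c b"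
    using assms by (simp add: scale_def germ_carrier R.r_distr)
  show "scale c (\<ominus>\<^bsub>\<O>\<^esub> a) = \<ominus>\<^bsub>\<O>\<^esub> scale c a"
    using assms by (simp add: scale_def germ_carrier R.r_minus)
  show "scale c (scale d a) = scale (c * d) a" "scale c a \<oplus>\<^bsub>\<O>\<^esub> scale d a = scale (c + d) a"
    "scale 1 a = a" "scale 0 a = \<zero>\<^bsub>\<O>\<^esub>"
    by (simp_all add: f scale_germ germ_add germ_zero algebra_simps)
qed

lemma scale_zero [simp]: "scale c \<zero>\<^bsub>\<O>\<^esub> = \<zero>\<^bsub>\<O>\<^esub>"
  by (simp add: germ_zero scale_germ)

lemma \<D>_scale:
  assumes "T \<in> \<D>" "a \<in> carrier \<O>"
  shows "T (scale c a) = scale c (T a)"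
  using assms unfolding \<D>_def
proof (induction arbitrary: a rule: generate_ring.induct)
  case one
  then show ?case by (simp add: endo_simps[OF E.zero_closed E.zero_closed])
next
  case (incl h)
  then obtain f where f: "analytic_near p f" "a = germ p f" by (elim germ_carrierE)
  consider g where "analytic_near p g" "h = mulop g" | "h = dop 0 1 0" | "h = dop 0 0 1"
    using incl(1) by (auto simp: op_gens_def)
  then show ?case
  proof cases
    case 1
    then show ?thesis
      using f by (simp add: scale_germ mulop_germ analytic_near_mult mult_ac)
  next
    case 2
    then show ?thesis
      using f const_op_mult[OF analytic_near_const[of p c] f(1), of 0 1 0]
      by (simp add: scale_germ dop_germ analytic_near_mult germ_eq_iff) (simp add: const_op_def)
  next
    case 3
    then show ?thesis
      using f const_op_mult[OF analytic_near_const[of p c] f(1), of 0 0 1]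
      by (simp add: scale_germ dop_germ analytic_near_mult germ_eq_iff) (simp add: const_op_def)
  qed
next
  case (a_inv h)
  then show ?case
    using \<D>_apply[of h] by (simp add: \<D>_def[symmetric] scale_simps)
next
  case (eng_add h1 h2)
  then show ?case
    using \<D>_apply[of h1] \<D>_apply[of h2] by (simp add: \<D>_def[symmetric] scale_simps)
next
  case (eng_mult h1 h2)
  then show ?case
    using \<D>_apply[of h2] by (simp add: \<D>_def[symmetric])
qed

lemma dop_eq: "dop k0 k1 k2 = mulop (\<lambda>_. k0) \<oplus>\<^bsub>\<E>\<^esub> mulop (\<lambda>_. k1) \<otimes>\<^bsub>\<E>\<^esub> dop 0 1 0 \<oplus>\<^bsub>\<E>\<^esub> mulop (\<lambda>_. k2) \<otimes>\<^bsub>\<E>\<^esub> dop 0 0 1"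
proof (rule endo_eqI)
  fix f assume "analytic_near p f"
  then show "dop k0 k1 k2 (germ p f) = (mulop (\<lambda>_. k0) \<oplus>\<^bsub>\<E>\<^esub> mulop (\<lambda>_. k1) \<otimes>\<^bsub>\<E>\<^esub> dop 0 1 0 \<oplus>\<^bsub>\<E>\<^esub> mulop (\<lambda>_. k2) \<otimes>\<^bsub>\<E>\<^esub> dop 0 0 1) (germ p f)"
    by (simp add: R.additive_endomorphisms_apply germ_carrier mulop_germ dop_germ germ_add)
       (simp add: const_op_def[abs_def])
qed (simp_all add: dop_carrier mulop_carrier)

lemma dop_\<D> [simp]: "dop k0 k1 k2 \<in> \<D>"
proof -
  have "dop 0 1 0 \<in> \<D>" "dop 0 0 1 \<in> \<D>"
    unfolding \<D>_def op_gens_def by (auto intro: generate_ring.incl)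
  then show ?thesis by (subst dop_eq) simp
qed

lemma dop_leibniz:
  assumes f: "analytic_near p f"
  shows "dop k0 k1 k2 \<otimes>\<^bsub>\<E>\<^esub> mulop f = mulop (const_op 0 k1 k2 f) \<oplus>\<^bsub>\<E>\<^esub> mulop f \<otimes>\<^bsub>\<E>\<^esub> dop k0 k1 k2"
proof (rule endo_eqI)
  fix g assume g: "analytic_near p g"
  show "(dop k0 k1 k2 \<otimes>\<^bsub>\<E>\<^esub> mulop f) (germ p g) = (mulop (const_op 0 k1 k2 f) \<oplus>\<^bsub>\<E>\<^esub> mulop f \<otimes>\<^bsub>\<E>\<^esub> dop k0 k1 k2) (germ p g)"
    using f g const_op_mult[OF f g, of k0 k1 k2]
    by (simp add: R.additive_endomorphisms_apply germ_carrier mulop_germ dop_germ germ_add analytic_near_mult germ_eq_iff)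
qed (simp_all add: dop_carrier mulop_carrier f)

lemma dop_commute: "dop k0 k1 k2 \<otimes>\<^bsub>\<E>\<^esub> dop l0 l1 l2 = dop l0 l1 l2 \<otimes>\<^bsub>\<E>\<^esub> dop k0 k1 k2"
proof (rule endo_eqI)
  fix g assume g: "analytic_near p g"
  show "(dop k0 k1 k2 \<otimes>\<^bsub>\<E>\<^esub> dop l0 l1 l2) (germ p g) = (dop l0 l1 l2 \<otimes>\<^bsub>\<E>\<^esub> dop k0 k1 k2) (germ p g)"
    using g const_op_commute[OF g]
    by (simp add: R.additive_endomorphisms_apply germ_carrier dop_germ germ_eq_iff)
qed (simp_all add: dop_carrier)

lemma mulop_zero: "mulop (\<lambda>_. 0) = \<zero>\<^bsub>\<E>\<^esub>"
  by (rule endo_eqI) (simp_all add: mulop_carrier mulop_germ R.additive_endomorphisms_apply germ_carrier germ_zero)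

lemma mulop_one: "mulop (\<lambda>_. 1) = \<one>\<^bsub>\<E>\<^esub>"
  by (rule endo_eqI) (simp_all add: mulop_carrier mulop_germ R.additive_endomorphisms_apply germ_carrier)

lemma mulop_mult:
  assumes "analytic_near p f" "analytic_near p g"
  shows "mulop f \<otimes>\<^bsub>\<E>\<^esub> mulop g = mulop (\<lambda>q. f q * g q)"
  by (rule endo_eqI)
     (use assms in \<open>simp_all add: mulop_carrier mulop_germ R.additive_endomorphisms_apply germ_carrier
        analytic_near_mult mult.assoc\<close>)

lemma mulop_add:
  assumes "analytic_near p f" "analytic_near p g"
  shows "mulop f \<oplus>\<^bsub>\<E>\<^esub> mulop g = mulop (\<lambda>q. f q + g q)"
  by (rule endo_eqI)
     (use assms in \<open>simp_all add: mulop_carrier mulop_germ R.additive_endomorphisms_apply germ_carrier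
        analytic_near_add germ_add algebra_simps\<close>)

lemma mulop_cong: "germ p f = germ p g \<Longrightarrow> mulop f = mulop g"
  by (simp add: mulop_def)

text \<open>The partial derivatives are linear combinations of any two independent operators with constant
coefficients and of the constants, so these two operators can serve as the variables \<open>X, Y\<close> of the normal
form.\<close>

lemma \<D>_normal_form:
  assumes "T \<in> \<D>" and det: "k1 * l2 - k2 * l1 \<noteq> 0"
  shows "T \<in> E.left_polynomials (E.left_polynomials (mulop ` {f. analytic_near p f}) (dop k0 k1 k2)) (dop l0 l1 l2)"
proof -
  let ?K = "mulop ` {f. analytic_near p f}" and ?X = "dop k0 k1 k2" and ?Y = "dop l0 l1 l2"
  have lin: "dop m0 m1 m2 = mulop (\<lambda>_. a) \<oplus>\<^bsub>\<E>\<^esub> mulop (\<lambda>_. b) \<otimes>\<^bsub>\<E>\<^esub> ?X \<oplus>\<^bsub>\<E>\<^esub> mulop (\<lambda>_. c) \<otimes>\<^bsub>\<E>\<^esub> ?Y"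
    if "m0 = a + b * k0 + c * l0" "m1 = b * k1 + c * l1" "m2 = b * k2 + c * l2" for a b c m0 m1 m2
  proof (rule endo_eqI)
    fix f assume "analytic_near p f"
    then show "dop m0 m1 m2 (germ p f) =
       (mulop (\<lambda>_. a) \<oplus>\<^bsub>\<E>\<^esub> mulop (\<lambda>_. b) \<otimes>\<^bsub>\<E>\<^esub> ?X \<oplus>\<^bsub>\<E>\<^esub> mulop (\<lambda>_. c) \<otimes>\<^bsub>\<E>\<^esub> ?Y) (germ p f)"
      by (simp add: R.additive_endomorphisms_apply germ_carrier mulop_germ dop_germ germ_add)
         (simp add: const_op_def[abs_def] that algebra_simps)
  qed (simp_all add: dop_carrier mulop_carrier)
  obtain i where i: "i * (k1 * l2 - k2 * l1) = 1"
    using det by (metis left_inverse)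
  have "generate_ring \<E> op_gens \<subseteq> E.left_polynomials (E.left_polynomials ?K ?X) ?Y"
  proof (rule E.ore_normal_form)
    show "\<one>\<^bsub>\<E>\<^esub> \<in> ?K" "\<zero>\<^bsub>\<E>\<^esub> \<in> ?K"
      by (auto simp flip: mulop_one mulop_zero)
    show "?Y \<otimes>\<^bsub>\<E>\<^esub> ?X = ?X \<otimes>\<^bsub>\<E>\<^esub> ?Y" by (rule dop_commute)
    show "\<ominus>\<^bsub>\<E>\<^esub> k \<in> ?K" if "k \<in> ?K" for k
    proof -
      obtain f where f: "analytic_near p f" "k = mulop f" using \<open>k \<in> ?K\<close> by blast
      have g: "analytic_near p (\<lambda>q. - 1 * f q)" by (intro analytic_near_mult f) simp
      have "mulop (\<lambda>q. - 1 * f q) \<oplus>\<^bsub>\<E>\<^esub> k = \<zero>\<^bsub>\<E>\<^esub>"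
        using f g by (simp add: mulop_add mulop_zero)
      then have "\<ominus>\<^bsub>\<E>\<^esub> k = mulop (\<lambda>q. - 1 * f q)"
        using f g by (intro E.minus_equality) (auto simp: mulop_carrier)
      then show ?thesis using g by blast
    qed
    fix s assume "s \<in> op_gens"
    then consider f where "analytic_near p f" "s = mulop f" | "s = dop 0 1 0" | "s = dop 0 0 1"
      by (auto simp: op_gens_def)
    then show "\<exists>a\<in>?K. \<exists>b\<in>?K. \<exists>c\<in>?K. s = a \<oplus>\<^bsub>\<E>\<^esub> b \<otimes>\<^bsub>\<E>\<^esub> ?X \<oplus>\<^bsub>\<E>\<^esub> c \<otimes>\<^bsub>\<E>\<^esub> ?Y"
    proof cases
      case (1 f)
      have "s = mulop f \<oplus>\<^bsub>\<E>\<^esub> mulop (\<lambda>_. 0) \<otimes>\<^bsub>\<E>\<^esub> ?X \<oplus>\<^bsub>\<E>\<^esub> mulop (\<lambda>_. 0) \<otimes>\<^bsub>\<E>\<^esub> ?Y"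
        using 1 by (simp add: mulop_zero mulop_carrier dop_carrier)
      then show ?thesis
        using 1(1) analytic_near_const by blast
    next
      case 2
      have "s = mulop (\<lambda>_. (k2 * l0 - l2 * k0) * i) \<oplus>\<^bsub>\<E>\<^esub> mulop (\<lambda>_. l2 * i) \<otimes>\<^bsub>\<E>\<^esub> ?X \<oplus>\<^bsub>\<E>\<^esub> mulop (\<lambda>_. - k2 * i) \<otimes>\<^bsub>\<E>\<^esub> ?Y"
        unfolding 2 by (rule lin) (use i in \<open>auto simp: algebra_simps\<close>)
      then show ?thesis
        using analytic_near_const by blast
    next
      case 3
      have "s = mulop (\<lambda>_. (l1 * k0 - k1 * l0) * i) \<oplus>\<^bsub>\<E>\<^esub> mulop (\<lambda>_. - l1 * i) \<otimes>\<^bsub>\<E>\<^esub> ?X \<oplus>\<^bsub>\<E>\<^esub> mulop (\<lambda>_. k1 * i) \<otimes>\<^bsub>\<E>\<^esub> ?Y"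
        unfolding 3 by (rule lin) (use i in \<open>auto simp: algebra_simps\<close>)
      then show ?thesis
        using analytic_near_const by blast
    qed
  next
    fix k assume "k \<in> ?K"
    then show "\<exists>l\<in>?K. ?X \<otimes>\<^bsub>\<E>\<^esub> k = l \<oplus>\<^bsub>\<E>\<^esub> k \<otimes>\<^bsub>\<E>\<^esub> ?X"
      using dop_leibniz by fastforce
  next
    fix k assume "k \<in> ?K"
    then show "\<exists>l\<in>?K. ?Y \<otimes>\<^bsub>\<E>\<^esub> k = l \<oplus>\<^bsub>\<E>\<^esub> k \<otimes>\<^bsub>\<E>\<^esub> ?Y"
      using dop_leibniz by fastforce
  qed (auto simp: mulop_carrier dop_carrier mulop_add mulop_mult analytic_near_add analytic_near_mult
         op_gens_carrier[THEN subsetD] intro!: imageI)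
  then show ?thesis using assms(1) by (auto simp: \<D>_def)
qed

end



section \<open>Bihomogeneous functions on a product of projective lines\<close>

definition monomial_form :: "nat \<Rightarrow> nat \<Rightarrow> nat \<Rightarrow> form" where
  "monomial_form k i j z1 z2 w1 w2 = z1 ^ i * z2 ^ (k - i) * w1 ^ j * w2 ^ (k - j)"

definition bihomogeneous :: "nat \<Rightarrow> form \<Rightarrow> bool" where
  "bihomogeneous k f \<longleftrightarrow> (\<forall>c z1 z2 w1 w2.
     f (c * z1) (c * z2) w1 w2 = c ^ k * f z1 z2 w1 w2 \<and> f z1 z2 (c * w1) (c * w2) = c ^ k * f z1 z2 w1 w2)"

lemma bihomogeneous_bilinear: "bihomogeneous 1 (bilinear_form a b c d)"
  by (auto simp: bihomogeneous_def bilinear_form_def algebra_simps)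

lemma bihomogeneous_monomial:
  assumes "i \<le> k" "j \<le> k" shows "bihomogeneous k (monomial_form k i j)"
proof -
  have "c ^ i * c ^ (k - i) = c ^ k" "c ^ j * c ^ (k - j) = c ^ k" for c :: complex
    using assms by (simp_all flip: power_add)
  then show ?thesis
    by (simp add: bihomogeneous_def monomial_form_def power_mult_distrib ac_simps)
qed

text \<open>The value of \<open>f / g\<^sup>k\<close> at a point of the product, read off from some representatives of the coordinates.
For forms of the right bidegree every choice of coordinates gives the same value (\<open>ratio_pt\<close>).\<close>

definition ratio :: "form \<Rightarrow> nat \<Rightarrow> form \<Rightarrow> cp1 \<times> cp1 \<Rightarrow> complex" where
  "ratio g k f P = (case (rep_cp1 (fst P), rep_cp1 (snd P)) of
     ((z1, z2), (w1, w2)) \<Rightarrow> f z1 z2 w1 w2 / g z1 z2 w1 w2 ^ k)"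

lemma rep_cp1_pt:
  assumes "(z1, z2) \<noteq> 0"
  obtains c where "c \<noteq> 0" "rep_cp1 (pt z1 z2) = (c * z1, c * z2)"
proof -
  have "proj_rel (z1, z2) (z1, z2)"
    using assms by (auto simp: proj_rel_def intro!: exI[of _ 1])
  then have "proj_rel (z1, z2) (rep_cp1 (pt z1 z2))"
    unfolding pt_def using Quotient_rep_abs[OF Quotient_cp1] Quotient_symp[OF Quotient_cp1, THEN sympD] by blast
  then show ?thesis
    using that by (auto simp: proj_rel_def)
qed

lemma cp1_cases:
  obtains t1 t2 where "t = pt t1 t2" "(t1, t2) \<noteq> 0"
proof -
  have "t = pt (fst (rep_cp1 t)) (snd (rep_cp1 t))"
    by (simp add: pt_def Quotient_abs_rep[OF Quotient_cp1])
  moreover have "proj_rel (rep_cp1 t) (rep_cp1 t)"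
    by (rule Quotient_rep_reflp[OF Quotient_cp1])
  ultimately show ?thesis using that by (auto simp: proj_rel_def)
qed

lemma ratio_pt:
  assumes f: "bihomogeneous k f" and g: "bihomogeneous 1 g" "g z1 z2 w1 w2 \<noteq> 0"
  shows "ratio g k f (pt z1 z2, pt w1 w2) = f z1 z2 w1 w2 / g z1 z2 w1 w2 ^ k"
proof -
  have "g 0 0 w1 w2 = 0" "g z1 z2 0 0 = 0"
    using g(1)[unfolded bihomogeneous_def, rule_format, of 0] by simp_all
  with g(2) have "(z1, z2) \<noteq> 0" "(w1, w2) \<noteq> 0"
    by (auto simp: zero_prod_def)
  then obtain c d where c: "c \<noteq> 0" "rep_cp1 (pt z1 z2) = (c * z1, c * z2)"
    and d: "d \<noteq> 0" "rep_cp1 (pt w1 w2) = (d * w1, d * w2)"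
    by (metis rep_cp1_pt)
  have "f (c * z1) (c * z2) (d * w1) (d * w2) = c ^ k * (d ^ k * f z1 z2 w1 w2)"
    using f by (simp add: bihomogeneous_def)
  moreover have "g (c * z1) (c * z2) (d * w1) (d * w2) = c * (d * g z1 z2 w1 w2)"
    using g(1) by (simp add: bihomogeneous_def)
  ultimately show ?thesis
    using c d g(2) by (simp add: ratio_def power_mult_distrib)
qed

section \<open>The complement of the curve as a double cover of the plane\<close>

text \<open>The forms after the gluing conditions are solved for their coefficients. The parameters \<open>k\<^sub>i\<close>, \<open>e\<^sub>i\<close> are
chosen such that \<open>g\<^sub>i / g = k\<^sub>i + c\<^sub>i \<delta> u + e\<^sub>i v\<close>, see \<open>exponents_pt\<close>.\<close>

locale glued_surface = germs p for p :: "complex \<times> complex" +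
  fixes B \<gamma> \<delta> k1 k2 e1 e2 c1 c2 \<Lambda> :: complex and g g1 g2 :: form
  assumes B: "B \<noteq> 0" and \<delta>: "\<delta> \<noteq> 0"
    and g: "g = bilinear_form (B\<^sup>2 * \<delta>) (B * \<delta>) \<gamma> \<delta>"
    and g1: "g1 = bilinear_form (k1 * (B\<^sup>2 * \<delta>) + 2 * B\<^sup>2 * c1 * \<delta>) (k1 * (B * \<delta>) + B * c1 * \<delta>) (k1 * \<gamma> + e1) (k1 * \<delta>)"
    and g2: "g2 = bilinear_form (k2 * (B\<^sup>2 * \<delta>) + 2 * B\<^sup>2 * c2 * \<delta>) (k2 * (B * \<delta>) + B * c2 * \<delta>) (k2 * \<gamma> + e2) (k2 * \<delta>)"
    and indep: "c1 * e2 - c2 * e1 \<noteq> 0"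
    and \<Lambda>: "\<Lambda> \<noteq> exp (c1 * fst p + c2 * snd p)"
begin

abbreviation nv where "nv \<equiv> nonvanishing g"

definition mon :: "nat \<Rightarrow> nat \<Rightarrow> nat \<Rightarrow> cp1 \<times> cp1 \<Rightarrow> complex" where
  "mon k i j = ratio g k (monomial_form k i j)"

text \<open>The affine coordinates on the complement of the curve. The first two occur in the exponents; the third one
completes them to a basis of the bilinear forms modulo \<open>g\<close>.\<close>

definition u :: "cp1 \<times> cp1 \<Rightarrow> complex" where "u P = 2 * B\<^sup>2 * mon 1 1 1 P + B * mon 1 1 0 P"
definition v :: "cp1 \<times> cp1 \<Rightarrow> complex" where "v P = mon 1 0 1 P"
definition w :: "cp1 \<times> cp1 \<Rightarrow> complex" where "w P = mon 1 1 1 P"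

lemma nv_cases:
  assumes "P \<in> nv"
  obtains z1 z2 w1 w2 where "P = (pt z1 z2, pt w1 w2)" "g z1 z2 w1 w2 \<noteq> 0"
  using assms by (auto simp: nonvanishing_def)

lemma nvI: "g z1 z2 w1 w2 \<noteq> 0 \<Longrightarrow> (pt z1 z2, pt w1 w2) \<in> nv"
  by (auto simp: nonvanishing_def)

lemma g_bihomogeneous: "bihomogeneous 1 g"
  unfolding g by (rule bihomogeneous_bilinear)

lemma mon_pt:
  assumes "g z1 z2 w1 w2 \<noteq> 0" "i \<le> k" "j \<le> k"
  shows "mon k i j (pt z1 z2, pt w1 w2) = monomial_form k i j z1 z2 w1 w2 / g z1 z2 w1 w2 ^ k"
  unfolding mon_def by (rule ratio_pt[OF bihomogeneous_monomial[OF assms(2,3)] g_bihomogeneous assms(1)])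

lemma mon_one:
  assumes "P \<in> nv"
  shows "B\<^sup>2 * \<delta> * mon 1 1 1 P + B * \<delta> * mon 1 1 0 P + \<gamma> * mon 1 0 1 P + \<delta> * mon 1 0 0 P = 1"
proof -
  obtain z1 z2 w1 w2 where P: "P = (pt z1 z2, pt w1 w2)" "g z1 z2 w1 w2 \<noteq> 0"
    using assms by (rule nv_cases)
  have "B\<^sup>2 * \<delta> * mon 1 1 1 P + B * \<delta> * mon 1 1 0 P + \<gamma> * mon 1 0 1 P + \<delta> * mon 1 0 0 P =
      (B\<^sup>2 * \<delta> * (z1 * w1) + B * \<delta> * (z1 * w2) + \<gamma> * (z2 * w1) + \<delta> * (z2 * w2)) / g z1 z2 w1 w2"
    unfolding P(1) mon_pt[OF P(2) order.refl order.refl] mon_pt[OF P(2) order.refl zero_le]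
      mon_pt[OF P(2) zero_le order.refl] mon_pt[OF P(2) zero_le zero_le]
    by (simp add: monomial_form_def add_divide_distrib)
  moreover have "B\<^sup>2 * \<delta> * (z1 * w1) + B * \<delta> * (z1 * w2) + \<gamma> * (z2 * w1) + \<delta> * (z2 * w2) = g z1 z2 w1 w2"
    by (simp add: g bilinear_form_def)
  ultimately show ?thesis using P(2) by simp
qed

lemma mon_segre:
  assumes "P \<in> nv"
  shows "mon 1 1 1 P * mon 1 0 0 P = mon 1 1 0 P * mon 1 0 1 P"
proof -
  obtain z1 z2 w1 w2 where P: "P = (pt z1 z2, pt w1 w2)" "g z1 z2 w1 w2 \<noteq> 0"
    using assms by (rule nv_cases)
  show ?thesis
    unfolding P(1) mon_pt[OF P(2) order.refl order.refl] mon_pt[OF P(2) order.refl zero_le]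
      mon_pt[OF P(2) zero_le order.refl] mon_pt[OF P(2) zero_le zero_le]
    by (simp add: monomial_form_def)
qed

lemma mon_mult:
  assumes "P \<in> nv" "i \<le> k" "j \<le> k" "a \<le> 1" "b \<le> 1"
  shows "mon k i j P * mon 1 a b P = mon (Suc k) (i + a) (j + b) P"
proof -
  obtain z1 z2 w1 w2 where P: "P = (pt z1 z2, pt w1 w2)" "g z1 z2 w1 w2 \<noteq> 0"
    using assms(1) by (rule nv_cases)
  have "z2 ^ (k - i) * z2 ^ (1 - a) = z2 ^ (Suc k - (i + a))" "w2 ^ (k - j) * w2 ^ (1 - b) = w2 ^ (Suc k - (j + b))"
    using assms by (simp_all flip: power_add)
  then have "monomial_form k i j z1 z2 w1 w2 * monomial_form 1 a b z1 z2 w1 w2 =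
      monomial_form (Suc k) (i + a) (j + b) z1 z2 w1 w2"
    by (simp add: monomial_form_def power_add) (metis mult.assoc mult.left_commute)
  then show ?thesis
    using assms P by (simp add: mon_pt)
qed

lemma mon_coords:
  assumes "P \<in> nv"
  shows "mon 1 1 1 P = w P" "mon 1 1 0 P = (u P - 2 * B\<^sup>2 * w P) / B" "mon 1 0 1 P = v P"
    "mon 1 0 0 P = 1 / \<delta> - \<gamma> / \<delta> * v P - u P + B\<^sup>2 * w P"
proof -
  show 1: "mon 1 1 1 P = w P" and 2: "mon 1 0 1 P = v P" by (simp_all add: w_def v_def)
  show 3: "mon 1 1 0 P = (u P - 2 * B\<^sup>2 * w P) / B" using B by (simp add: u_def w_def)
  have 4: "B * \<delta> * mon 1 1 0 P = \<delta> * (u P - 2 * B\<^sup>2 * w P)"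
    unfolding 3 using B by simp
  have "\<delta> * mon 1 0 0 P = 1 - B\<^sup>2 * \<delta> * w P - \<delta> * (u P - 2 * B\<^sup>2 * w P) - \<gamma> * v P"
    using mon_one[OF assms] unfolding 1 2 4 by (simp add: algebra_simps)
  then show "mon 1 0 0 P = 1 / \<delta> - \<gamma> / \<delta> * v P - u P + B\<^sup>2 * w P"
    using \<delta> by (simp add: field_simps)
qed

text \<open>The Segre relation between the four products \<open>z\<^sub>i w\<^sub>j\<close>, written in the coordinates. It is monic in
\<open>w\<close>, so \<open>1\<close> and \<open>w\<close> generate the coordinate ring over the polynomials in \<open>u, v\<close>.\<close>

lemma w_quadratic:
  assumes "P \<in> nv"
  shows "w P * w P = u P * v P / B ^ 3 + w P * ((u P - 1 / \<delta> + (\<gamma> / \<delta> - 2 * B) * v P) / B\<^sup>2)"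
proof -
  have "w P * (1 / \<delta> - \<gamma> / \<delta> * v P - u P + B\<^sup>2 * w P) * B = (u P - 2 * B\<^sup>2 * w P) * v P"
    using mon_segre[OF assms] B unfolding mon_coords[OF assms] by simp
  then have "B ^ 3 * (w P * w P) = u P * v P + w P * (u P - 1 / \<delta> + (\<gamma> / \<delta> - 2 * B) * v P) * B"
    by (simp add: algebra_simps power2_eq_square power3_eq_cube)
  then have "w P * w P = (u P * v P + w P * (u P - 1 / \<delta> + (\<gamma> / \<delta> - 2 * B) * v P) * B) / B ^ 3"
    using B by (simp add: field_simps)
  moreover have "(a + w P * b * B) / B ^ 3 = a / B ^ 3 + w P * (b / B\<^sup>2)" for a b
    using B by (simp add: add_divide_distrib power2_eq_square power3_eq_cube)
  ultimately show ?thesis by simp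
qed

section \<open>The exponential as a common eigenfunction\<close>

definition exp_fun :: "cp1 \<times> cp1 \<Rightarrow> fun2" where
  "exp_fun P = (\<lambda>(x, y). exp (x * (k1 + c1 * \<delta> * u P + e1 * v P) + y * (k2 + c2 * \<delta> * u P + e2 * v P)))"

definition exp_germ :: "cp1 \<times> cp1 \<Rightarrow> fun2 set" where "exp_germ P = germ p (exp_fun P)"

lemma analytic_exp_fun [simp]: "analytic_near p (exp_fun P)"
  unfolding exp_fun_def by (rule analytic_near_exp_linear)

lemma exp_fun_nonzero: "exp_fun P q \<noteq> 0"
  by (simp add: exp_fun_def case_prod_unfold)

lemma exp_germ_carrier [simp]: "exp_germ P \<in> carrier \<O>"
  unfolding exp_germ_def by (rule germ_carrier) simp

lemma exponents_pt:
  assumes "g z1 z2 w1 w2 \<noteq> 0" and P: "P = (pt z1 z2, pt w1 w2)"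
  shows "g1 z1 z2 w1 w2 / g z1 z2 w1 w2 = k1 + c1 * \<delta> * u P + e1 * v P"
    "g2 z1 z2 w1 w2 / g z1 z2 w1 w2 = k2 + c2 * \<delta> * u P + e2 * v P"
proof -
  have "u P = (2 * B\<^sup>2 * z1 * w1 + B * z1 * w2) / g z1 z2 w1 w2" "v P = z2 * w1 / g z1 z2 w1 w2"
    using assms(1) by (simp_all add: P u_def v_def mon_pt monomial_form_def add_divide_distrib mult_ac)
  moreover have "g1 z1 z2 w1 w2 = k1 * g z1 z2 w1 w2 + c1 * \<delta> * (2 * B\<^sup>2 * z1 * w1 + B * z1 * w2) + e1 * (z2 * w1)"
    "g2 z1 z2 w1 w2 = k2 * g z1 z2 w1 w2 + c2 * \<delta> * (2 * B\<^sup>2 * z1 * w1 + B * z1 * w2) + e2 * (z2 * w1)"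
    by (simp_all add: g g1 g2 bilinear_form_def algebra_simps)
  ultimately show "g1 z1 z2 w1 w2 / g z1 z2 w1 w2 = k1 + c1 * \<delta> * u P + e1 * v P"
    "g2 z1 z2 w1 w2 / g z1 z2 w1 w2 = k2 + c2 * \<delta> * u P + e2 * v P"
    using assms(1) by (simp_all add: field_simps)
qed

definition slope_det :: complex where "slope_det = c1 * e2 - c2 * e1"

lemma slope_det_nonzero: "slope_det \<noteq> 0" using indep by (simp add: slope_det_def)

text \<open>The coefficients of \<open>X\<close> and \<open>Y\<close> solve the linear systems that isolate \<open>u\<close>, respectively \<open>v\<close>, from the two
exponents.\<close>

definition X where
  "X = dop (- (e2 * k1 - e1 * k2) / (\<delta> * slope_det)) (e2 / (\<delta> * slope_det)) (- e1 / (\<delta> * slope_det))"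

definition Y where
  "Y = dop (- (c1 * k2 - c2 * k1) / slope_det) (- c2 / slope_det) (c1 / slope_det)"

lemma X_\<D> [simp]: "X \<in> \<D>" and Y_\<D> [simp]: "Y \<in> \<D>"
  by (simp_all add: X_def Y_def)

lemma dop_exp_germ:
  assumes "a + b * (k1 + c1 * \<delta> * u P + e1 * v P) + c * (k2 + c2 * \<delta> * u P + e2 * v P) = s"
  shows "dop a b c (exp_germ P) = scale s (exp_germ P)"
proof -
  have "const_op a b c (exp_fun P) = (\<lambda>q. s * exp_fun P q)"
    using assms by (auto simp: exp_fun_def const_op_exp fun_eq_iff)
  then show ?thesis by (simp add: exp_germ_def dop_germ scale_germ)
qed

lemma X_exp_germ: "X (exp_germ P) = scale (u P) (exp_germ P)"
proof -
  have "slope_det \<noteq> 0" by (rule slope_det_nonzero)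
  then show ?thesis
    unfolding X_def using \<delta>
    by (intro dop_exp_germ) (simp add: divide_simps, simp add: slope_det_def algebra_simps)
qed

lemma Y_exp_germ: "Y (exp_germ P) = scale (v P) (exp_germ P)"
proof -
  have "slope_det \<noteq> 0" by (rule slope_det_nonzero)
  then show ?thesis
    unfolding Y_def using \<delta>
    by (intro dop_exp_germ) (simp add: divide_simps, simp add: slope_det_def algebra_simps)
qed

lemma mulop_exp_germ: "mulop f (exp_germ P) = germ p (\<lambda>q. f q * exp_fun P q)"
  by (simp add: exp_germ_def mulop_germ)

lemma mulop_const_exp_germ: "mulop (\<lambda>_. c) (exp_germ P) = scale c (exp_germ P)"
  by (simp add: exp_germ_def mulop_germ scale_germ)

section \<open>Numerators as pairs of operators\<close>

text \<open>The functions of \<open>P\<close> by which operators act on the exponential. They contain the polynomials in \<open>u, v\<close> and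
form a ring, composition of operators becoming multiplication.\<close>

definition symbol :: "(cp1 \<times> cp1 \<Rightarrow> complex) \<Rightarrow> bool" where
  "symbol f \<longleftrightarrow> (\<exists>T\<in>\<D>. \<forall>P. T (exp_germ P) = scale (f P) (exp_germ P))"

lemma symbol_const: "symbol (\<lambda>_. c)"
  unfolding symbol_def by (rule bexI[of _ "mulop (\<lambda>_. c)"]) (simp_all add: mulop_const_exp_germ)

lemma symbol_u: "symbol u" and symbol_v: "symbol v"
  unfolding symbol_def using X_exp_germ Y_exp_germ X_\<D> Y_\<D> by blast+

lemma symbol_add: "symbol f \<Longrightarrow> symbol h \<Longrightarrow> symbol (\<lambda>P. f P + h P)"
  unfolding symbol_def
proof (elim bexE)
  fix S T assume "S \<in> \<D>" "T \<in> \<D>" "\<forall>P. S (exp_germ P) = scale (f P) (exp_germ P)" "\<forall>P. T (exp_germ P) = scale (h P) (exp_germ P)"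
  then show "\<exists>T\<in>\<D>. \<forall>P. T (exp_germ P) = scale (f P + h P) (exp_germ P)"
    by (intro bexI[of _ "S \<oplus>\<^bsub>\<E>\<^esub> T"]) (simp_all add: \<D>_apply scale_simps)
qed

lemma symbol_mult: "symbol f \<Longrightarrow> symbol h \<Longrightarrow> symbol (\<lambda>P. f P * h P)"
  unfolding symbol_def
proof (elim bexE)
  fix S T assume "S \<in> \<D>" "T \<in> \<D>" "\<forall>P. S (exp_germ P) = scale (f P) (exp_germ P)" "\<forall>P. T (exp_germ P) = scale (h P) (exp_germ P)"
  then show "\<exists>T\<in>\<D>. \<forall>P. T (exp_germ P) = scale (f P * h P) (exp_germ P)"
    by (intro bexI[of _ "S \<otimes>\<^bsub>\<E>\<^esub> T"]) (simp_all add: \<D>_apply \<D>_scale scale_simps mult.commute)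
qed

definition two_sheeted :: "(cp1 \<times> cp1 \<Rightarrow> complex) \<Rightarrow> bool" where
  "two_sheeted f \<longleftrightarrow> (\<exists>a b. symbol a \<and> symbol b \<and> (\<forall>P\<in>nv. f P = a P + w P * b P))"

lemma two_sheeted_symbol: "symbol f \<Longrightarrow> two_sheeted f"
  unfolding two_sheeted_def using symbol_const[of 0] by (intro exI[of _ f] exI[of _ "\<lambda>_. 0"]) simp

lemma two_sheeted_cong: "two_sheeted f \<Longrightarrow> (\<And>P. P \<in> nv \<Longrightarrow> f P = h P) \<Longrightarrow> two_sheeted h"
  unfolding two_sheeted_def by metis

lemma two_sheeted_add:
  assumes "two_sheeted f" "two_sheeted h" shows "two_sheeted (\<lambda>P. f P + h P)"
proof -
  obtain a b a' b' where "symbol a" "symbol b" "symbol a'" "symbol b'"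
    "\<And>P. P \<in> nv \<Longrightarrow> f P = a P + w P * b P" "\<And>P. P \<in> nv \<Longrightarrow> h P = a' P + w P * b' P"
    using assms by (auto simp: two_sheeted_def)
  then show ?thesis
    unfolding two_sheeted_def
    by (intro exI[of _ "\<lambda>P. a P + a' P"] exI[of _ "\<lambda>P. b P + b' P"] conjI symbol_add)
       (auto simp: algebra_simps)
qed

lemma two_sheeted_mult_symbol:
  assumes "two_sheeted f" "symbol h" shows "two_sheeted (\<lambda>P. f P * h P)"
proof -
  obtain a b where "symbol a" "symbol b" "\<And>P. P \<in> nv \<Longrightarrow> f P = a P + w P * b P"
    using assms by (auto simp: two_sheeted_def)
  then show ?thesis
    unfolding two_sheeted_def using assms(2)
    by (intro exI[of _ "\<lambda>P. a P * h P"] exI[of _ "\<lambda>P. b P * h P"] conjI symbol_mult)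
       (auto simp: algebra_simps)
qed

text \<open>The square of \<open>w\<close> is eliminated by the quadratic relation.\<close>

lemma two_sheeted_mult_w:
  assumes "two_sheeted f" shows "two_sheeted (\<lambda>P. f P * w P)"
proof -
  obtain a b where ab: "symbol a" "symbol b" "\<And>P. P \<in> nv \<Longrightarrow> f P = a P + w P * b P"
    using assms by (auto simp: two_sheeted_def)
  define l where "l P = (u P + - 1 / \<delta> + (\<gamma> / \<delta> - 2 * B) * v P) * (1 / B\<^sup>2)" for P
  define n where "n P = u P * v P * (1 / B ^ 3)" for P
  have sym: "symbol l" "symbol n"
    unfolding l_def[abs_def] n_def[abs_def]
    by (intro symbol_add symbol_mult symbol_const symbol_u symbol_v)+
  have "f P * w P = b P * n P + w P * (a P + b P * l P)" if "P \<in> nv" for P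
  proof -
    have "w P * w P = n P + w P * l P"
      using w_quadratic[OF that] by (simp add: l_def n_def)
    then show ?thesis
      using ab(3)[OF that] by (simp add: algebra_simps)
  qed
  then show ?thesis
    unfolding two_sheeted_def using ab sym
    by (intro exI[of _ "\<lambda>P. b P * n P"] exI[of _ "\<lambda>P. a P + b P * l P"] conjI symbol_add symbol_mult) auto
qed

lemma two_sheeted_mult_mon:
  assumes f: "two_sheeted f" and "i \<le> 1" "j \<le> 1" shows "two_sheeted (\<lambda>P. f P * mon 1 i j P)"
proof -
  have lin: "two_sheeted (\<lambda>P. f P * (a + b * v P + c * u P) + (f P * w P) * d)" for a b c d
    by (intro two_sheeted_add two_sheeted_mult_symbol two_sheeted_mult_w f symbol_add symbol_mult
        symbol_const symbol_u symbol_v)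
  consider "i = 1" "j = 1" | "i = 1" "j = 0" | "i = 0" "j = 1" | "i = 0" "j = 0"
    using assms(2,3) by linarith
  then show ?thesis
  proof cases
    case 1
    show ?thesis
    proof (rule two_sheeted_cong[OF lin[of 0 0 0 1]])
      fix P assume P: "P \<in> nv"
      show "f P * (0 + 0 * v P + 0 * u P) + (f P * w P) * 1 = f P * mon 1 i j P"
        unfolding 1 mon_coords(1)[OF P] using B \<delta> by (simp add: field_simps)
    qed
  next
    case 2
    show ?thesis
    proof (rule two_sheeted_cong[OF lin[of 0 0 "1 / B" "- (2 * B\<^sup>2) / B"]])
      fix P assume P: "P \<in> nv"
      show "f P * (0 + 0 * v P + (1 / B) * u P) + (f P * w P) * (- (2 * B\<^sup>2) / B) = f P * mon 1 i j P"
        unfolding 2 mon_coords(2)[OF P] using B \<delta> by (simp add: field_simps)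
    qed
  next
    case 3
    show ?thesis
    proof (rule two_sheeted_cong[OF lin[of 0 1 0 0]])
      fix P assume P: "P \<in> nv"
      show "f P * (0 + 1 * v P + 0 * u P) + (f P * w P) * 0 = f P * mon 1 i j P"
        unfolding 3 mon_coords(3)[OF P] using B \<delta> by (simp add: field_simps)
    qed
  next
    case 4
    show ?thesis
    proof (rule two_sheeted_cong[OF lin[of "1 / \<delta>" "- \<gamma> / \<delta>" "- 1" "B\<^sup>2"]])
      fix P assume P: "P \<in> nv"
      show "f P * (1 / \<delta> + (- \<gamma> / \<delta>) * v P + (- 1) * u P) + (f P * w P) * B\<^sup>2 = f P * mon 1 i j P"
        unfolding 4 mon_coords(4)[OF P] using B \<delta> by (simp add: field_simps)
    qed
  qed
qed

text \<open>A monomial of bidegree \<open>(k,k)\<close> is a product of \<open>k\<close> bilinear monomials, which are linear in the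
coordinates.\<close>

lemma two_sheeted_mon: "i \<le> k \<Longrightarrow> j \<le> k \<Longrightarrow> two_sheeted (mon k i j)"
proof (induction k arbitrary: i j)
  case 0
  have "mon 0 0 0 P = 1" if "P \<in> nv" for P
    using that by (auto elim!: nv_cases simp: mon_pt monomial_form_def)
  then show ?case
    using 0 two_sheeted_cong[OF two_sheeted_symbol[OF symbol_const[of 1]], of "mon 0 0 0"] by simp
next
  case (Suc k)
  \<comment> \<open>Split off one bilinear monomial, with as many of \<open>z\<^sub>1\<close>, \<open>w\<^sub>1\<close> as are available.\<close>
  define a b where "a = (if i = 0 then 0 else 1::nat)" and "b = (if j = 0 then 0 else 1::nat)"
  have ab: "a \<le> 1" "b \<le> 1" "i - a \<le> k" "j - b \<le> k" "i - a + a = i" "j - b + b = j"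
    using Suc.prems by (auto simp: a_def b_def)
  show ?case
  proof (rule two_sheeted_cong[OF two_sheeted_mult_mon[OF Suc.IH[OF ab(3,4)] ab(1,2)]])
    fix P assume "P \<in> nv"
    from mon_mult[OF this ab(3,4,1,2)] show "mon k (i - a) (j - b) P * mon 1 a b P = mon (Suc k) i j P"
      by (simp add: ab)
  qed
qed

text \<open>The form \<open>T exp + w S exp\<close>. It is preserved by differential operators, since these commute with the number
\<open>w P\<close>.\<close>

definition op_family :: "(cp1 \<times> cp1 \<Rightarrow> fun2 set) \<Rightarrow> bool" where
  "op_family \<phi> \<longleftrightarrow> (\<exists>T\<in>\<D>. \<exists>S\<in>\<D>. \<forall>P\<in>nv. \<phi> P = T (exp_germ P) \<oplus>\<^bsub>\<O>\<^esub> scale (w P) (S (exp_germ P)))"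

lemma op_family_cong: "op_family \<phi> \<Longrightarrow> (\<And>P. P \<in> nv \<Longrightarrow> \<phi> P = \<psi> P) \<Longrightarrow> op_family \<psi>"
  unfolding op_family_def by metis

lemma op_family_zero: "op_family (\<lambda>_. \<zero>\<^bsub>\<O>\<^esub>)"
  unfolding op_family_def
  by (intro bexI[of _ "\<zero>\<^bsub>\<E>\<^esub>"] ballI) (simp_all add: R.additive_endomorphisms_apply)

lemma op_family_add:
  assumes "op_family \<phi>" "op_family \<psi>" shows "op_family (\<lambda>P. \<phi> P \<oplus>\<^bsub>\<O>\<^esub> \<psi> P)"
proof -
  obtain T S T' S' where "T \<in> \<D>" "S \<in> \<D>" "T' \<in> \<D>" "S' \<in> \<D>"
    "\<forall>P\<in>nv. \<phi> P = T (exp_germ P) \<oplus>\<^bsub>\<O>\<^esub> scale (w P) (S (exp_germ P))"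
    "\<forall>P\<in>nv. \<psi> P = T' (exp_germ P) \<oplus>\<^bsub>\<O>\<^esub> scale (w P) (S' (exp_germ P))"
    using assms by (auto simp: op_family_def)
  then show ?thesis
    unfolding op_family_def
    by - (rule bexI[of _ "T \<oplus>\<^bsub>\<E>\<^esub> T'"], rule bexI[of _ "S \<oplus>\<^bsub>\<E>\<^esub> S'"],
        simp_all add: \<D>_apply scale_simps R.a_ac)
qed

lemma op_family_apply:
  assumes "Q \<in> \<D>" "op_family \<phi>" shows "op_family (\<lambda>P. Q (\<phi> P))"
proof -
  obtain T S where "T \<in> \<D>" "S \<in> \<D>"
    "\<forall>P\<in>nv. \<phi> P = T (exp_germ P) \<oplus>\<^bsub>\<O>\<^esub> scale (w P) (S (exp_germ P))"
    using assms by (auto simp: op_family_def)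
  then show ?thesis
    unfolding op_family_def using assms(1)
    by - (rule bexI[of _ "Q \<otimes>\<^bsub>\<E>\<^esub> T"], rule bexI[of _ "Q \<otimes>\<^bsub>\<E>\<^esub> S"],
        simp_all add: \<D>_apply \<D>_scale)
qed

lemma op_family_sum:
  assumes "finite A" "\<And>x. x \<in> A \<Longrightarrow> op_family (\<lambda>P. germ p (\<lambda>q. F x P q))"
  shows "op_family (\<lambda>P. germ p (\<lambda>q. \<Sum>x\<in>A. F x P q))"
  using assms
proof (induction A rule: finite_induct)
  case empty
  then show ?case using op_family_zero by (simp add: germ_zero)
next
  case (insert x A)
  have "op_family (\<lambda>P. germ p (\<lambda>q. F x P q) \<oplus>\<^bsub>\<O>\<^esub> germ p (\<lambda>q. \<Sum>x\<in>A. F x P q))"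
    by (intro op_family_add insert) (use insert in auto)
  then show ?case using insert by (simp add: germ_add)
qed

lemma op_family_term:
  assumes "two_sheeted f" "analytic_near p h"
  shows "op_family (\<lambda>P. germ p (\<lambda>q. h q * f P * exp_fun P q))"
proof -
  obtain a b where ab: "symbol a" "symbol b" "\<forall>P\<in>nv. f P = a P + w P * b P"
    using assms(1) by (auto simp: two_sheeted_def)
  then obtain T S where TS: "T \<in> \<D>" "\<And>P. T (exp_germ P) = scale (a P) (exp_germ P)"
      "S \<in> \<D>" "\<And>P. S (exp_germ P) = scale (b P) (exp_germ P)"
    unfolding symbol_def by blast
  then have "op_family (\<lambda>P. scale (f P) (exp_germ P))"
    unfolding op_family_def using ab(3)
    by - (rule bexI[of _ T], rule bexI[of _ S], simp_all add: scale_simps)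
  from op_family_apply[OF _ this, of "mulop h"] assms(2)
  have "op_family (\<lambda>P. mulop h (scale (f P) (exp_germ P)))" by simp
  then show ?thesis
    by (rule op_family_cong)
       (simp add: exp_germ_def scale_germ mulop_germ analytic_near_mult mult.assoc)
qed

definition form_family :: "nat \<Rightarrow> (cp1 \<times> cp1 \<Rightarrow> fun2 set) \<Rightarrow> bool" where
  "form_family k \<phi> \<longleftrightarrow> (\<exists>h. (\<forall>i\<le>k. \<forall>j\<le>k. analytic_near p (h i j)) \<and>
     (\<forall>P\<in>nv. \<phi> P = germ p (\<lambda>q. (\<Sum>i\<le>k. \<Sum>j\<le>k. h i j q * mon k i j P) * exp_fun P q)))"

lemma form_family_imp_op_family:
  assumes "form_family k \<phi>" shows "op_family \<phi>"
proof -
  obtain h where h: "\<And>i j. i \<le> k \<Longrightarrow> j \<le> k \<Longrightarrow> analytic_near p (h i j)"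
    "\<And>P. P \<in> nv \<Longrightarrow> \<phi> P = germ p (\<lambda>q. (\<Sum>i\<le>k. \<Sum>j\<le>k. h i j q * mon k i j P) * exp_fun P q)"
    using assms unfolding form_family_def by blast
  have "op_family (\<lambda>P. germ p (\<lambda>q. \<Sum>i\<le>k. \<Sum>j\<le>k. h i j q * mon k i j P * exp_fun P q))"
    by (intro op_family_sum op_family_term two_sheeted_mon h) auto
  then show ?thesis
    by (rule op_family_cong) (simp add: h(2) sum_distrib_right)
qed

definition gluing :: "(cp1 \<times> cp1 \<Rightarrow> fun2 set) \<Rightarrow> bool" where
  "gluing \<phi> \<longleftrightarrow> (\<forall>t. (pt 1 0, t) \<in> nv \<and> (t, pt 0 1) \<in> nv \<longrightarrow> \<phi> (pt 1 0, t) = scale \<Lambda> (\<phi> (t, pt 0 1)))"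

lemma BA_space_iff:
  "\<phi> \<in> BA_space g g1 g2 \<Lambda> p k \<longleftrightarrow> \<phi> \<in> nv \<rightarrow>\<^sub>E carrier \<O> \<and> form_family k \<phi> \<and> gluing \<phi>"
proof -
  have eq: "(\<lambda>(x, y). bihom_form k (\<lambda>i j. h i j (x, y)) z1 z2 w1 w2 / g z1 z2 w1 w2 ^ k *
        exp (x * (g1 z1 z2 w1 w2 / g z1 z2 w1 w2) + y * (g2 z1 z2 w1 w2 / g z1 z2 w1 w2))) =
      (\<lambda>q. (\<Sum>i\<le>k. \<Sum>j\<le>k. h i j q * mon k i j P) * exp_fun P q)"
    if P: "P = (pt z1 z2, pt w1 w2)" and nz: "g z1 z2 w1 w2 \<noteq> 0" for h z1 z2 w1 w2 P
  proof (rule ext)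
    fix q :: "complex \<times> complex"
    have "(\<Sum>i\<le>k. \<Sum>j\<le>k. h i j q * mon k i j P) = bihom_form k (\<lambda>i j. h i j q) z1 z2 w1 w2 / g z1 z2 w1 w2 ^ k"
      unfolding bihom_form_def sum_divide_distrib
      by (intro sum.cong refl) (simp add: P mon_pt[OF nz] monomial_form_def)
    then show "(case q of (x, y) \<Rightarrow> bihom_form k (\<lambda>i j. h i j (x, y)) z1 z2 w1 w2 / g z1 z2 w1 w2 ^ k *
        exp (x * (g1 z1 z2 w1 w2 / g z1 z2 w1 w2) + y * (g2 z1 z2 w1 w2 / g z1 z2 w1 w2))) =
      (\<Sum>i\<le>k. \<Sum>j\<le>k. h i j q * mon k i j P) * exp_fun P q"
      by (simp add: exp_fun_def case_prod_unfold exponents_pt[OF nz P])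
  qed
  have "(\<forall>z1 z2 w1 w2. g z1 z2 w1 w2 \<noteq> 0 \<longrightarrow>
              \<phi> (pt z1 z2, pt w1 w2) =
                germ p (\<lambda>(x, y).
                  bihom_form k (\<lambda>i j. h i j (x, y)) z1 z2 w1 w2 / g z1 z2 w1 w2 ^ k *
                  exp (x * (g1 z1 z2 w1 w2 / g z1 z2 w1 w2) +
                       y * (g2 z1 z2 w1 w2 / g z1 z2 w1 w2)))) \<longleftrightarrow>
     (\<forall>P\<in>nv. \<phi> P = germ p (\<lambda>q. (\<Sum>i\<le>k. \<Sum>j\<le>k. h i j q * mon k i j P) * exp_fun P q))" for h
    using eq[OF refl] by (auto elim!: nv_cases simp: nvI)
  then show ?thesis
    unfolding BA_space_def form_family_def gluing_def scale_def by simp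
qed

end



section \<open>Polynomials with many zeros\<close>

lemma horner_sum_eq_poly: "horner_sum h x fs = poly (Poly (map h fs)) (x::complex)"
  by (induction fs) simp_all

lemma degree_Poly_less:
  assumes "fs \<noteq> []" shows "degree (Poly fs) < length fs"
proof -
  have "degree (Poly fs) \<le> length fs - 1"
    by (rule degree_le) (auto simp: coeff_Poly_eq nth_default_def)
  moreover have "length fs > 0" using assms by simp
  ultimately show ?thesis by linarith
qed

lemma horner_sum_vanishes:
  fixes h :: "'b \<Rightarrow> complex"
  assumes "finite S" "length fs \<le> card S" "\<And>x. x \<in> S \<Longrightarrow> horner_sum h x fs = 0" "f \<in> set fs"
  shows "h f = 0"
proof -
  have "Poly (map h fs) = 0"
  proof (rule ccontr)
    assume nz: "Poly (map h fs) \<noteq> 0"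
    have "card S \<le> card {x. poly (Poly (map h fs)) x = 0}"
      using assms(3) poly_roots_finite[OF nz] by (intro card_mono) (auto simp: horner_sum_eq_poly)
    also have "\<dots> \<le> degree (Poly (map h fs))"
      by (rule card_poly_roots_bound[OF nz])
    also have "\<dots> < length fs"
    proof -
      have "map h fs \<noteq> []" using nz by auto
      then show ?thesis using degree_Poly_less[of "map h fs"] by simp
    qed
    finally show False using assms(2) by simp
  qed
  then have "\<forall>c\<in>set (map h fs). c = 0"
    by (metis Poly_eq_0 in_set_replicate)
  then show ?thesis using assms(4) by simp
qed

text \<open>A shift of the argument does not change the leading coefficient, so the identity would give \<open>\<kappa> = l\<close> if the
polynomial were not zero. It suffices to have it at as many points as there are coefficients.\<close>

lemma shifted_polynomial_vanishes:
  fixes d \<kappa> l :: complex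
  assumes "\<kappa> \<noteq> l" "finite S" "length fs \<le> card S" "f \<in> set fs"
    "\<And>x. x \<in> S \<Longrightarrow> \<kappa> * horner_sum h (d + x) fs = l * horner_sum h x fs"
  shows "h f = 0"
proof -
  define A where "A = Poly (map h fs)"
  \<comment> \<open>The functional equation holds at more points than the degree, hence identically.\<close>
  define R where "R = Polynomial.smult \<kappa> (pcompose A [:d, 1:]) - Polynomial.smult l A"
  have degA: "degree A < length fs"
    using degree_Poly_less[of "map h fs"] assms(4) by (cases fs) (simp_all add: A_def)
  have degR: "degree R < length fs"
    unfolding R_def using degA
    by (intro degree_diff_less le_less_trans[OF degree_smult_le]) (simp_all add: degree_pcompose)
  have "R = 0"
  proof (rule ccontr)
    assume nz: "R \<noteq> 0"
    have "card S \<le> card {x. poly R x = 0}"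
      using assms(5) poly_roots_finite[OF nz]
      by (intro card_mono) (auto simp: horner_sum_eq_poly R_def A_def poly_pcompose)
    also have "\<dots> \<le> degree R"
      by (rule card_poly_roots_bound[OF nz])
    finally show False using assms(3) degR by simp
  qed
  then have "poly.coeff (Polynomial.smult \<kappa> (pcompose A [:d, 1:])) (degree A) =
      poly.coeff (Polynomial.smult l A) (degree A)"
    by (simp add: R_def)
  moreover have "poly.coeff (pcompose A [:d, 1:]) (degree A) = lead_coeff A"
    using lead_coeff_comp[of "[:d, 1:]" A] by (simp add: degree_pcompose)
  ultimately have "\<kappa> * lead_coeff A = l * lead_coeff A"
    by simp
  then have "A = 0" using assms(1) by simp
  then have "\<forall>c\<in>set (map h fs). c = 0"
    unfolding A_def by (metis Poly_eq_0 in_set_replicate)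
  then show ?thesis using assms(4) by simp
qed

context glued_surface
begin

section \<open>Pairs of operators as numerators\<close>

text \<open>The quotients \<open>h / g\<^sup>k\<close> with numerators of bidegree \<open>(k,k)\<close>. That they form an increasing union closed under
multiplication by \<open>u, v, w\<close> is what turns pairs of operators back into numerators.\<close>

definition regular :: "nat \<Rightarrow> (cp1 \<times> cp1 \<Rightarrow> fun2) \<Rightarrow> bool" where
  "regular k F \<longleftrightarrow> (\<exists>h. (\<forall>i\<le>k. \<forall>j\<le>k. analytic_near p (h i j)) \<and>
     (\<forall>P\<in>nv. \<forall>q. F P q = (\<Sum>i\<le>k. \<Sum>j\<le>k. h i j q * mon k i j P)))"

lemma analytic_near_sum:
  "(\<And>x. x \<in> A \<Longrightarrow> analytic_near p (f x)) \<Longrightarrow> analytic_near p (\<lambda>q. \<Sum>x\<in>A. f x q)"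
  by (induction A rule: infinite_finite_induct) (auto intro: analytic_near_add)

text \<open>Collecting equal monomials. This avoids explicit formulas for the coefficients of products.\<close>

lemma regular_span:
  assumes "finite A" "\<And>x. x \<in> A \<Longrightarrow> analytic_near p (h x) \<and> i x \<le> k \<and> j x \<le> k"
    "\<And>P q. P \<in> nv \<Longrightarrow> F P q = (\<Sum>x\<in>A. h x q * mon k (i x) (j x) P)"
  shows "regular k F"
proof -
  let ?h = "\<lambda>a b q. \<Sum>x\<in>{x\<in>A. (i x, j x) = (a, b)}. h x q"
  have "F P q = (\<Sum>a\<le>k. \<Sum>b\<le>k. ?h a b q * mon k a b P)" if "P \<in> nv" for P q
  proof -
    have "(\<Sum>a\<le>k. \<Sum>b\<le>k. ?h a b q * mon k a b P) =
        (\<Sum>ab\<in>{..k} \<times> {..k}. \<Sum>x\<in>{x\<in>A. (i x, j x) = ab}. h x q * mon k (i x) (j x) P)"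
      by (auto simp: sum.cartesian_product sum_distrib_right intro!: sum.cong)
    also have "\<dots> = (\<Sum>x\<in>A. h x q * mon k (i x) (j x) P)"
      by (rule sum.group) (use assms in auto)
    finally show ?thesis using assms(3)[OF that] by simp
  qed
  moreover have "analytic_near p (?h a b)" for a b
    by (rule analytic_near_sum) (use assms in auto)
  ultimately show ?thesis unfolding regular_def by (intro exI[of _ ?h]) auto
qed

lemma regular_cong: "regular k F \<Longrightarrow> (\<And>P q. P \<in> nv \<Longrightarrow> F P q = G P q) \<Longrightarrow> regular k G"
  unfolding regular_def by simp

lemma regular_add:
  assumes "regular k F" "regular k G" shows "regular k (\<lambda>P q. F P q + G P q)"
proof -
  obtain h h' where "\<forall>i\<le>k. \<forall>j\<le>k. analytic_near p (h i j)" "\<forall>i\<le>k. \<forall>j\<le>k. analytic_near p (h' i j)"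
    "\<forall>P\<in>nv. \<forall>q. F P q = (\<Sum>i\<le>k. \<Sum>j\<le>k. h i j q * mon k i j P)"
    "\<forall>P\<in>nv. \<forall>q. G P q = (\<Sum>i\<le>k. \<Sum>j\<le>k. h' i j q * mon k i j P)"
    using assms unfolding regular_def by blast
  then show ?thesis
    unfolding regular_def
    by (intro exI[of _ "\<lambda>i j q. h i j q + h' i j q"])
       (auto simp: sum.distrib distrib_right intro: analytic_near_add)
qed

lemma regular_mult_coefficient:
  assumes "regular k F" "analytic_near p f" shows "regular k (\<lambda>P q. f q * F P q)"
proof -
  obtain h where "\<forall>i\<le>k. \<forall>j\<le>k. analytic_near p (h i j)"
    "\<forall>P\<in>nv. \<forall>q. F P q = (\<Sum>i\<le>k. \<Sum>j\<le>k. h i j q * mon k i j P)"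
    using assms unfolding regular_def by blast
  then show ?thesis
    unfolding regular_def using assms(2)
    by (intro exI[of _ "\<lambda>i j q. f q * h i j q"])
       (auto simp: sum_distrib_left mult.assoc intro: analytic_near_mult)
qed

lemma regular_mult_mon:
  assumes "regular k F" "a \<le> 1" "b \<le> 1" shows "regular (Suc k) (\<lambda>P q. F P q * mon 1 a b P)"
proof -
  obtain h where h: "\<forall>i\<le>k. \<forall>j\<le>k. analytic_near p (h i j)"
    "\<forall>P\<in>nv. \<forall>q. F P q = (\<Sum>i\<le>k. \<Sum>j\<le>k. h i j q * mon k i j P)"
    using assms unfolding regular_def by blast
  show ?thesis
  proof (rule regular_span[where A = "{..k} \<times> {..k}" and h = "\<lambda>(i, j). h i j"
        and i = "\<lambda>x. fst x + a" and j = "\<lambda>x. snd x + b"])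
    fix P and q :: "complex \<times> complex"
    assume P: "P \<in> nv"
    then have "F P q = (\<Sum>i\<le>k. \<Sum>j\<le>k. h i j q * mon k i j P)"
      using h(2) by blast
    then have "F P q * mon 1 a b P = (\<Sum>(i, j)\<in>{..k} \<times> {..k}. h i j q * (mon k i j P * mon 1 a b P))"
      by (simp add: sum.cartesian_product sum_distrib_right case_prod_unfold mult.assoc)
    also have "\<dots> = (\<Sum>x\<in>{..k} \<times> {..k}. (\<lambda>(i, j). h i j) x q * mon (Suc k) (fst x + a) (snd x + b) P)"
      using mon_mult[OF P _ _ assms(2,3)] by (intro sum.cong) auto
    finally show "F P q * mon 1 a b P = \<dots>" .
  qed (use h assms in auto)
qed

lemma regular_mult_linear:
  assumes F: "regular k F"
  shows "regular (Suc k) (\<lambda>P q. F P q * (a * mon 1 1 1 P + b * mon 1 1 0 P + c * mon 1 0 1 P + d * mon 1 0 0 P))"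
proof -
  have "regular (Suc k) (\<lambda>P q. ((a * (F P q * mon 1 1 1 P) + b * (F P q * mon 1 1 0 P)) + c * (F P q * mon 1 0 1 P)) + d * (F P q * mon 1 0 0 P))"
    by (intro regular_add regular_mult_coefficient[where f = "\<lambda>_. _"] regular_mult_mon F) simp_all
  then show ?thesis by (rule regular_cong) (simp add: algebra_simps)
qed

text \<open>Numerator and denominator are multiplied by \<open>g\<close>.\<close>

lemma regular_Suc: "regular k F \<Longrightarrow> regular (Suc k) F"
  by (rule regular_cong[OF regular_mult_linear[of k F "B\<^sup>2 * \<delta>" "B * \<delta>" \<gamma> \<delta>]]) (use mon_one in auto)

lemma regular_mono: "regular k F \<Longrightarrow> k \<le> l \<Longrightarrow> regular l F"
  by (induction l) (auto simp: le_Suc_eq intro: regular_Suc)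

lemma regular_add':
  assumes "regular k F" "regular l G" shows "regular (max k l) (\<lambda>P q. F P q + G P q)"
  by (rule regular_add; rule regular_mono) (use assms in auto)

lemma regular_const: "analytic_near p f \<Longrightarrow> regular 0 (\<lambda>P. f)"
  unfolding regular_def
proof (rule exI[of _ "\<lambda>_ _. f"])
  assume "analytic_near p f"
  moreover have "mon 0 0 0 P = 1" if "P \<in> nv" for P
    using that by (auto elim!: nv_cases simp: mon_pt monomial_form_def)
  ultimately show "(\<forall>i\<le>0. \<forall>j\<le>0. analytic_near p f) \<and>
      (\<forall>P\<in>nv. \<forall>q. f q = (\<Sum>i\<le>0. \<Sum>j\<le>0. f q * mon 0 i j P))" by simp
qed

lemma regular_mult_u: "regular k F \<Longrightarrow> regular (Suc k) (\<lambda>P q. F P q * u P)"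
  by (rule regular_cong[OF regular_mult_linear[of k F "2 * B\<^sup>2" B 0 0]]) (auto simp: u_def)

lemma regular_mult_v: "regular k F \<Longrightarrow> regular (Suc k) (\<lambda>P q. F P q * v P)"
  by (rule regular_cong[OF regular_mult_linear[of k F 0 0 1 0]]) (auto simp: v_def)

lemma regular_mult_w: "regular k F \<Longrightarrow> regular (Suc k) (\<lambda>P q. F P q * w P)"
  by (rule regular_cong[OF regular_mult_linear[of k F 1 0 0 0]]) (auto simp: w_def)

text \<open>The normal form of an operator with its coefficients as explicit lists, in the order in which Horner's
scheme uses them. The coefficients are functions, not germs, so that they can be evaluated near the base
point.\<close>

definition x_operator :: "fun2 list \<Rightarrow> fun2 set \<Rightarrow> fun2 set" where
  "x_operator fs = foldr (\<lambda>f T. mulop f \<oplus>\<^bsub>\<E>\<^esub> T \<otimes>\<^bsub>\<E>\<^esub> X) fs \<zero>\<^bsub>\<E>\<^esub>"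

definition xy_operator :: "fun2 list list \<Rightarrow> fun2 set \<Rightarrow> fun2 set" where
  "xy_operator fss = foldr (\<lambda>fs T. x_operator fs \<oplus>\<^bsub>\<E>\<^esub> T \<otimes>\<^bsub>\<E>\<^esub> Y) fss \<zero>\<^bsub>\<E>\<^esub>"

definition analytic_list where "analytic_list fs \<longleftrightarrow> (\<forall>f\<in>set fs. analytic_near p f)"

lemma x_operator_simps [simp]: "x_operator [] = \<zero>\<^bsub>\<E>\<^esub>" "x_operator (f # fs) = mulop f \<oplus>\<^bsub>\<E>\<^esub> x_operator fs \<otimes>\<^bsub>\<E>\<^esub> X"
  by (simp_all add: x_operator_def)

lemma xy_operator_simps [simp]: "xy_operator [] = \<zero>\<^bsub>\<E>\<^esub>" "xy_operator (fs # fss) = x_operator fs \<oplus>\<^bsub>\<E>\<^esub> xy_operator fss \<otimes>\<^bsub>\<E>\<^esub> Y"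
  by (simp_all add: xy_operator_def)

lemma x_operator_\<D>: "analytic_list fs \<Longrightarrow> x_operator fs \<in> \<D>"
  by (induction fs) (auto simp: analytic_list_def)

lemma xy_operator_\<D>: "\<forall>fs\<in>set fss. analytic_list fs \<Longrightarrow> xy_operator fss \<in> \<D>"
  by (induction fss) (auto simp: x_operator_\<D>)

lemma \<D>_xy_operator:
  assumes "T \<in> \<D>"
  obtains fss where "\<forall>fs\<in>set fss. analytic_list fs" "T = xy_operator fss"
proof -
  have "T \<in> E.left_polynomials (E.left_polynomials (mulop ` {f. analytic_near p f}) X) Y"
    unfolding X_def Y_def
  proof (rule \<D>_normal_form[OF assms])
    have "e2 / (\<delta> * slope_det) * (c1 / slope_det) - - e1 / (\<delta> * slope_det) * (- c2 / slope_det) = 1 / (\<delta> * slope_det)"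
      using slope_det_nonzero \<delta> by (simp add: field_simps) (simp add: slope_det_def algebra_simps)
    then show "e2 / (\<delta> * slope_det) * (c1 / slope_det) - - e1 / (\<delta> * slope_det) * (- c2 / slope_det) \<noteq> 0"
      using slope_det_nonzero \<delta> by simp
  qed
  moreover have "\<exists>fs. analytic_list fs \<and> S = x_operator fs"
    if "S \<in> E.left_polynomials (mulop ` {f. analytic_near p f}) X" for S
    using that
  proof (induction rule: E.left_polynomials_induct)
    case zero
    then show ?case by (intro exI[of _ "[]"]) (simp add: analytic_list_def)
  next
    case (step k T)
    then obtain f fs where "analytic_near p f" "k = mulop f" "analytic_list fs" "T = x_operator fs" by auto
    then show ?case by (intro exI[of _ "f # fs"]) (simp add: analytic_list_def)
  qed
  ultimately have "\<exists>fss. (\<forall>fs\<in>set fss. analytic_list fs) \<and> T = xy_operator fss"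
  proof (induction rule: E.left_polynomials_induct)
    case zero
    then show ?case by (intro exI[of _ "[]"]) simp
  next
    case (step k T)
    then obtain fs fss where "analytic_list fs" "k = x_operator fs" "\<forall>fs\<in>set fss. analytic_list fs" "T = xy_operator fss" by metis
    then show ?case by (intro exI[of _ "fs # fss"]) simp
  qed
  then show ?thesis using that by blast
qed

text \<open>On the exponential, \<open>X\<close> acts as the number \<open>u P\<close>, so an operator in normal form acts as the polynomial with
its coefficients.\<close>

lemma x_operator_exp_germ:
  "analytic_list fs \<Longrightarrow> x_operator fs (exp_germ P) = germ p (\<lambda>q. horner_sum (\<lambda>f. f q) (u P) fs * exp_fun P q)"
proof (induction fs)
  case Nil
  then show ?case by (simp add: R.additive_endomorphisms_apply germ_zero)
next
  case (Cons f fs)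
  then have "analytic_list fs" "analytic_near p f" by (auto simp: analytic_list_def)
  then have "x_operator (f # fs) (exp_germ P) = mulop f (exp_germ P) \<oplus>\<^bsub>\<O>\<^esub> scale (u P) (x_operator fs (exp_germ P))"
    using x_operator_\<D> by (simp add: \<D>_apply \<D>_scale X_exp_germ)
  then show ?case
    using Cons \<open>analytic_list fs\<close> by (simp add: mulop_exp_germ scale_germ germ_add algebra_simps)
qed

lemma xy_operator_exp_germ:
  "\<forall>fs\<in>set fss. analytic_list fs \<Longrightarrow>
     xy_operator fss (exp_germ P) = germ p (\<lambda>q. horner_sum (\<lambda>fs. horner_sum (\<lambda>f. f q) (u P) fs) (v P) fss * exp_fun P q)"
proof (induction fss)
  case Nil
  then show ?case by (simp add: R.additive_endomorphisms_apply germ_zero)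
next
  case (Cons fs fss)
  then have "xy_operator (fs # fss) (exp_germ P) = x_operator fs (exp_germ P) \<oplus>\<^bsub>\<O>\<^esub> scale (v P) (xy_operator fss (exp_germ P))"
    using x_operator_\<D> xy_operator_\<D> by (simp add: \<D>_apply \<D>_scale Y_exp_germ)
  then show ?case
    using Cons by (simp add: x_operator_exp_germ scale_germ germ_add algebra_simps)
qed

lemma x_operator_zero: "\<forall>f\<in>set fs. germ p f = \<zero>\<^bsub>\<O>\<^esub> \<Longrightarrow> x_operator fs = \<zero>\<^bsub>\<E>\<^esub>"
proof (induction fs)
  case (Cons f fs)
  then have "mulop f = \<zero>\<^bsub>\<E>\<^esub>"
    using mulop_zero mulop_cong[of f "\<lambda>_. 0"] by (simp add: germ_zero)
  then show ?case using Cons by (simp add: X_def dop_carrier)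
qed simp

lemma xy_operator_zero: "\<forall>fs\<in>set fss. \<forall>f\<in>set fs. germ p f = \<zero>\<^bsub>\<O>\<^esub> \<Longrightarrow> xy_operator fss = \<zero>\<^bsub>\<E>\<^esub>"
  by (induction fss) (simp_all add: x_operator_zero Y_def dop_carrier)

lemma \<D>_regular:
  assumes "T \<in> \<D>"
  shows "\<exists>k F. regular k F \<and> (\<forall>P. T (exp_germ P) = germ p (\<lambda>q. F P q * exp_fun P q))"
proof -
  obtain fss where fss: "\<forall>fs\<in>set fss. analytic_list fs" "T = xy_operator fss"
    using \<D>_xy_operator[OF assms] .
  have "\<exists>k. regular k (\<lambda>P q. horner_sum (\<lambda>f. f q) (u P) fs)" if "analytic_list fs" for fs
    using that
  proof (induction fs)
    case Nil
    then show ?case using regular_const[of "\<lambda>_. 0"] by auto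
  next
    case (Cons f fs)
    then obtain k where "regular k (\<lambda>P q. horner_sum (\<lambda>f. f q) (u P) fs)" "analytic_near p f"
      by (auto simp: analytic_list_def)
    from regular_add'[OF regular_const[OF this(2)] regular_mult_u[OF this(1)]]
    show ?case by (auto simp: mult.commute)
  qed
  then have "\<exists>k. regular k (\<lambda>P q. horner_sum (\<lambda>fs. horner_sum (\<lambda>f. f q) (u P) fs) (v P) fss)"
    using fss(1)
  proof (induction fss)
    case Nil
    then show ?case using regular_const[of "\<lambda>_. 0"] by auto
  next
    case (Cons fs fss)
    from Cons obtain k where "regular k (\<lambda>P q. horner_sum (\<lambda>fs. horner_sum (\<lambda>f. f q) (u P) fs) (v P) fss)"
      by (meson list.set_intros(2))
    moreover from Cons.prems obtain l where "regular l (\<lambda>P q. horner_sum (\<lambda>f. f q) (u P) fs)"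
      by (meson list.set_intros(1))
    ultimately have rs: "regular k (\<lambda>P q. horner_sum (\<lambda>fs. horner_sum (\<lambda>f. f q) (u P) fs) (v P) fss)"
      "regular l (\<lambda>P q. horner_sum (\<lambda>f. f q) (u P) fs)" .
    from regular_add'[OF rs(2) regular_mult_v[OF rs(1)]]
    show ?case by (auto simp: mult.commute)
  qed
  then show ?thesis using xy_operator_exp_germ[OF fss(1)] fss(2) by blast
qed

lemma op_family_imp_form_family:
  assumes "op_family \<phi>" shows "\<exists>k\<ge>1. form_family k \<phi>"
proof -
  obtain T S where TS: "T \<in> \<D>" "S \<in> \<D>" "\<forall>P\<in>nv. \<phi> P = T (exp_germ P) \<oplus>\<^bsub>\<O>\<^esub> scale (w P) (S (exp_germ P))"
    using assms by (auto simp: op_family_def)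
  obtain k F l G where FG: "regular k F" "\<forall>P. T (exp_germ P) = germ p (\<lambda>q. F P q * exp_fun P q)"
      "regular l G" "\<forall>P. S (exp_germ P) = germ p (\<lambda>q. G P q * exp_fun P q)"
    using \<D>_regular[OF TS(1)] \<D>_regular[OF TS(2)] by blast
  define n where "n = max k (Suc l)"
  have "n \<ge> 1" and "regular n (\<lambda>P q. F P q + G P q * w P)"
    using regular_add'[OF FG(1) regular_mult_w[OF FG(3)]] by (simp_all add: n_def)
  then obtain h where h: "\<forall>i\<le>n. \<forall>j\<le>n. analytic_near p (h i j)"
      "\<forall>P\<in>nv. \<forall>q. F P q + G P q * w P = (\<Sum>i\<le>n. \<Sum>j\<le>n. h i j q * mon n i j P)"
    unfolding regular_def by blast
  have "\<phi> P = germ p (\<lambda>q. (\<Sum>i\<le>n. \<Sum>j\<le>n. h i j q * mon n i j P) * exp_fun P q)" if "P \<in> nv" for P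
  proof -
    have "\<phi> P = germ p (\<lambda>q. (F P q + G P q * w P) * exp_fun P q)"
      using TS(3) FG(2,4) that by (simp add: scale_germ germ_add algebra_simps)
    then show ?thesis using h(2) that by simp
  qed
  with h(1) have "form_family n \<phi>" unfolding form_family_def by blast
  with \<open>n \<ge> 1\<close> show ?thesis by blast
qed

text \<open>The union over all \<open>k\<close> becomes a condition that does not mention \<open>k\<close>.\<close>

lemma BA_module_carrier:
  "carrier (BA_module g g1 g2 \<Lambda> p) = {\<phi>. \<phi> \<in> nv \<rightarrow>\<^sub>E carrier \<O> \<and> op_family \<phi> \<and> gluing \<phi>}"
proof -
  have "\<phi> \<in> carrier (BA_module g g1 g2 \<Lambda> p) \<longleftrightarrow> (\<exists>k\<ge>1. \<phi> \<in> nv \<rightarrow>\<^sub>E carrier \<O> \<and> form_family k \<phi> \<and> gluing \<phi>)" for \<phi>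
    unfolding BA_module_def partial_object.select_convs BA_space_iff[symmetric] by auto
  moreover have "(\<exists>k\<ge>1. form_family k \<phi>) \<longleftrightarrow> op_family \<phi>" for \<phi>
    using form_family_imp_op_family op_family_imp_form_family by metis
  ultimately show ?thesis by (intro Set.set_eqI) (simp, metis)
qed

section \<open>Uniqueness of the pair of operators\<close>

text \<open>Every solution of the quadratic equation with \<open>u v \<noteq> 0\<close> is realised. The coordinates determine the four
products \<open>z\<^sub>i w\<^sub>j\<close> normalised by \<open>g = 1\<close>; the equation says that they form a matrix of rank one, whose
factors give the point.\<close>

lemma sheets:
  assumes "u0 \<noteq> 0" "v0 \<noteq> 0" and w0: "w0 * w0 = u0 * v0 / B ^ 3 + w0 * ((u0 - 1 / \<delta> + (\<gamma> / \<delta> - 2 * B) * v0) / B\<^sup>2)"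
  shows "\<exists>P\<in>nv. u P = u0 \<and> v P = v0 \<and> w P = w0"
proof -
  have nz: "w0 \<noteq> 0" using assms B by auto
  \<comment> \<open>The products \<open>z\<^sub>1 w\<^sub>2\<close> and \<open>z\<^sub>2 w\<^sub>2\<close> on the slice \<open>g = 1\<close>; the other two are \<open>w0\<close> and \<open>v0\<close>.\<close>
  define b d where "b = (u0 - 2 * B\<^sup>2 * w0) / B" and "d = 1 / \<delta> - \<gamma> / \<delta> * v0 - u0 + B\<^sup>2 * w0"
  have "B ^ 3 * (w0 * w0) = u0 * v0 + w0 * (u0 - 1 / \<delta> + (\<gamma> / \<delta> - 2 * B) * v0) * B"
  proof -
    have "B ^ 3 * (a / B ^ 3 + w0 * (L / B\<^sup>2)) = a + w0 * L * B" for a L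
      using B by (simp add: field_simps power2_eq_square power3_eq_cube)
    then show ?thesis unfolding w0 .
  qed
  then have "B * (w0 * d) = (u0 - 2 * B\<^sup>2 * w0) * v0"
    by (simp add: d_def algebra_simps power2_eq_square power3_eq_cube)
  also have "u0 - 2 * B\<^sup>2 * w0 = B * b" using B by (simp add: b_def)
  finally have segre: "w0 * d = b * v0" using B by simp
  have bB: "B * b = u0 - 2 * B\<^sup>2 * w0" using B by (simp add: b_def)
  have g1: "g 1 (v0 / w0) w0 b = 1"
  proof -
    define r where "r = v0 / w0"
    have r: "r * w0 = v0" "r * b = d" using segre nz by (simp_all add: r_def field_simps)
    have "g 1 r w0 b = B\<^sup>2 * \<delta> * w0 + \<delta> * (B * b) + \<gamma> * (r * w0) + \<delta> * (r * b)"
      by (simp add: g bilinear_form_def)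
    then have "g 1 (v0 / w0) w0 b = B\<^sup>2 * \<delta> * w0 + \<delta> * (B * b) + \<gamma> * v0 + \<delta> * d"
      unfolding r by (simp add: r_def)
    also have "\<dots> = 1"
      unfolding bB using \<delta> by (simp add: d_def algebra_simps)
    finally show ?thesis .
  qed
  let ?P = "(pt 1 (v0 / w0), pt w0 b)"
  have "?P \<in> nv" using g1 by (intro nvI) simp
  moreover have "w ?P = w0" "v ?P = v0" "u ?P = u0"
    using g1 nz bB by (simp_all add: w_def v_def u_def mon_pt monomial_form_def)
  ultimately show ?thesis by blast
qed

text \<open>The polynomial in the hypothesis is, up to a constant factor, the discriminant of the quadratic equation for
\<open>w\<close>, as a polynomial in \<open>u\<close>. It is monic, so only finitely many \<open>u\<close> have to be avoided for each \<open>v\<close>.\<close>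

lemma two_sheets:
  assumes "u0 \<noteq> 0" "v0 \<noteq> 0"
    "poly [:(1 / \<delta> - (\<gamma> / \<delta> - 2 * B) * v0)\<^sup>2, 4 * B * v0 - 2 * (1 / \<delta> - (\<gamma> / \<delta> - 2 * B) * v0), 1:] u0 \<noteq> 0"
  shows "\<exists>P\<in>nv. \<exists>P'\<in>nv. u P = u0 \<and> v P = v0 \<and> u P' = u0 \<and> v P' = v0 \<and> w P \<noteq> w P'"
proof -
  define L where "L = u0 - 1 / \<delta> + (\<gamma> / \<delta> - 2 * B) * v0"
  define s where "s = csqrt (L\<^sup>2 + 4 * B * u0 * v0)"
  have s2: "s * s = L\<^sup>2 + 4 * B * u0 * v0"
    using power2_csqrt[of "L\<^sup>2 + 4 * B * u0 * v0"] by (simp add: s_def power2_eq_square)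
  have "L\<^sup>2 + 4 * B * u0 * v0 \<noteq> 0"
    using assms(3) by (simp add: L_def algebra_simps power2_eq_square)
  then have s: "s \<noteq> 0" using s2 by auto
  have root: "\<exists>P\<in>nv. u P = u0 \<and> v P = v0 \<and> w P = (L + r) / (2 * B\<^sup>2)" if "r * r = s * s" for r
  proof (rule sheets[OF assms(1,2)], fold L_def)
    have "(L + r) * (L + r) = 4 * (B * u0 * v0) + 2 * ((L + r) * L)"
      using that s2 by (simp add: algebra_simps power2_eq_square)
    then show "(L + r) / (2 * B\<^sup>2) * ((L + r) / (2 * B\<^sup>2)) = u0 * v0 / B ^ 3 + (L + r) / (2 * B\<^sup>2) * (L / B\<^sup>2)"
      using B by (simp add: field_simps power2_eq_square power3_eq_cube)
  qed
  obtain P P' where "P \<in> nv" "u P = u0" "v P = v0" "w P = (L + s) / (2 * B\<^sup>2)"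
    "P' \<in> nv" "u P' = u0" "v P' = v0" "w P' = (L + - s) / (2 * B\<^sup>2)"
    using root[of s] root[of "- s"] by auto
  moreover have "(L + s) / (2 * B\<^sup>2) \<noteq> (L + - s) / (2 * B\<^sup>2)"
    using s B by (simp add: field_simps)
  ultimately show ?thesis by metis
qed

text \<open>A finite grid is enough to detect polynomials of bounded degree. Finiteness matters: each point of the
surface gives an identity of germs, hence only on a neighbourhood that depends on the point, and finitely
many neighbourhoods still have a common one.\<close>

lemma grid:
  obtains U V where "finite U" "finite V" "card U = n" "card V = n"
    "\<forall>a\<in>U. \<forall>b\<in>V. \<exists>P\<in>nv. \<exists>P'\<in>nv. u P = a \<and> v P = b \<and> u P' = a \<and> v P' = b \<and> w P \<noteq> w P'"
proof -
  let ?p = "\<lambda>b. [:(1 / \<delta> - (\<gamma> / \<delta> - 2 * B) * b)\<^sup>2, 4 * B * b - 2 * (1 / \<delta> - (\<gamma> / \<delta> - 2 * B) * b), 1:]"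
  have "infinite (UNIV - {0::complex})"
    by (simp add: infinite_UNIV_char_0)
  then obtain V where V: "V \<subseteq> UNIV - {0::complex}" "finite V" "card V = n"
    using infinite_arbitrarily_large by metis
  \<comment> \<open>For every \<open>v\<close> in \<open>V\<close>, avoid \<open>u = 0\<close> and the zeros of the discriminant.\<close>
  define bad where "bad = insert 0 (\<Union>b\<in>V. {a. poly (?p b) a = 0})"
  have "finite bad"
    unfolding bad_def using V(2) by (intro finite.insertI finite_UN_I poly_roots_finite) auto
  then have "infinite (UNIV - bad)"
    by (rule Diff_infinite_finite) (simp add: infinite_UNIV_char_0)
  then obtain U where U: "U \<subseteq> UNIV - bad" "finite U" "card U = n"
    using infinite_arbitrarily_large by metis
  have "\<exists>P\<in>nv. \<exists>P'\<in>nv. u P = a \<and> v P = b \<and> u P' = a \<and> v P' = b \<and> w P \<noteq> w P'"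
    if "a \<in> U" "b \<in> V" for a b
    by (rule two_sheets) (use U V that in \<open>auto simp: bad_def\<close>)
  then show ?thesis
    by (intro that[OF U(2) V(2) U(3) V(3)] ballI)
qed

lemma horner2_vanishes:
  assumes "finite U" "finite V" "length fss \<le> card V" "\<forall>fs\<in>set fss. length fs \<le> card U"
    "\<And>a b. a \<in> U \<Longrightarrow> b \<in> V \<Longrightarrow> horner_sum (\<lambda>fs. horner_sum h a fs) b fss = (0::complex)"
    "fs \<in> set fss" "f \<in> set fs"
  shows "h f = 0"
proof -
  have 1: "horner_sum h a fs = 0" if "a \<in> U" for a
    using horner_sum_vanishes[OF assms(2,3), of "\<lambda>fs. horner_sum h a fs" fs] assms(5,6) that by auto
  show ?thesis
    by (rule horner_sum_vanishes[OF assms(1) _ 1 assms(7)]) (use assms(4,6) in auto)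
qed

text \<open>Over each point of the grid there are two values of \<open>w\<close>, so \<open>T + w S = 0\<close> at both points separates \<open>T\<close> from
\<open>S\<close>. The resulting polynomials in \<open>u, v\<close> vanish on the grid, and their coefficients vanish.\<close>

lemma coefficients_vanish:
  assumes fss: "\<forall>fs\<in>set fss. analytic_list fs" and gss: "\<forall>gs\<in>set gss. analytic_list gs"
    and zero: "\<And>P. P \<in> nv \<Longrightarrow> xy_operator fss (exp_germ P) \<oplus>\<^bsub>\<O>\<^esub> scale (w P) (xy_operator gss (exp_germ P)) = \<zero>\<^bsub>\<O>\<^esub>"
  shows "(\<forall>fs\<in>set fss. \<forall>f\<in>set fs. germ p f = \<zero>\<^bsub>\<O>\<^esub>) \<and> (\<forall>gs\<in>set gss. \<forall>f\<in>set gs. germ p f = \<zero>\<^bsub>\<O>\<^esub>)"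
proof -
  define n where "n = Max (set (map length (fss @ gss)) \<union> {length fss, length gss})"
  have le: "x \<le> n" if "x \<in> set (map length (fss @ gss)) \<union> {length fss, length gss}" for x
    unfolding n_def using that by (intro Max_ge) auto
  have n: "length fss \<le> n" "length gss \<le> n" "\<And>fs. fs \<in> set fss \<Longrightarrow> length fs \<le> n" "\<And>gs. gs \<in> set gss \<Longrightarrow> length gs \<le> n"
    by (rule le; simp)+
  obtain U V where UV: "finite U" "finite V" "card U = n" "card V = n"
    "\<forall>a\<in>U. \<forall>b\<in>V. \<exists>P\<in>nv. \<exists>P'\<in>nv. u P = a \<and> v P = b \<and> u P' = a \<and> v P' = b \<and> w P \<noteq> w P'"
    using grid[of n] .
  define H where "H fss a b q = horner_sum (\<lambda>fs. horner_sum (\<lambda>f. f q) a fs) b fss" for fss :: "fun2 list list" and a b q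
  have ev: "\<forall>\<^sub>F q in nhds p. H fss (u P) (v P) q + w P * H gss (u P) (v P) q = 0" if "P \<in> nv" for P
  proof -
    have "\<forall>\<^sub>F q in nhds p. H fss (u P) (v P) q * exp_fun P q + w P * (H gss (u P) (v P) q * exp_fun P q) = 0"
      using zero[OF that] unfolding xy_operator_exp_germ[OF fss] xy_operator_exp_germ[OF gss] H_def[symmetric]
      by (simp add: scale_germ germ_add germ_zero germ_eq_iff)
    then show ?thesis
    proof eventually_elim
      case (elim q)
      then have "(H fss (u P) (v P) q + w P * H gss (u P) (v P) q) * exp_fun P q = 0"
        by (simp add: algebra_simps)
      then show ?case using exp_fun_nonzero by simp
    qed
  qed
  have "\<forall>\<^sub>F q in nhds p. H fss a b q = 0 \<and> H gss a b q = 0" if "a \<in> U" "b \<in> V" for a b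
  proof -
    obtain P P' where P: "P \<in> nv" "P' \<in> nv" "u P = a" "v P = b" "u P' = a" "v P' = b" "w P \<noteq> w P'"
      using UV(5)[rule_format, OF \<open>a \<in> U\<close> \<open>b \<in> V\<close>] by blast
    from ev[OF P(1)] ev[OF P(2)] show ?thesis
    proof eventually_elim
      case (elim q)
      then have 1: "H fss a b q + w P * H gss a b q = 0" "H fss a b q + w P' * H gss a b q = 0"
        by (simp_all add: P(3-6))
      have "(w P - w P') * H gss a b q =
          (H fss a b q + w P * H gss a b q) - (H fss a b q + w P' * H gss a b q)"
        by (simp add: left_diff_distrib)
      then have "(w P - w P') * H gss a b q = 0" unfolding 1 by simp
      then have "H gss a b q = 0" using P(7) by simp
      with 1(1) show ?case by simp
    qed
  qed
  then have "\<forall>\<^sub>F q in nhds p. \<forall>(a, b)\<in>U \<times> V. H fss a b q = 0 \<and> H gss a b q = 0"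
    using UV(1,2) by (intro eventually_ball_finite) auto
  then have "\<forall>\<^sub>F q in nhds p. (\<forall>fs\<in>set fss. \<forall>f\<in>set fs. f q = 0) \<and> (\<forall>gs\<in>set gss. \<forall>f\<in>set gs. f q = 0)"
  proof eventually_elim
    case (elim q)
    show ?case
    proof (intro conjI ballI)
      fix fs f assume "fs \<in> set fss" "f \<in> set fs"
      then show "f q = 0"
        using horner2_vanishes[OF UV(1,2), of fss "\<lambda>f. f q" fs f] elim n UV(3,4) by (auto simp: H_def)
    next
      fix fs f assume "fs \<in> set gss" "f \<in> set fs"
      then show "f q = 0"
        using horner2_vanishes[OF UV(1,2), of gss "\<lambda>f. f q" fs f] elim n UV(3,4) by (auto simp: H_def)
    qed
  qed
  then show ?thesis
    unfolding germ_zero germ_eq_iff by (auto elim: eventually_mono)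
qed

end



context glued_surface
begin

lemma representation_unique:
  assumes "T \<in> \<D>" "S \<in> \<D>" "\<And>P. P \<in> nv \<Longrightarrow> T (exp_germ P) \<oplus>\<^bsub>\<O>\<^esub> scale (w P) (S (exp_germ P)) = \<zero>\<^bsub>\<O>\<^esub>"
  shows "T = \<zero>\<^bsub>\<E>\<^esub>" "S = \<zero>\<^bsub>\<E>\<^esub>"
proof -
  obtain fss where fss: "\<forall>fs\<in>set fss. analytic_list fs" "T = xy_operator fss"
    using \<D>_xy_operator[OF assms(1)] .
  obtain gss where gss: "\<forall>gs\<in>set gss. analytic_list gs" "S = xy_operator gss"
    using \<D>_xy_operator[OF assms(2)] .
  have "(\<forall>fs\<in>set fss. \<forall>f\<in>set fs. germ p f = \<zero>\<^bsub>\<O>\<^esub>) \<and> (\<forall>gs\<in>set gss. \<forall>f\<in>set gs. germ p f = \<zero>\<^bsub>\<O>\<^esub>)"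
    using assms(3) unfolding fss(2) gss(2) by (rule coefficients_vanish[OF fss(1) gss(1)])
  then show "T = \<zero>\<^bsub>\<E>\<^esub>" "S = \<zero>\<^bsub>\<E>\<^esub>"
    unfolding fss(2) gss(2) by (blast intro: xy_operator_zero)+
qed

text \<open>In the normal form, right multiplication by \<open>Y\<close> adds an empty list of coefficients in front.\<close>

lemma Y_right_cancel:
  assumes "Q \<in> \<D>" "Q \<otimes>\<^bsub>\<E>\<^esub> Y = \<zero>\<^bsub>\<E>\<^esub>"
  shows "Q = \<zero>\<^bsub>\<E>\<^esub>"
proof -
  obtain fss where fss: "\<forall>fs\<in>set fss. analytic_list fs" "Q = xy_operator fss"
    using \<D>_xy_operator[OF assms(1)] .
  have fss': "\<forall>fs\<in>set ([] # fss). analytic_list fs" using fss(1) by (simp add: analytic_list_def)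
  have "xy_operator ([] # fss) = \<zero>\<^bsub>\<E>\<^esub>"
    using assms(2) fss(2) by simp
  then have "xy_operator ([] # fss) (exp_germ P) \<oplus>\<^bsub>\<O>\<^esub> scale (w P) (xy_operator [] (exp_germ P)) = \<zero>\<^bsub>\<O>\<^esub>" for P
    by (simp only: xy_operator_simps(1)) (simp add: R.additive_endomorphisms_apply)
  with coefficients_vanish[OF fss', of "[]"] show ?thesis
    by (simp add: fss(2) xy_operator_zero)
qed

section \<open>The identified curves\<close>

text \<open>Membership of the complement is defined through some coordinates of the point; the form \<open>g\<close> is then nonzero
at all coordinates of it.\<close>

lemma nv_coordinates_nonzero:
  assumes "(pt z1 z2, pt w1 w2) \<in> nv" "(z1, z2) \<noteq> 0" "(w1, w2) \<noteq> 0"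
  shows "g z1 z2 w1 w2 \<noteq> 0"
proof -
  obtain z1' z2' w1' w2' where z: "pt z1 z2 = pt z1' z2'" "pt w1 w2 = pt w1' w2'" and nz: "g z1' z2' w1' w2' \<noteq> 0"
    using assms(1) by (auto elim!: nv_cases)
  have "g 0 0 w1' w2' = 0" "g z1' z2' 0 0 = 0"
    using g_bihomogeneous[unfolded bihomogeneous_def, rule_format, of 0] by simp_all
  with nz have "(z1', z2') \<noteq> 0" "(w1', w2') \<noteq> 0"
    by (auto simp: zero_prod_def)
  then obtain c d c' d' where "c \<noteq> 0" "d \<noteq> 0" "c' \<noteq> 0" "d' \<noteq> 0"
    "rep_cp1 (pt z1 z2) = (c * z1, c * z2)" "rep_cp1 (pt w1 w2) = (d * w1, d * w2)"
    "rep_cp1 (pt z1 z2) = (c' * z1', c' * z2')" "rep_cp1 (pt w1 w2) = (d' * w1', d' * w2')"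
    using assms(2,3) z by (metis rep_cp1_pt)
  moreover have "g (c * z1) (c * z2) (d * w1) (d * w2) = c * (d * g z1 z2 w1 w2)"
    "g (c' * z1') (c' * z2') (d' * w1') (d' * w2') = c' * (d' * g z1' z2' w1' w2')"
    for c d c' d' :: complex
    using g_bihomogeneous by (simp_all add: bihomogeneous_def)
  ultimately show ?thesis using nz by (metis mult_eq_0_iff prod.inject)
qed

text \<open>The points of the two identified curves off \<open>g = 0\<close>, with coordinates normalised such that \<open>g\<close> is \<open>B\<close> on the
first curve and \<open>1\<close> on the second one.\<close>

lemma edge_values:
  assumes "\<delta> * (B * a + b) = 1"
  shows "(pt 1 0, pt a b) \<in> nv" "(pt a b, pt 0 1) \<in> nv"
    "mon 1 1 1 (pt 1 0, pt a b) = a / B" "mon 1 1 0 (pt 1 0, pt a b) = b / B"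
    "mon 1 0 1 (pt 1 0, pt a b) = 0" "mon 1 0 0 (pt 1 0, pt a b) = 0"
    "mon 1 1 1 (pt a b, pt 0 1) = 0" "mon 1 1 0 (pt a b, pt 0 1) = a"
    "mon 1 0 1 (pt a b, pt 0 1) = 0" "mon 1 0 0 (pt a b, pt 0 1) = b"
proof -
  have "g 1 0 a b = B * (\<delta> * (B * a + b))" "g a b 0 1 = \<delta> * (B * a + b)"
    by (simp_all add: g bilinear_form_def algebra_simps power2_eq_square)
  then have gv: "g 1 0 a b = B" "g a b 0 1 = 1" by (simp_all add: assms)
  then have nz: "g 1 0 a b \<noteq> 0" "g a b 0 1 \<noteq> 0" using B by simp_all
  show "(pt 1 0, pt a b) \<in> nv" "(pt a b, pt 0 1) \<in> nv"
    using nz by (auto intro: nvI)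
  show "mon 1 1 1 (pt 1 0, pt a b) = a / B" "mon 1 1 0 (pt 1 0, pt a b) = b / B"
    "mon 1 0 1 (pt 1 0, pt a b) = 0" "mon 1 0 0 (pt 1 0, pt a b) = 0"
    by (simp_all add: mon_pt[OF nz(1)] monomial_form_def gv)
  show "mon 1 1 1 (pt a b, pt 0 1) = 0" "mon 1 1 0 (pt a b, pt 0 1) = a"
    "mon 1 0 1 (pt a b, pt 0 1) = 0" "mon 1 0 0 (pt a b, pt 0 1) = b"
    by (simp_all add: mon_pt[OF nz(2)] monomial_form_def gv)
qed

lemma edge_coordinates:
  assumes "\<delta> * (B * a + b) = 1"
  shows "u (pt 1 0, pt a b) = 1 / \<delta> + B * a" "u (pt a b, pt 0 1) = B * a"
    "v (pt 1 0, pt a b) = 0" "v (pt a b, pt 0 1) = 0"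
proof -
  have "b = 1 / \<delta> - B * a" using assms \<delta> by (simp add: field_simps)
  then show "u (pt 1 0, pt a b) = 1 / \<delta> + B * a"
    using B unfolding u_def edge_values(3,4)[OF assms] by (simp add: power2_eq_square)
  show "u (pt a b, pt 0 1) = B * a" "v (pt 1 0, pt a b) = 0" "v (pt a b, pt 0 1) = 0"
    unfolding u_def v_def edge_values[OF assms] by simp_all
qed

text \<open>The quotient of the exponentials at two identified points, see \<open>edge_exp_fun\<close>.\<close>

definition jump :: fun2 where "jump q = exp (c1 * fst q + c2 * snd q)"

lemma edge_exp_fun:
  assumes "\<delta> * (B * a + b) = 1"
  shows "exp_fun (pt 1 0, pt a b) q = jump q * exp_fun (pt a b, pt 0 1) q"
proof -
  have "c * \<delta> * (1 / \<delta> + s) = c + c * \<delta> * s" for c s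
    using \<delta> by (simp add: field_simps)
  then show ?thesis
    unfolding exp_fun_def edge_coordinates[OF assms] jump_def case_prod_unfold exp_add[symmetric]
    by (simp add: algebra_simps)
qed

lemma edge_cases:
  assumes "(pt 1 0, t) \<in> nv"
  obtains a b where "t = pt a b" "\<delta> * (B * a + b) = 1"
proof -
  obtain t1 t2 where t: "t = pt t1 t2" "(t1, t2) \<noteq> 0" by (rule cp1_cases)
  have "g 1 0 t1 t2 = B * (\<delta> * (B * t1 + t2))"
    by (simp add: g bilinear_form_def algebra_simps power2_eq_square)
  moreover have "g 1 0 t1 t2 \<noteq> 0"
    by (rule nv_coordinates_nonzero) (use assms t in \<open>auto simp: zero_prod_def\<close>)
  ultimately have s: "\<delta> * (B * t1 + t2) \<noteq> 0" by auto
  define c where "c = 1 / (\<delta> * (B * t1 + t2))"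
  have c: "c \<noteq> 0" using s by (simp add: c_def)
  have "proj_rel (t1, t2) (c * t1, c * t2)"
    using t(2) c by (auto simp: proj_rel_def zero_prod_def)
  then have "pt t1 t2 = pt (c * t1) (c * t2)"
    unfolding pt_def by (rule Quotient_rel_abs[OF Quotient_cp1])
  moreover have "\<delta> * (B * (c * t1) + c * t2) = c * (\<delta> * (B * t1 + t2))"
    by (simp add: algebra_simps)
  then have "\<delta> * (B * (c * t1) + c * t2) = 1"
    using s by (simp add: c_def)
  ultimately show ?thesis using t that by metis
qed

lemma gluing_iff:
  "gluing \<phi> \<longleftrightarrow> (\<forall>a b. \<delta> * (B * a + b) = 1 \<longrightarrow> \<phi> (pt 1 0, pt a b) = scale \<Lambda> (\<phi> (pt a b, pt 0 1)))"
proof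
  assume "gluing \<phi>"
  then show "\<forall>a b. \<delta> * (B * a + b) = 1 \<longrightarrow> \<phi> (pt 1 0, pt a b) = scale \<Lambda> (\<phi> (pt a b, pt 0 1))"
    unfolding gluing_def by (simp add: edge_values(1,2))
next
  assume R: "\<forall>a b. \<delta> * (B * a + b) = 1 \<longrightarrow> \<phi> (pt 1 0, pt a b) = scale \<Lambda> (\<phi> (pt a b, pt 0 1))"
  show "gluing \<phi>"
    unfolding gluing_def
  proof (intro allI impI)
    fix t assume "(pt 1 0, t) \<in> nv \<and> (t, pt 0 1) \<in> nv"
    then obtain a b where "t = pt a b" "\<delta> * (B * a + b) = 1"
      using edge_cases by blast
    then show "\<phi> (pt 1 0, t) = scale \<Lambda> (\<phi> (t, pt 0 1))" using R by simp
  qed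
qed

lemma jump_analytic: "analytic_near p jump"
proof -
  have "jump = (\<lambda>(x, y). exp (x * c1 + y * c2))"
    by (auto simp: jump_def mult.commute)
  then show ?thesis by simp
qed

text \<open>The factor \<open>\<mu>\<close> by which the quotients \<open>h / g\<^sup>k\<close> differ at two identified points when the gluing condition
holds: dividing out the exponentials turns \<open>\<Lambda>\<close> into this function of \<open>(x, y)\<close>.\<close>

definition multiplier :: fun2 where "multiplier q = \<Lambda> * inverse (jump q)"

lemma multiplier_analytic: "analytic_near p multiplier"
  unfolding multiplier_def
  by (intro analytic_near_mult analytic_near_const analytic_near_inverse jump_analytic) (simp add: jump_def)

lemma multiplier_jump: "multiplier q * jump q = \<Lambda>"
  by (simp add: multiplier_def jump_def)

lemma multiplier_ne_1: "multiplier p \<noteq> 1"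
  using \<Lambda> multiplier_jump[of p] by (auto simp: jump_def)

lemma jump_ne_\<Lambda>: "\<forall>\<^sub>F q in nhds p. jump q \<noteq> \<Lambda>"
proof -
  have "isCont jump p"
    unfolding jump_def by (intro continuous_intros)
  then show ?thesis
    using \<Lambda> tendsto_imp_eventually_ne[of jump "jump p" "at p" \<Lambda>]
    by (auto simp: isCont_def eventually_nhds_conv_at jump_def)
qed

section \<open>Two functions of level one\<close>

text \<open>The bilinear numerators that satisfy the gluing condition are determined by their coefficients at
\<open>z\<^sub>2 w\<^sub>2\<close> and \<open>z\<^sub>2 w\<^sub>1\<close>: those at \<open>z\<^sub>1 w\<^sub>2\<close> and \<open>z\<^sub>1 w\<^sub>1\<close> arise from the former by one and two
applications of the factor \<open>\<mu> B\<close>. The two functions are the two unit choices.\<close>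

definition phi0 :: "cp1 \<times> cp1 \<Rightarrow> fun2 set" where
  "phi0 = (\<lambda>P\<in>nv. germ p (\<lambda>q. (mon 1 0 0 P + multiplier q * B * mon 1 1 0 P + (multiplier q)\<^sup>2 * B\<^sup>2 * mon 1 1 1 P) * exp_fun P q))"

definition phi1 :: "cp1 \<times> cp1 \<Rightarrow> fun2 set" where
  "phi1 = (\<lambda>P\<in>nv. germ p (\<lambda>q. mon 1 0 1 P * exp_fun P q))"

lemma square_analytic: "analytic_near p f \<Longrightarrow> analytic_near p (\<lambda>q. (f q)\<^sup>2)"
  by (simp add: power2_eq_square analytic_near_mult)

lemma phi0_BA: "phi0 \<in> BA_space g g1 g2 \<Lambda> p 1"
  unfolding BA_space_iff
proof (intro conjI)
  define h where "h i j = (if i = 0 then if j = 0 then (\<lambda>_. 1) else (\<lambda>_. 0)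
     else if j = 0 then (\<lambda>q. multiplier q * B) else (\<lambda>q. (multiplier q)\<^sup>2 * B\<^sup>2))" for i j :: nat
  show "form_family 1 phi0"
    unfolding form_family_def
  proof (intro exI[of _ h] conjI allI impI ballI)
    show "analytic_near p (h i j)" for i j
      by (auto simp: h_def intro!: analytic_near_mult multiplier_analytic square_analytic)
    show "phi0 P = germ p (\<lambda>q. (\<Sum>i\<le>1. \<Sum>j\<le>1. h i j q * mon 1 i j P) * exp_fun P q)" if "P \<in> nv" for P
      using that by (simp add: phi0_def h_def ac_simps)
  qed
  show "phi0 \<in> nv \<rightarrow>\<^sub>E carrier \<O>"
    unfolding phi0_def
    by (auto intro!: germ_carrier analytic_near_mult analytic_near_add multiplier_analytic square_analytic)
  show "gluing phi0"
    unfolding gluing_iff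
  proof (intro allI impI)
    fix a b assume ab: "\<delta> * (B * a + b) = 1"
    have "(multiplier q * B * (b / B) + (multiplier q)\<^sup>2 * B\<^sup>2 * (a / B)) * exp_fun (pt 1 0, pt a b) q =
        \<Lambda> * ((b + multiplier q * B * a) * exp_fun (pt a b, pt 0 1) q)" for q
    proof -
      have "(multiplier q * B * (b / B) + (multiplier q)\<^sup>2 * B\<^sup>2 * (a / B)) = multiplier q * (b + multiplier q * B * a)"
        using B by (simp add: field_simps power2_eq_square)
      moreover have "multiplier q * (b + multiplier q * B * a) * (jump q * exp_fun (pt a b, pt 0 1) q) =
          (multiplier q * jump q) * ((b + multiplier q * B * a) * exp_fun (pt a b, pt 0 1) q)"
        by (simp only: mult_ac)
      ultimately show ?thesis
        unfolding edge_exp_fun[OF ab] by (simp only: multiplier_jump)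
    qed
    then show "phi0 (pt 1 0, pt a b) = scale \<Lambda> (phi0 (pt a b, pt 0 1))"
      unfolding phi0_def restrict_apply' [OF edge_values(1)[OF ab]] restrict_apply'[OF edge_values(2)[OF ab]]
        edge_values[OF ab] scale_germ by simp
  qed
qed

lemma phi1_BA: "phi1 \<in> BA_space g g1 g2 \<Lambda> p 1"
  unfolding BA_space_iff
proof (intro conjI)
  define h where "h i j = (if i = 0 \<and> j = 1 then (\<lambda>_. 1) else (\<lambda>_. 0) :: fun2)" for i j :: nat
  show "form_family 1 phi1"
    unfolding form_family_def
  proof (intro exI[of _ h] conjI allI impI ballI)
    show "analytic_near p (h i j)" for i j by (auto simp: h_def)
    show "phi1 P = germ p (\<lambda>q. (\<Sum>i\<le>1. \<Sum>j\<le>1. h i j q * mon 1 i j P) * exp_fun P q)" if "P \<in> nv" for P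
      using that by (simp add: phi1_def h_def)
  qed
  show "phi1 \<in> nv \<rightarrow>\<^sub>E carrier \<O>"
    unfolding phi1_def by (auto intro!: germ_carrier analytic_near_mult)
  show "gluing phi1"
    unfolding gluing_iff phi1_def
    by (simp add: restrict_apply' edge_values[simplified] scale_germ)
qed

text \<open>The pair of operators that represents \<open>phi0\<close>, see \<open>phi0_eq\<close>.\<close>

definition phi0_op where
  "phi0_op = mulop (\<lambda>_. 1 / \<delta>) \<oplus>\<^bsub>\<E>\<^esub> mulop (\<lambda>_. - \<gamma> / \<delta>) \<otimes>\<^bsub>\<E>\<^esub> Y \<oplus>\<^bsub>\<E>\<^esub> mulop (\<lambda>q. multiplier q - 1) \<otimes>\<^bsub>\<E>\<^esub> X"

definition phi0_coeff :: fun2 where "phi0_coeff q = B\<^sup>2 * ((multiplier q - 1) * (multiplier q - 1))"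

lemma multiplier_minus_one_analytic: "analytic_near p (\<lambda>q. multiplier q - 1)"
  using analytic_near_add[OF multiplier_analytic analytic_near_const[of p "- 1"]] by simp

lemma phi0_coeff_analytic: "analytic_near p phi0_coeff"
  unfolding phi0_coeff_def[abs_def] by (intro analytic_near_mult multiplier_minus_one_analytic analytic_near_const)

lemma phi0_op_\<D> [simp]: "phi0_op \<in> \<D>"
  unfolding phi0_op_def by (intro \<D>_closed Y_\<D> X_\<D> analytic_near_const multiplier_minus_one_analytic)

lemma phi0_eq:
  assumes "P \<in> nv"
  shows "phi0 P = phi0_op (exp_germ P) \<oplus>\<^bsub>\<O>\<^esub> scale (w P) (mulop phi0_coeff (exp_germ P))"
proof -
  have "phi0_op (exp_germ P) = germ p (\<lambda>q. 1 / \<delta> * exp_fun P q + - \<gamma> / \<delta> * (v P * exp_fun P q) + (multiplier q - 1) * (u P * exp_fun P q))"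
    unfolding phi0_op_def
    by (simp add: \<D>_apply multiplier_minus_one_analytic X_exp_germ Y_exp_germ mulop_exp_germ)
       (simp add: exp_germ_def scale_germ mulop_germ germ_add analytic_near_mult)
  then have "phi0_op (exp_germ P) \<oplus>\<^bsub>\<O>\<^esub> scale (w P) (mulop phi0_coeff (exp_germ P)) = germ p (\<lambda>q. (1 / \<delta> * exp_fun P q + - \<gamma> / \<delta> * (v P * exp_fun P q)
       + (multiplier q - 1) * (u P * exp_fun P q)) + w P * (phi0_coeff q * exp_fun P q))"
    by (simp add: mulop_exp_germ scale_germ germ_add)
  also have "(\<lambda>q. (1 / \<delta> * exp_fun P q + - \<gamma> / \<delta> * (v P * exp_fun P q)
       + (multiplier q - 1) * (u P * exp_fun P q)) + w P * (phi0_coeff q * exp_fun P q)) =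
     (\<lambda>q. (mon 1 0 0 P + multiplier q * B * mon 1 1 0 P + (multiplier q)\<^sup>2 * B\<^sup>2 * mon 1 1 1 P) * exp_fun P q)"
  proof
    fix q
    have cancel: "multiplier q * B * ((u P - 2 * B\<^sup>2 * w P) / B) = multiplier q * (u P - 2 * B\<^sup>2 * w P)"
      using B by simp
    show "(1 / \<delta> * exp_fun P q + - \<gamma> / \<delta> * (v P * exp_fun P q)
       + (multiplier q - 1) * (u P * exp_fun P q)) + w P * (phi0_coeff q * exp_fun P q) =
       (mon 1 0 0 P + multiplier q * B * mon 1 1 0 P + (multiplier q)\<^sup>2 * B\<^sup>2 * mon 1 1 1 P) * exp_fun P q"
      unfolding mon_coords[OF assms] phi0_coeff_def cancel by (simp add: algebra_simps power2_eq_square)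
  qed
  finally show ?thesis using assms by (simp add: phi0_def)
qed

lemma phi1_eq:
  assumes "P \<in> nv" shows "phi1 P = Y (exp_germ P)"
  using assms unfolding Y_exp_germ by (simp add: phi1_def v_def exp_germ_def scale_germ)

text \<open>The coefficient \<open>B\<^sup>2 (\<mu> - 1)\<^sup>2\<close> vanishes exactly where \<open>\<Lambda> = exp (c\<^sub>1 x + c\<^sub>2 y)\<close>, a curve that the base point
avoids.\<close>

lemma phi0_coeff_inverse: "mulop phi0_coeff \<otimes>\<^bsub>\<E>\<^esub> mulop (\<lambda>q. inverse (phi0_coeff q)) = \<one>\<^bsub>\<E>\<^esub>"
  "mulop (\<lambda>q. inverse (phi0_coeff q)) \<otimes>\<^bsub>\<E>\<^esub> mulop phi0_coeff = \<one>\<^bsub>\<E>\<^esub>" "mulop (\<lambda>q. inverse (phi0_coeff q)) \<in> \<D>"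
proof -
  have "phi0_coeff p \<noteq> 0" using multiplier_ne_1 B by (simp add: phi0_coeff_def)
  then have an: "analytic_near p (\<lambda>q. inverse (phi0_coeff q))"
    by (intro analytic_near_inverse phi0_coeff_analytic)
  then show "mulop (\<lambda>q. inverse (phi0_coeff q)) \<in> \<D>" by simp
  have "\<forall>\<^sub>F q in nhds p. phi0_coeff q \<noteq> 0"
    using phi0_coeff_analytic \<open>phi0_coeff p \<noteq> 0\<close> by (rule analytic_near_eventually_nonzero)
  then have "\<forall>\<^sub>F q in nhds p. phi0_coeff q * inverse (phi0_coeff q) = 1"
    by eventually_elim simp
  then have "mulop (\<lambda>q. phi0_coeff q * inverse (phi0_coeff q)) = mulop (\<lambda>_. 1)"
    by (intro mulop_cong) (simp add: germ_eq_iff)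
  with an phi0_coeff_analytic show "mulop phi0_coeff \<otimes>\<^bsub>\<E>\<^esub> mulop (\<lambda>q. inverse (phi0_coeff q)) = \<one>\<^bsub>\<E>\<^esub>"
    "mulop (\<lambda>q. inverse (phi0_coeff q)) \<otimes>\<^bsub>\<E>\<^esub> mulop phi0_coeff = \<one>\<^bsub>\<E>\<^esub>"
    by (simp_all add: mulop_mult mulop_one mult.commute)
qed

section \<open>The part of the module without the second sheet\<close>

text \<open>On the identified curves \<open>v\<close> vanishes, so only the coefficients without \<open>Y\<close> are visible there. Near the base
point the gluing condition says that the polynomial with these coefficients is multiplied by \<open>\<mu> \<noteq> 1\<close> when
its argument is shifted by \<open>1/\<delta>\<close>; hence it is zero.\<close>

lemma glued_divisible_by_Y:
  assumes T: "T \<in> \<D>" and glue: "gluing (\<lambda>P. T (exp_germ P))"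
  shows "\<exists>Q\<in>\<D>. T = Q \<otimes>\<^bsub>\<E>\<^esub> Y"
proof -
  obtain fss where fss: "\<forall>fs\<in>set fss. analytic_list fs" "T = xy_operator fss"
    using \<D>_xy_operator[OF T] .
  show ?thesis
  proof (cases fss)
    case Nil
    then show ?thesis using fss by (intro bexI[of _ "\<zero>\<^bsub>\<E>\<^esub>"]) (simp_all add: Y_def dop_carrier)
  next
    case (Cons fs rest)
    then have an: "analytic_list fs" "\<forall>fs\<in>set rest. analytic_list fs" using fss(1) by auto
    have eval: "T (exp_germ P) = germ p (\<lambda>q. horner_sum (\<lambda>f. f q) (u P) fs * exp_fun P q)" if "v P = 0" for P
      unfolding fss(2) xy_operator_exp_germ[OF fss(1)] by (simp add: that Cons)
    obtain S :: "complex set" where S: "finite S" "card S = length fs"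
      using infinite_arbitrarily_large[OF infinite_UNIV_char_0] by metis
    have "\<forall>\<^sub>F q in nhds p. jump q * horner_sum (\<lambda>f. f q) (1 / \<delta> + s) fs = \<Lambda> * horner_sum (\<lambda>f. f q) s fs" for s
    proof -
      \<comment> \<open>The pair of identified points at which \<open>u\<close> is \<open>s + 1/\<delta>\<close> and \<open>s\<close>.\<close>
      define a b where "a = s / B" and "b = 1 / \<delta> - s"
      have ab: "\<delta> * (B * a + b) = 1" and Ba: "B * a = s" using B \<delta> by (simp_all add: a_def b_def)
      note coords = edge_coordinates[OF ab, unfolded Ba]
      have "germ p (\<lambda>q. horner_sum (\<lambda>f. f q) (1 / \<delta> + s) fs * exp_fun (pt 1 0, pt a b) q) =
          scale \<Lambda> (germ p (\<lambda>q. horner_sum (\<lambda>f. f q) s fs * exp_fun (pt a b, pt 0 1) q))"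
        using glue ab eval[OF coords(3), unfolded coords(1)] eval[OF coords(4), unfolded coords(2)]
        unfolding gluing_iff by metis
      then have "\<forall>\<^sub>F q in nhds p. horner_sum (\<lambda>f. f q) (1 / \<delta> + s) fs * exp_fun (pt 1 0, pt a b) q =
          \<Lambda> * (horner_sum (\<lambda>f. f q) s fs * exp_fun (pt a b, pt 0 1) q)"
        by (simp add: scale_germ germ_eq_iff)
      then show ?thesis
      proof eventually_elim
        case (elim q)
        then have "(jump q * horner_sum (\<lambda>f. f q) (1 / \<delta> + s) fs) * exp_fun (pt a b, pt 0 1) q =
            (\<Lambda> * horner_sum (\<lambda>f. f q) s fs) * exp_fun (pt a b, pt 0 1) q"
          unfolding edge_exp_fun[OF ab] by (simp add: mult_ac)
        then show ?case using exp_fun_nonzero by simp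
      qed
    qed
    then have "\<forall>\<^sub>F q in nhds p. \<forall>s\<in>S. jump q * horner_sum (\<lambda>f. f q) (1 / \<delta> + s) fs = \<Lambda> * horner_sum (\<lambda>f. f q) s fs"
      using S(1) by (intro eventually_ball_finite) auto
    with jump_ne_\<Lambda> have "\<forall>\<^sub>F q in nhds p. \<forall>f\<in>set fs. f q = 0"
    proof eventually_elim
      case (elim q)
      show ?case
      proof
        fix f assume f: "f \<in> set fs"
        show "f q = 0"
          by (rule shifted_polynomial_vanishes[where h = "\<lambda>f. f q", OF elim(1) S(1) _ f])
             (use S(2) elim(2) in auto)
      qed
    qed
    then have "x_operator fs = \<zero>\<^bsub>\<E>\<^esub>"
      by (intro x_operator_zero) (auto simp: germ_zero germ_eq_iff elim: eventually_mono)
    then have "T = xy_operator rest \<otimes>\<^bsub>\<E>\<^esub> Y"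
      using xy_operator_\<D>[OF an(2)] by (simp add: fss(2) Cons \<D>_carrier)
    then show ?thesis using xy_operator_\<D>[OF an(2)] by blast
  qed
qed

end



context glued_surface
begin

section \<open>The module and its basis\<close>

abbreviation BA where "BA \<equiv> BA_module g g1 g2 \<Lambda> p"

lemma BA_iff: "\<phi> \<in> carrier BA \<longleftrightarrow> \<phi> \<in> nv \<rightarrow>\<^sub>E carrier \<O> \<and> op_family \<phi> \<and> gluing \<phi>"
  by (simp add: BA_module_carrier)

lemma BA_apply: "\<phi> \<in> carrier BA \<Longrightarrow> P \<in> nv \<Longrightarrow> \<phi> P \<in> carrier \<O>"
  by (auto simp: BA_iff PiE_iff)

lemma BA_extensional: "\<phi> \<in> carrier BA \<Longrightarrow> \<phi> \<in> extensional nv"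
  by (simp add: BA_iff PiE_iff)

lemma BA_add: "\<phi> \<oplus>\<^bsub>BA\<^esub> \<psi> = (\<lambda>P\<in>nv. \<phi> P \<oplus>\<^bsub>\<O>\<^esub> \<psi> P)"
  and BA_zero: "\<zero>\<^bsub>BA\<^esub> = (\<lambda>P\<in>nv. \<zero>\<^bsub>\<O>\<^esub>)"
  and BA_smult: "T \<odot>\<^bsub>BA\<^esub> \<phi> = (\<lambda>P\<in>nv. T (\<phi> P))"
  by (simp_all add: BA_module_def)

lemma BA_I:
  assumes "\<And>P. P \<in> nv \<Longrightarrow> \<phi> P \<in> carrier \<O>" "op_family \<phi>"
    "\<And>a b. \<delta> * (B * a + b) = 1 \<Longrightarrow> \<phi> (pt 1 0, pt a b) = scale \<Lambda> (\<phi> (pt a b, pt 0 1))"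
  shows "restrict \<phi> nv \<in> carrier BA"
  unfolding BA_iff
proof (intro conjI)
  show "op_family (restrict \<phi> nv)"
    by (rule op_family_cong[OF assms(2)]) simp
  show "gluing (restrict \<phi> nv)"
    unfolding gluing_iff by (simp add: edge_values(1,2) assms(3))
qed (use assms(1) in auto)

lemma BA_gluing:
  "\<phi> \<in> carrier BA \<Longrightarrow> \<delta> * (B * a + b) = 1 \<Longrightarrow> \<phi> (pt 1 0, pt a b) = scale \<Lambda> (\<phi> (pt a b, pt 0 1))"
  by (simp add: BA_iff gluing_iff)

lemma BA_add_closed:
  assumes "\<phi> \<in> carrier BA" "\<psi> \<in> carrier BA" shows "\<phi> \<oplus>\<^bsub>BA\<^esub> \<psi> \<in> carrier BA"
  unfolding BA_add
proof (rule BA_I)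
  show "op_family (\<lambda>P. \<phi> P \<oplus>\<^bsub>\<O>\<^esub> \<psi> P)"
    using assms by (intro op_family_add[of \<phi> \<psi>]) (simp_all add: BA_iff)
  fix a b assume ab: "\<delta> * (B * a + b) = 1"
  show "\<phi> (pt 1 0, pt a b) \<oplus>\<^bsub>\<O>\<^esub> \<psi> (pt 1 0, pt a b) = scale \<Lambda> (\<phi> (pt a b, pt 0 1) \<oplus>\<^bsub>\<O>\<^esub> \<psi> (pt a b, pt 0 1))"
    using BA_gluing[OF assms(1) ab] BA_gluing[OF assms(2) ab] edge_values(2)[OF ab]
    by (simp add: scale_simps BA_apply[OF assms(1)] BA_apply[OF assms(2)] assms)
qed (simp add: BA_apply[OF assms(1)] BA_apply[OF assms(2)])

lemma BA_smult_closed: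
  assumes "T \<in> \<D>" "\<phi> \<in> carrier BA" shows "T \<odot>\<^bsub>BA\<^esub> \<phi> \<in> carrier BA"
  unfolding BA_smult
proof (rule BA_I)
  show "op_family (\<lambda>P. T (\<phi> P))"
    using assms(2) by (intro op_family_apply[OF assms(1), of \<phi>]) (simp add: BA_iff)
  fix a b assume ab: "\<delta> * (B * a + b) = 1"
  show "T (\<phi> (pt 1 0, pt a b)) = scale \<Lambda> (T (\<phi> (pt a b, pt 0 1)))"
    using BA_gluing[OF assms(2) ab] edge_values(2)[OF ab] by (simp add: \<D>_scale BA_apply[OF assms(2)] assms(1))
qed (simp add: \<D>_apply BA_apply[OF assms(2)] assms(1))

lemma BA_zero_closed: "\<zero>\<^bsub>BA\<^esub> \<in> carrier BA"
  unfolding BA_zero by (rule BA_I) (simp_all add: op_family_zero)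

lemma BA_eqI:
  assumes "\<phi> \<in> extensional nv" "\<psi> \<in> extensional nv" "\<And>P. P \<in> nv \<Longrightarrow> \<phi> P = \<psi> P"
  shows "\<phi> = \<psi>"
  using assms by (rule extensionalityI)

lemma BA_abelian_group: "abelian_group BA"
proof (rule abelian_groupI)
  fix \<phi> assume \<phi>: "\<phi> \<in> carrier BA"
  show "\<exists>\<psi>\<in>carrier BA. \<psi> \<oplus>\<^bsub>BA\<^esub> \<phi> = \<zero>\<^bsub>BA\<^esub>"
  proof (rule bexI)
    show "(\<ominus>\<^bsub>\<E>\<^esub> \<one>\<^bsub>\<E>\<^esub>) \<odot>\<^bsub>BA\<^esub> \<phi> \<in> carrier BA"
      by (rule BA_smult_closed) (simp_all add: \<phi>)
    show "(\<ominus>\<^bsub>\<E>\<^esub> \<one>\<^bsub>\<E>\<^esub>) \<odot>\<^bsub>BA\<^esub> \<phi> \<oplus>\<^bsub>BA\<^esub> \<phi> = \<zero>\<^bsub>BA\<^esub>"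
      unfolding BA_add BA_zero BA_smult
      by (rule restrict_ext)
         (simp add: \<D>_apply BA_apply \<phi> R.additive_endomorphisms_apply R.l_neg)
  qed
next
  fix \<phi> \<psi> \<rho> assume c: "\<phi> \<in> carrier BA" "\<psi> \<in> carrier BA" "\<rho> \<in> carrier BA"
  show "\<phi> \<oplus>\<^bsub>BA\<^esub> \<psi> \<oplus>\<^bsub>BA\<^esub> \<rho> = \<phi> \<oplus>\<^bsub>BA\<^esub> (\<psi> \<oplus>\<^bsub>BA\<^esub> \<rho>)"
    unfolding BA_add by (rule restrict_ext) (simp add: BA_apply[OF c(1)] BA_apply[OF c(2)] BA_apply[OF c(3)] R.a_assoc)
next
  fix \<phi> \<psi> assume c: "\<phi> \<in> carrier BA" "\<psi> \<in> carrier BA"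
  show "\<phi> \<oplus>\<^bsub>BA\<^esub> \<psi> = \<psi> \<oplus>\<^bsub>BA\<^esub> \<phi>"
    unfolding BA_add by (rule restrict_ext) (simp add: BA_apply[OF c(1)] BA_apply[OF c(2)] R.a_comm)
next
  fix \<phi> assume c: "\<phi> \<in> carrier BA"
  show "\<zero>\<^bsub>BA\<^esub> \<oplus>\<^bsub>BA\<^esub> \<phi> = \<phi>"
    unfolding BA_add BA_zero by (rule BA_eqI) (simp_all add: BA_apply[OF c] BA_extensional c)
qed (use BA_add_closed BA_zero_closed in blast)+

lemma BA_left_module: "left_module (diff_ops p) BA"
proof -
  interpret D: ring "diff_ops p" by (rule diff_ops_ring)
  interpret M: abelian_group BA by (rule BA_abelian_group)
  show ?thesis
  proof (unfold_locales, goal_cases)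
    case (1 a x)
    then show ?case by (simp add: diff_ops_eq BA_smult_closed)
  next
    case (2 a b x)
    then show ?case
      by (auto simp: diff_ops_eq BA_smult BA_add \<D>_apply BA_apply intro!: restrict_ext)
  next
    case (3 a x y)
    then show ?case
      by (auto simp: diff_ops_eq BA_smult BA_add \<D>_apply BA_apply intro!: restrict_ext)
  next
    case (4 a b x)
    then show ?case
      by (auto simp: diff_ops_eq BA_smult BA_add \<D>_apply BA_apply intro!: restrict_ext)
  next
    case (5 x)
    then show ?case
      by (auto simp: diff_ops_eq BA_smult R.additive_endomorphisms_apply BA_apply BA_extensional intro!: BA_eqI)
  qed
qed

lemma phi_BA [simp]: "phi0 \<in> carrier BA" "phi1 \<in> carrier BA"
  using phi0_BA phi1_BA form_family_imp_op_family unfolding BA_iff BA_space_iff by blast+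

text \<open>In the representation by pairs the two functions form a triangular matrix, with \<open>Y\<close> and an invertible
function on the diagonal.\<close>

lemma combination_eq:
  assumes "r0 \<in> \<D>" "r1 \<in> \<D>" "P \<in> nv"
  shows "r0 (phi0 P) \<oplus>\<^bsub>\<O>\<^esub> r1 (phi1 P) =
    (r0 \<otimes>\<^bsub>\<E>\<^esub> phi0_op \<oplus>\<^bsub>\<E>\<^esub> r1 \<otimes>\<^bsub>\<E>\<^esub> Y) (exp_germ P) \<oplus>\<^bsub>\<O>\<^esub> scale (w P) ((r0 \<otimes>\<^bsub>\<E>\<^esub> mulop phi0_coeff) (exp_germ P))"
  using assms phi0_coeff_analytic by (simp add: phi0_eq phi1_eq \<D>_apply \<D>_scale R.a_ac)

text \<open>Back substitution in this triangular system: the coefficient of \<open>phi0\<close> is read off from \<open>S\<close>, and the rest is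
divisible by \<open>Y\<close> because it still satisfies the gluing condition.\<close>

lemma basis_exists:
  assumes mon: "\<phi> \<in> carrier BA"
  shows "\<exists>r0\<in>\<D>. \<exists>r1\<in>\<D>. \<forall>P\<in>nv. \<phi> P = r0 (phi0 P) \<oplus>\<^bsub>\<O>\<^esub> r1 (phi1 P)"
proof -
  obtain T S where TS: "T \<in> \<D>" "S \<in> \<D>" "\<And>P. P \<in> nv \<Longrightarrow> \<phi> P = T (exp_germ P) \<oplus>\<^bsub>\<O>\<^esub> scale (w P) (S (exp_germ P))"
    using mon unfolding BA_iff op_family_def by blast
  define r0 where "r0 = S \<otimes>\<^bsub>\<E>\<^esub> mulop (\<lambda>q. inverse (phi0_coeff q))"
  have r0: "r0 \<in> \<D>" using TS phi0_coeff_inverse(3) by (simp add: r0_def)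
  have r0s0: "r0 \<otimes>\<^bsub>\<E>\<^esub> mulop phi0_coeff = S"
    unfolding r0_def using TS phi0_coeff_inverse phi0_coeff_analytic by (simp add: E.m_assoc \<D>_carrier mulop_carrier)
  define T' where "T' = T \<oplus>\<^bsub>\<E>\<^esub> \<ominus>\<^bsub>\<E>\<^esub> (r0 \<otimes>\<^bsub>\<E>\<^esub> phi0_op)"
  have T': "T' \<in> \<D>" using TS r0 by (simp add: T'_def)
  have diff: "T' (exp_germ P) = \<phi> P \<oplus>\<^bsub>\<O>\<^esub> \<ominus>\<^bsub>\<O>\<^esub> r0 (phi0 P)" if P: "P \<in> nv" for P
  proof -
    have "r0 (phi0 P) = r0 (phi0_op (exp_germ P)) \<oplus>\<^bsub>\<O>\<^esub> scale (w P) (S (exp_germ P))"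
      using P r0 phi0_coeff_analytic by (simp add: phi0_eq \<D>_apply \<D>_scale r0s0[symmetric])
    moreover have "(a \<oplus>\<^bsub>\<O>\<^esub> c) \<oplus>\<^bsub>\<O>\<^esub> \<ominus>\<^bsub>\<O>\<^esub> (b \<oplus>\<^bsub>\<O>\<^esub> c) = a \<oplus>\<^bsub>\<O>\<^esub> \<ominus>\<^bsub>\<O>\<^esub> b"
      if "a \<in> carrier \<O>" "b \<in> carrier \<O>" "c \<in> carrier \<O>" for a b c
    proof -
      have "a \<oplus>\<^bsub>\<O>\<^esub> c = (a \<oplus>\<^bsub>\<O>\<^esub> \<ominus>\<^bsub>\<O>\<^esub> b) \<oplus>\<^bsub>\<O>\<^esub> (b \<oplus>\<^bsub>\<O>\<^esub> c)"
        using that by (simp add: R.a_assoc R.r_neg1)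
      then show ?thesis
        using that by (simp add: R.a_assoc[of _ "b \<oplus>\<^bsub>\<O>\<^esub> c"] R.r_neg)
    qed
    ultimately show ?thesis
      using TS P r0 by (simp add: T'_def \<D>_apply)
  qed
  have "gluing (\<lambda>P. T' (exp_germ P))"
    unfolding gluing_iff
  proof (intro allI impI)
    fix a b assume ab: "\<delta> * (B * a + b) = 1"
    show "T' (exp_germ (pt 1 0, pt a b)) = scale \<Lambda> (T' (exp_germ (pt a b, pt 0 1)))"
      unfolding diff[OF edge_values(1)[OF ab]] diff[OF edge_values(2)[OF ab]]
      using BA_gluing[OF mon ab] BA_gluing[OF phi_BA(1) ab] edge_values(2)[OF ab] r0 mon
      by (simp add: scale_simps \<D>_apply \<D>_scale BA_apply)
  qed
  from glued_divisible_by_Y[OF T' this] obtain Q where Q: "Q \<in> \<D>" "T' = Q \<otimes>\<^bsub>\<E>\<^esub> Y"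
    by blast
  have "\<phi> P = r0 (phi0 P) \<oplus>\<^bsub>\<O>\<^esub> Q (phi1 P)" if P: "P \<in> nv" for P
  proof -
    have "Q (phi1 P) = \<phi> P \<oplus>\<^bsub>\<O>\<^esub> \<ominus>\<^bsub>\<O>\<^esub> r0 (phi0 P)"
      using diff[OF P] Q by (simp add: \<D>_apply phi1_eq P)
    then show ?thesis
      using P mon r0 BA_apply[OF phi_BA(1) P] BA_apply[OF mon P] by (simp add: \<D>_apply R.a_lcomm R.r_neg)
  qed
  with r0 Q(1) show ?thesis by blast
qed

lemma basis_independent:
  assumes r: "r0 \<in> \<D>" "r1 \<in> \<D>" and zero: "\<And>P. P \<in> nv \<Longrightarrow> r0 (phi0 P) \<oplus>\<^bsub>\<O>\<^esub> r1 (phi1 P) = \<zero>\<^bsub>\<O>\<^esub>"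
  shows "r0 = \<zero>\<^bsub>\<E>\<^esub>" "r1 = \<zero>\<^bsub>\<E>\<^esub>"
proof -
  have *: "r0 \<otimes>\<^bsub>\<E>\<^esub> phi0_op \<oplus>\<^bsub>\<E>\<^esub> r1 \<otimes>\<^bsub>\<E>\<^esub> Y = \<zero>\<^bsub>\<E>\<^esub>" "r0 \<otimes>\<^bsub>\<E>\<^esub> mulop phi0_coeff = \<zero>\<^bsub>\<E>\<^esub>"
  proof -
    have cl: "r0 \<otimes>\<^bsub>\<E>\<^esub> phi0_op \<oplus>\<^bsub>\<E>\<^esub> r1 \<otimes>\<^bsub>\<E>\<^esub> Y \<in> \<D>" "r0 \<otimes>\<^bsub>\<E>\<^esub> mulop phi0_coeff \<in> \<D>"
      using r phi0_coeff_analytic by simp_all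
    have z: "(r0 \<otimes>\<^bsub>\<E>\<^esub> phi0_op \<oplus>\<^bsub>\<E>\<^esub> r1 \<otimes>\<^bsub>\<E>\<^esub> Y) (exp_germ P) \<oplus>\<^bsub>\<O>\<^esub> scale (w P) ((r0 \<otimes>\<^bsub>\<E>\<^esub> mulop phi0_coeff) (exp_germ P)) = \<zero>\<^bsub>\<O>\<^esub>"
      if "P \<in> nv" for P
      using zero[OF that] unfolding combination_eq[OF r that] .
    show "r0 \<otimes>\<^bsub>\<E>\<^esub> phi0_op \<oplus>\<^bsub>\<E>\<^esub> r1 \<otimes>\<^bsub>\<E>\<^esub> Y = \<zero>\<^bsub>\<E>\<^esub>" "r0 \<otimes>\<^bsub>\<E>\<^esub> mulop phi0_coeff = \<zero>\<^bsub>\<E>\<^esub>"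
      using representation_unique[OF cl z] by blast+
  qed
  have "r0 = (r0 \<otimes>\<^bsub>\<E>\<^esub> mulop phi0_coeff) \<otimes>\<^bsub>\<E>\<^esub> mulop (\<lambda>q. inverse (phi0_coeff q))"
    using r phi0_coeff_inverse phi0_coeff_analytic by (simp add: E.m_assoc \<D>_carrier mulop_carrier)
  also have "\<dots> = \<zero>\<^bsub>\<E>\<^esub>"
    using phi0_coeff_inverse(3) by (simp add: *(2) \<D>_carrier)
  finally show r0: "r0 = \<zero>\<^bsub>\<E>\<^esub>" .
  have "r1 \<otimes>\<^bsub>\<E>\<^esub> Y = \<zero>\<^bsub>\<E>\<^esub>"
    using *(1) r by (simp add: r0 \<D>_carrier)
  then show "r1 = \<zero>\<^bsub>\<E>\<^esub>"
    by (rule Y_right_cancel[OF r(2)])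
qed

lemma basis_unique:
  assumes "r0 \<in> \<D>" "r1 \<in> \<D>" "s \<in> \<D>" "t \<in> \<D>"
    and eq: "\<And>P. P \<in> nv \<Longrightarrow> r0 (phi0 P) \<oplus>\<^bsub>\<O>\<^esub> r1 (phi1 P) = s (phi0 P) \<oplus>\<^bsub>\<O>\<^esub> t (phi1 P)"
  shows "r0 = s" "r1 = t"
proof -
  have "(r0 \<oplus>\<^bsub>\<E>\<^esub> \<ominus>\<^bsub>\<E>\<^esub> s) (phi0 P) \<oplus>\<^bsub>\<O>\<^esub> (r1 \<oplus>\<^bsub>\<E>\<^esub> \<ominus>\<^bsub>\<E>\<^esub> t) (phi1 P) = \<zero>\<^bsub>\<O>\<^esub>" if P: "P \<in> nv" for P
  proof -
    note c = BA_apply[OF phi_BA(1) P] BA_apply[OF phi_BA(2) P]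
    have "(r0 \<oplus>\<^bsub>\<E>\<^esub> \<ominus>\<^bsub>\<E>\<^esub> s) (phi0 P) \<oplus>\<^bsub>\<O>\<^esub> (r1 \<oplus>\<^bsub>\<E>\<^esub> \<ominus>\<^bsub>\<E>\<^esub> t) (phi1 P) =
        (r0 (phi0 P) \<oplus>\<^bsub>\<O>\<^esub> r1 (phi1 P)) \<oplus>\<^bsub>\<O>\<^esub> \<ominus>\<^bsub>\<O>\<^esub> (s (phi0 P) \<oplus>\<^bsub>\<O>\<^esub> t (phi1 P))"
      using assms(1-4) c by (simp add: \<D>_apply R.minus_add R.a_ac)
    then show ?thesis
      unfolding eq[OF P] using assms(3,4) c by (simp add: \<D>_apply R.r_neg)
  qed
  moreover have "r0 \<oplus>\<^bsub>\<E>\<^esub> \<ominus>\<^bsub>\<E>\<^esub> s \<in> \<D>" "r1 \<oplus>\<^bsub>\<E>\<^esub> \<ominus>\<^bsub>\<E>\<^esub> t \<in> \<D>"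
    using assms(1-4) by simp_all
  ultimately have "r0 \<oplus>\<^bsub>\<E>\<^esub> \<ominus>\<^bsub>\<E>\<^esub> s = \<zero>\<^bsub>\<E>\<^esub>" "r1 \<oplus>\<^bsub>\<E>\<^esub> \<ominus>\<^bsub>\<E>\<^esub> t = \<zero>\<^bsub>\<E>\<^esub>"
    using basis_independent by blast+
  then show "r0 = s" "r1 = t"
    using E.r_right_minus_eq[unfolded a_minus_def] assms(1-4) \<D>_carrier by blast+
qed

lemma finsum_two:
  assumes "r \<in> {..<2::nat} \<rightarrow>\<^sub>E \<D>"
  shows "finsum BA (\<lambda>i. r i \<odot>\<^bsub>BA\<^esub> (if i = 0 then phi0 else phi1)) {..<2} =
    (\<lambda>P\<in>nv. r 0 (phi0 P) \<oplus>\<^bsub>\<O>\<^esub> r 1 (phi1 P))"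
proof -
  interpret M: abelian_group BA by (rule BA_abelian_group)
  have r: "r 0 \<in> \<D>" "r 1 \<in> \<D>" by (rule PiE_mem[OF assms]; simp)+
  then have c: "r 0 \<odot>\<^bsub>BA\<^esub> phi0 \<in> carrier BA" "r 1 \<odot>\<^bsub>BA\<^esub> phi1 \<in> carrier BA"
    by (simp_all add: BA_smult_closed)
  have two: "{..<2::nat} = {0, 1}" by auto
  have "finsum BA (\<lambda>i. r i \<odot>\<^bsub>BA\<^esub> (if i = 0 then phi0 else phi1)) {..<2} = r 0 \<odot>\<^bsub>BA\<^esub> phi0 \<oplus>\<^bsub>BA\<^esub> r 1 \<odot>\<^bsub>BA\<^esub> phi1"
    unfolding two using c by (simp add: M.finsum_insert)
  also have "\<dots> = (\<lambda>P\<in>nv. r 0 (phi0 P) \<oplus>\<^bsub>\<O>\<^esub> r 1 (phi1 P))"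
    unfolding BA_add BA_smult by (rule restrict_ext) simp
  finally show ?thesis .
qed

lemma BA_basis: "module_basis (diff_ops p) BA 2 (\<lambda>i. if i = 0 then phi0 else phi1)"
  unfolding module_basis_def
proof (intro conjI ballI)
  show "\<forall>i<2. (if i = 0 then phi0 else phi1) \<in> carrier BA" by simp
next
  fix \<phi> assume \<phi>: "\<phi> \<in> carrier BA"
  obtain r0 r1 where r01: "r0 \<in> \<D>" "r1 \<in> \<D>" "\<And>P. P \<in> nv \<Longrightarrow> \<phi> P = r0 (phi0 P) \<oplus>\<^bsub>\<O>\<^esub> r1 (phi1 P)"
    using basis_exists[OF \<phi>] by blast
  define r where "r = (\<lambda>i\<in>{..<2::nat}. if i = 0 then r0 else r1)"
  have rD: "r \<in> {..<2} \<rightarrow>\<^sub>E \<D>" using r01(1,2) by (auto simp: r_def)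
  have car: "carrier (diff_ops p) = \<D>" by (simp add: diff_ops_eq)
  have fs: "\<phi> = finsum BA (\<lambda>i. s i \<odot>\<^bsub>BA\<^esub> (if i = 0 then phi0 else phi1)) {..<2} \<longleftrightarrow>
      (\<forall>P\<in>nv. \<phi> P = s 0 (phi0 P) \<oplus>\<^bsub>\<O>\<^esub> s 1 (phi1 P))" if "s \<in> {..<2} \<rightarrow>\<^sub>E \<D>" for s :: "nat \<Rightarrow> fun2 set \<Rightarrow> fun2 set"
  proof -
    show ?thesis
      unfolding finsum_two[OF that]
    proof
      assume eq: "\<phi> = (\<lambda>P\<in>nv. s 0 (phi0 P) \<oplus>\<^bsub>\<O>\<^esub> s 1 (phi1 P))"
      show "\<forall>P\<in>nv. \<phi> P = s 0 (phi0 P) \<oplus>\<^bsub>\<O>\<^esub> s 1 (phi1 P)"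
        by (subst eq) simp
    next
      assume "\<forall>P\<in>nv. \<phi> P = s 0 (phi0 P) \<oplus>\<^bsub>\<O>\<^esub> s 1 (phi1 P)"
      then show "\<phi> = (\<lambda>P\<in>nv. s 0 (phi0 P) \<oplus>\<^bsub>\<O>\<^esub> s 1 (phi1 P))"
        by (intro BA_eqI) (simp_all add: BA_extensional \<phi>)
    qed
  qed
  show "\<exists>!r. r \<in> {..<2::nat} \<rightarrow>\<^sub>E carrier (diff_ops p) \<and>
      \<phi> = finsum BA (\<lambda>i. r i \<odot>\<^bsub>BA\<^esub> (if i = 0 then phi0 else phi1)) {..<2}"
  proof (rule ex1I[of _ r])
    show "r \<in> {..<2} \<rightarrow>\<^sub>E carrier (diff_ops p) \<and> \<phi> = finsum BA (\<lambda>i. r i \<odot>\<^bsub>BA\<^esub> (if i = 0 then phi0 else phi1)) {..<2}"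
    proof
      show "r \<in> {..<2} \<rightarrow>\<^sub>E carrier (diff_ops p)" unfolding car by (rule rD)
      have "\<forall>P\<in>nv. \<phi> P = r 0 (phi0 P) \<oplus>\<^bsub>\<O>\<^esub> r 1 (phi1 P)"
        by (simp add: r_def r01(3))
      then show "\<phi> = finsum BA (\<lambda>i. r i \<odot>\<^bsub>BA\<^esub> (if i = 0 then phi0 else phi1)) {..<2}"
        using fs[OF rD] by blast
    qed
  next
    fix s :: "nat \<Rightarrow> fun2 set \<Rightarrow> fun2 set"
    assume s: "s \<in> {..<2} \<rightarrow>\<^sub>E carrier (diff_ops p) \<and> \<phi> = finsum BA (\<lambda>i. s i \<odot>\<^bsub>BA\<^esub> (if i = 0 then phi0 else phi1)) {..<2}"
    then have sD: "s \<in> {..<2} \<rightarrow>\<^sub>E \<D>" unfolding car by blast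
    have s01: "s 0 \<in> \<D>" "s 1 \<in> \<D>" by (rule PiE_mem[OF sD]; simp)+
    have eq: "s 0 (phi0 P) \<oplus>\<^bsub>\<O>\<^esub> s 1 (phi1 P) = r0 (phi0 P) \<oplus>\<^bsub>\<O>\<^esub> r1 (phi1 P)" if "P \<in> nv" for P
    proof -
      have "\<forall>P\<in>nv. \<phi> P = s 0 (phi0 P) \<oplus>\<^bsub>\<O>\<^esub> s 1 (phi1 P)"
        using s fs[OF sD] by blast
      then show ?thesis using r01(3)[OF that] that by simp
    qed
    have "s 0 = r0" "s 1 = r1"
      using basis_unique[OF s01 r01(1,2) eq] by blast+
    then show "s = r"
      by (intro PiE_ext[OF sD rD]) (auto simp: r_def less_2_cases_iff)
  qed
qed

end

section \<open>Solving the gluing conditions for the coefficients\<close>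

theorem theorem2:
  fixes B \<alpha> \<beta> \<gamma> \<delta> \<alpha>1 \<beta>1 \<gamma>1 \<delta>1 c1 \<alpha>2 \<beta>2 \<gamma>2 \<delta>2 c2 \<Lambda> x0 y0 :: complex
    and g g1 g2 :: form
  assumes "B \<noteq> 0"
    and "g = bilinear_form \<alpha> \<beta> \<gamma> \<delta>"
    and "g1 = bilinear_form \<alpha>1 \<beta>1 \<gamma>1 \<delta>1"
    and "g2 = bilinear_form \<alpha>2 \<beta>2 \<gamma>2 \<delta>2"
    and "\<And>t1 t2. g 1 0 t1 t2 - B * g t1 t2 0 1 = 0"
    and "g 0 1 0 1 \<noteq> 0"
    and "\<And>t1 t2. g1 1 0 t1 t2 - B * g1 t1 t2 0 1 - c1 * g 1 0 t1 t2 = 0"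
    and "\<And>t1 t2. g2 1 0 t1 t2 - B * g2 t1 t2 0 1 - c2 * g 1 0 t1 t2 = 0"
    and "\<And>a b c. (\<And>z1 z2 w1 w2. a * g z1 z2 w1 w2 + b * g1 z1 z2 w1 w2 + c * g2 z1 z2 w1 w2 = 0)
           \<Longrightarrow> a = 0 \<and> b = 0 \<and> c = 0"
    and "(\<gamma> * \<delta>1 - \<gamma>1 * \<delta>)\<^sup>2 + 2 * \<gamma> * \<delta> * c1 * (\<gamma> * \<delta>1 - \<gamma>1 * \<delta>)
           + \<delta>\<^sup>2 * (\<gamma> - 2 * B * \<delta>)\<^sup>2 * c1\<^sup>2 \<noteq> 0"
    and "(\<gamma> * \<delta>2 - \<gamma>2 * \<delta>)\<^sup>2 + 2 * \<gamma> * \<delta> * c2 * (\<gamma> * \<delta>2 - \<gamma>2 * \<delta>)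
           + \<delta>\<^sup>2 * (\<gamma> - 2 * B * \<delta>)\<^sup>2 * c2\<^sup>2 \<noteq> 0"
    and "\<Lambda> \<noteq> exp (c1 * x0 + c2 * y0)"
  shows "left_module (diff_ops (x0, y0)) (BA_module g g1 g2 \<Lambda> (x0, y0)) \<and>
    (\<exists>\<phi>. (\<forall>i<2. \<phi> i \<in> BA_space g g1 g2 \<Lambda> (x0, y0) 1) \<and>
         module_basis (diff_ops (x0, y0)) (BA_module g g1 g2 \<Lambda> (x0, y0)) 2 \<phi>)"
proof -
  have \<delta>: "\<delta> \<noteq> 0"
    using assms(6) by (simp add: assms(2) bilinear_form_def)
  have ab: "\<beta> = B * \<delta>" "\<alpha> = B\<^sup>2 * \<delta>"
    using assms(5)[of 0 1] assms(5)[of 1 0]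
    by (simp_all add: assms(2) bilinear_form_def power2_eq_square)
  define k1 k2 e1 e2 where "k1 = \<delta>1 / \<delta>" and "k2 = \<delta>2 / \<delta>"
    and "e1 = \<gamma>1 - k1 * \<gamma>" and "e2 = \<gamma>2 - k2 * \<gamma>"
  have k: "\<delta>1 = k1 * \<delta>" "\<delta>2 = k2 * \<delta>" using \<delta> by (simp_all add: k1_def k2_def)
  have b1: "\<beta>1 = B * \<delta>1 + c1 * \<beta>" "\<alpha>1 = B * \<beta>1 + c1 * \<alpha>"
    using assms(7)[of 0 1] assms(7)[of 1 0]
    by (simp_all add: assms(2,3) bilinear_form_def algebra_simps)
  have b2: "\<beta>2 = B * \<delta>2 + c2 * \<beta>" "\<alpha>2 = B * \<beta>2 + c2 * \<alpha>"
    using assms(8)[of 0 1] assms(8)[of 1 0]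
    by (simp_all add: assms(2,4) bilinear_form_def algebra_simps)
  have g: "g = bilinear_form (B\<^sup>2 * \<delta>) (B * \<delta>) \<gamma> \<delta>"
    by (simp add: assms(2) ab)
  have "\<alpha>1 = k1 * (B\<^sup>2 * \<delta>) + 2 * B\<^sup>2 * c1 * \<delta>" "\<beta>1 = k1 * (B * \<delta>) + B * c1 * \<delta>"
    "\<gamma>1 = k1 * \<gamma> + e1"
    unfolding b1 ab k e1_def by (simp_all add: algebra_simps power2_eq_square)
  then have g1: "g1 = bilinear_form (k1 * (B\<^sup>2 * \<delta>) + 2 * B\<^sup>2 * c1 * \<delta>) (k1 * (B * \<delta>) + B * c1 * \<delta>) (k1 * \<gamma> + e1) (k1 * \<delta>)"
    by (simp only: assms(3) k)
  have "\<alpha>2 = k2 * (B\<^sup>2 * \<delta>) + 2 * B\<^sup>2 * c2 * \<delta>" "\<beta>2 = k2 * (B * \<delta>) + B * c2 * \<delta>"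
    "\<gamma>2 = k2 * \<gamma> + e2"
    unfolding b2 ab k e2_def by (simp_all add: algebra_simps power2_eq_square)
  then have g2: "g2 = bilinear_form (k2 * (B\<^sup>2 * \<delta>) + 2 * B\<^sup>2 * c2 * \<delta>) (k2 * (B * \<delta>) + B * c2 * \<delta>) (k2 * \<gamma> + e2) (k2 * \<delta>)"
    by (simp only: assms(4) k)
  \<comment> \<open>Modulo \<open>g\<close> the forms \<open>g\<^sub>i\<close> are combinations of the numerators of \<open>u\<close> and \<open>v\<close>, with coefficients \<open>c\<^sub>i \<delta>\<close> and \<open>e\<^sub>i\<close>.\<close>
  have comb: "(- (b * k1 + c * k2)) * g z1 z2 w1 w2 + b * g1 z1 z2 w1 w2 + c * g2 z1 z2 w1 w2 =
      (b * c1 + c * c2) * (\<delta> * (2 * B\<^sup>2 * z1 * w1 + B * z1 * w2)) + (b * e1 + c * e2) * (z2 * w1)" for b c z1 z2 w1 w2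
    by (simp add: g g1 g2 bilinear_form_def algebra_simps)
  have indep: "b = 0 \<and> c = 0" if "b * c1 + c * c2 = 0" "b * e1 + c * e2 = 0" for b c
    using assms(9)[of "- (b * k1 + c * k2)" b c] unfolding comb that by simp
  have "c1 * e2 - c2 * e1 \<noteq> 0"
  proof
    assume 0: "c1 * e2 - c2 * e1 = 0"
    have "c2 = 0 \<and> - c1 = 0"
      by (rule indep) (use 0 in \<open>simp_all add: algebra_simps\<close>)
    moreover have "e2 = 0 \<and> - e1 = 0"
      by (rule indep) (use 0 in \<open>simp_all add: algebra_simps\<close>)
    ultimately show False using indep[of 1 0] by simp
  qed
  then interpret glued_surface "(x0, y0)" B \<gamma> \<delta> k1 k2 e1 e2 c1 c2 \<Lambda> g g1 g2
    using assms(1,12) \<delta> g g1 g2 by unfold_locales simp_all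
  show ?thesis
    using BA_left_module BA_basis phi0_BA phi1_BA
    by (intro conjI exI[of _ "\<lambda>i. if i = 0 then phi0 else phi1"]) simp_all
qed

end
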